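(* Let $m,\lambda:\mathbb{R}_+\to\mathbb{R}_+$ be continuous, let $0\le a^-,b^+\in C_b(\mathbb{R}^d)$, and let $a^+$ be a probability density on $\mathbb{R}^d$. Assume that $a^--b^+$ is a stable potential, i.e. there is a constant $b\ge0$ with $$\sum_{x\in\eta}\sum_{y\in\eta\backslash x}(a^-(x-y)-b^+(x-y))\ge-b|\eta|,\qquad\eta\in\Gamma_0.$$ Suppose that for any compact $\Lambda\subset\mathbb{R}^d$ there exists $a^*\in L^1(\mathbb{R}^d)$ with $a^+(x-w)\le a^*(w)$ for all $x\in\Lambda$, $w\in\mathbb{R}^d$. Consider on $\Gamma_0$ the transition function $$Q(t,\eta,A)=\sum_{x\in\eta}\Big(m(t)+\sum_{y\in\eta\backslash x}a^-(x-y)\Big)\mathbf{1}_A(\eta\backslash x)+\sum_{x\in\eta}\Big(\lambda(t)+\sum_{y\in\eta\backslash x}b^+(x-y)\Big)\int_{\mathbb{R}^d}\mathbf{1}_A(\eta\cup w)a^+(x-w)\,dw,$$ and let $q(t,\eta)=Q(t,\eta,\Gamma_0)$. Then the following conditions are satisfied for $V(\eta)=|\eta|+|\eta|^2$: (A) For any $\varepsilon>0$, $T>0$ and any compact $B\subset\Gamma_0$ there exists a compact $A\subset\Gamma_0$ such that $\int_0^TQ(r,\eta,A^c)\,dr<\varepsilon$ for all $\eta\in B$. (B) There exists a continuous function $c:\mathbb{R}_+\to\mathbb{R}_+$ such that $\int_{\Gamma_0}V(\omega)\,Q(t,\eta,d\omega)\le c(t)V(\eta)+q(t,\eta)V(\eta)$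 for all $t\ge0$, $\eta\in\Gamma_0$. (C) For any continuous $F:\Gamma_0\to\mathbb{R}$ with $\sup_{\eta\in\Gamma_0}\frac{|F(\eta)|}{1+V(\eta)}<\infty$ the map $(t,\eta)\mapsto\int_{\Gamma_0}F(\omega)\,Q(t,\eta,d\omega)$ is continuous. (D) For any $T>0$ there exists $a(T)>0$ such that $q(t,\eta)\le a(T)V(\eta)$ for all $\eta\in\Gamma_0$ and $t\in[0,T]$. Moreover, for any $n\ge1$ and any probability measure $\mu$ on $\Gamma_0$ with $\int_{\Gamma_0}|\eta|^n\mu(d\eta)<\infty$, the evolution of states satisfies $\int_{\Gamma_0}|\eta|^n\,U^*(t,s)\mu(d\eta)<\infty$ for all $0\le s\le t$. If in addition $m(t),\lambda(t)>0$ for all $t\ge0$, then (E) for any $T>0$ there exists $b(T)>0$ such that $q(t,\eta)\ge b(T)q(T,\eta)$ for all $\eta\in\Gamma_0$ and $t\in[0,T]$, holds, and $U^*(t,s)$ leaves the space of densities $L^1(\Gamma_0,d\lambda_{LP})$ invariant.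
   Context: $\Gamma_0=\{\eta\subset\mathbb{R}^d : |\eta|<\infty\}=\bigsqcup_{n\ge0}\Gamma_0^{(n)}$ is the space of finite subsets of $\mathbb{R}^d$, where $|\eta|$ is the cardinality and $\Gamma_0^{(n)}=\{|\eta|=n\}$. $\Gamma_0^{(n)}$ carries the quotient topology under $(x_1,\dots,x_n)\mapsto\{x_1,\dots,x_n\}$ from the set of $n$-tuples of pairwise distinct points, and $\Gamma_0$ the disjoint union topology; it is a locally compact Polish space with Borel $\sigma$-algebra $\mathcal{B}(\Gamma_0)$. We write $\eta\backslash x$, $\eta\cup x$ for $\eta\backslash\{x\}$, $\eta\cup\{x\}$. $\lambda_{LP}=\delta_\emptyset+\sum_{n\ge1}\frac1{n!}d^{(n)}x$ is the Lebesgue-Poisson measure, where $d^{(n)}x$ is the image on $\Gamma_0^{(n)}$ of Lebesgue measure on $(\mathbb{R}^d)^n$ under $(x_1,\dots,x_n)\mapsto\{x_1,\dots,x_n\}$. $L^1(\Gamma_0,d\lambda_{LP})$ is identified with a subspace of the finite signed Borel measures via $R\mapsto R\,d\lambda_{LP}$. The (pre-)generator of this (Dieckmann-Law) model is $L(t)F(\eta)=\int_{\Gamma_0}(F(\omega)-F(\eta))\,Q(t,\eta,d\omega)$. Let $P=\sum_{n\ge0}P^{(n)}$ with $P^{(0)}(s,\eta;t,A)=\mathbf{1}_A(\eta)e^{-\int_s^tq(r,\eta)dr}$ and, for $n\ge0$, $P^{(n+1)}(s,\eta;t,A)=\int_s^te^{-\int_s^rq(\tau,\eta)d\tau}\int_{\Gamma_0}P^{(n)}(r,\omega;t,A)Q(r,\eta,d\omega)\,dr$.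 The evolution of states is $U^*(t,s)\mu(A)=\int_{\Gamma_0}P(s,\eta;t,A)\,\mu(d\eta)$, $0\le s\le t$, for finite signed Borel measures $\mu$ on $\Gamma_0$. *)

theory Defs
  imports "HOL-Probability.Probability"
begin

section \<open>Finite configurations\<close>

definition Gamma0 :: "'a::euclidean_space set set" where
  "Gamma0 = {\<eta>. finite \<eta>}"

definition Gamma0_n :: "nat \<Rightarrow> 'a::euclidean_space set set" where
  "Gamma0_n n = {\<eta>. finite \<eta> \<and> card \<eta> = n}"

text \<open>An $n$-tuple of points is an extensional function on \<^term>\<open>{..<n}\<close>, and
  \<^term>\<open>\<lambda>x. x ` {..<n}\<close> is the map $(x_1,\dots,x_n) \mapsto \{x_1,\dots,x_n\}$.\<close>

definition distinct_tuples :: "nat \<Rightarrow> (nat \<Rightarrow> 'a::euclidean_space) set" where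
  "distinct_tuples n = {x \<in> {..<n} \<rightarrow>\<^sub>E UNIV. inj_on x {..<n}}"

definition tuple_topology :: "nat \<Rightarrow> (nat \<Rightarrow> 'a::euclidean_space) topology" where
  "tuple_topology n =
     subtopology (product_topology (\<lambda>_. euclidean) {..<n}) (distinct_tuples n)"

definition Gamma0_n_topology :: "nat \<Rightarrow> 'a::euclidean_space set topology" where
  "Gamma0_n_topology n = topology (\<lambda>U. U \<subseteq> Gamma0_n n \<and>
     openin (tuple_topology n) {x \<in> distinct_tuples n. x ` {..<n} \<in> U})"

definition Gamma0_topology :: "'a::euclidean_space set topology" where
  "Gamma0_topology = topology (\<lambda>U. U \<subseteq> Gamma0 \<and>
     (\<forall>n. openin (Gamma0_n_topology n) (U \<inter> Gamma0_n n)))"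

lemma topspace_tuple_topology: "topspace (tuple_topology n) = distinct_tuples n"
  unfolding tuple_topology_def topspace_subtopology topspace_product_topology distinct_tuples_def
  by (simp, blast)

lemma image_distinct_tuples:
  "(\<lambda>x. x ` {..<n}) ` distinct_tuples n = (Gamma0_n n :: 'a::euclidean_space set set)"
proof
  show "(\<lambda>x. x ` {..<n}) ` distinct_tuples n \<subseteq> (Gamma0_n n :: 'a set set)"
  proof (rule image_subsetI)
    fix x :: "nat \<Rightarrow> 'a" assume "x \<in> distinct_tuples n"
    then have "inj_on x {..<n}" unfolding distinct_tuples_def by blast
    then show "x ` {..<n} \<in> Gamma0_n n" unfolding Gamma0_n_def by (simp add: card_image)
  qed
  show "(Gamma0_n n :: 'a set set) \<subseteq> (\<lambda>x. x ` {..<n}) ` distinct_tuples n"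
  proof
    fix \<eta> :: "'a set" assume "\<eta> \<in> Gamma0_n n"
    then have "finite \<eta>" "card \<eta> = n" by (simp_all add: Gamma0_n_def)
    then obtain h where h: "bij_betw h {..<n} \<eta>"
      using ex_bij_betw_nat_finite[of \<eta>] by (metis atLeast0LessThan)
    have "inj_on (restrict h {..<n}) {..<n}"
      using bij_betw_imp_inj_on[OF h] by (simp add: inj_on_restrict_eq)
    then have "restrict h {..<n} \<in> distinct_tuples n"
      unfolding distinct_tuples_def by simp
    moreover have "restrict h {..<n} ` {..<n} = \<eta>"
      using bij_betw_imp_surj_on[OF h] by simp
    ultimately show "\<eta> \<in> (\<lambda>x. x ` {..<n}) ` distinct_tuples n" by blast
  qed
qed

lemma openin_Gamma0_n_topology:
  fixes U :: "'a::euclidean_space set set"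
  shows "openin (Gamma0_n_topology n) U \<longleftrightarrow>
     U \<subseteq> Gamma0_n n \<and> openin (tuple_topology n) {x \<in> distinct_tuples n. x ` {..<n} \<in> U}"
proof -
  have "istopology (\<lambda>U :: 'a set set. U \<subseteq> Gamma0_n n \<and>
     openin (tuple_topology n) {x \<in> distinct_tuples n. x ` {..<n} \<in> U})"
  proof -
    have 1: "{x \<in> distinct_tuples n. x ` {..<n} \<in> S \<inter> T} =
        {x \<in> distinct_tuples n. x ` {..<n} \<in> S} \<inter> {x \<in> distinct_tuples n. x ` {..<n} \<in> T}"
      for S T :: "'a set set" by auto
    have 2: "{x \<in> distinct_tuples n. x ` {..<n} \<in> \<Union>K} =
        (\<Union>U\<in>K. {x \<in> distinct_tuples n. x ` {..<n} \<in> U})" for K :: "'a set set set" by auto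
    show ?thesis unfolding istopology_def 1 2
      by (intro conjI allI impI openin_Int openin_Union) auto
  qed
  then show ?thesis by (simp add: Gamma0_n_topology_def)
qed

lemma topspace_Gamma0_n_topology:
  "topspace (Gamma0_n_topology n) = (Gamma0_n n :: 'a::euclidean_space set set)"
proof
  show "topspace (Gamma0_n_topology n) \<subseteq> (Gamma0_n n :: 'a set set)"
    using openin_topspace[of "Gamma0_n_topology n :: 'a set topology"]
    unfolding openin_Gamma0_n_topology by (rule conjunct1)
  have "{x \<in> distinct_tuples n. x ` {..<n} \<in> Gamma0_n n} =
      topspace (tuple_topology n :: (nat \<Rightarrow> 'a) topology)"
    using image_distinct_tuples by (fastforce simp: topspace_tuple_topology)
  then have "openin (Gamma0_n_topology n) (Gamma0_n n :: 'a set set)"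
    unfolding openin_Gamma0_n_topology by simp
  then show "(Gamma0_n n :: 'a set set) \<subseteq> topspace (Gamma0_n_topology n)"
    by (rule openin_subset)
qed

lemma quotient_map_Gamma0_n:
  "quotient_map (tuple_topology n) (Gamma0_n_topology n) (\<lambda>x. x ` {..<n})"
  unfolding quotient_map_def topspace_tuple_topology topspace_Gamma0_n_topology
    openin_Gamma0_n_topology
  using image_distinct_tuples by blast

lemma openin_Gamma0_topology:
  fixes U :: "'a::euclidean_space set set"
  shows "openin Gamma0_topology U \<longleftrightarrow>
     U \<subseteq> Gamma0 \<and> (\<forall>n. openin (Gamma0_n_topology n) (U \<inter> Gamma0_n n))"
proof -
  have "istopology (\<lambda>U :: 'a set set. U \<subseteq> Gamma0 \<and>
     (\<forall>n. openin (Gamma0_n_topology n) (U \<inter> Gamma0_n n)))"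
  proof -
    have "openin (Gamma0_n_topology n) (S \<inter> T \<inter> Gamma0_n n)"
      if "openin (Gamma0_n_topology n) (S \<inter> Gamma0_n n)"
        and "openin (Gamma0_n_topology n) (T \<inter> Gamma0_n n)" for S T :: "'a set set" and n
      using openin_Int[OF that] by (simp add: Int_ac)
    moreover have "openin (Gamma0_n_topology n) (\<Union>K \<inter> Gamma0_n n)"
      if "\<forall>U\<in>K. openin (Gamma0_n_topology n) (U \<inter> Gamma0_n n)" for K :: "'a set set set" and n
    proof -
      have "\<Union>K \<inter> Gamma0_n n = (\<Union>U\<in>K. U \<inter> Gamma0_n n)" by auto
      with that show ?thesis by (metis (mono_tags, lifting) imageE openin_Union)
    qed
    ultimately show ?thesis unfolding istopology_def by (intro conjI allI impI) auto
  qed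
  then show ?thesis by (simp add: Gamma0_topology_def)
qed

lemma topspace_Gamma0_topology:
  "topspace Gamma0_topology = (Gamma0 :: 'a::euclidean_space set set)"
proof
  show "topspace Gamma0_topology \<subseteq> (Gamma0 :: 'a set set)"
    using openin_topspace[of "Gamma0_topology :: 'a set topology"]
    unfolding openin_Gamma0_topology by (rule conjunct1)
  have "Gamma0 \<inter> Gamma0_n n = topspace (Gamma0_n_topology n :: 'a set topology)" for n
    unfolding topspace_Gamma0_n_topology by (auto simp: Gamma0_def Gamma0_n_def)
  then have "openin Gamma0_topology (Gamma0 :: 'a set set)"
    unfolding openin_Gamma0_topology by simp
  then show "(Gamma0 :: 'a set set) \<subseteq> topspace Gamma0_topology"
    by (rule openin_subset)
qed

definition Gamma0_borel :: "'a::euclidean_space set measure" where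
  "Gamma0_borel = sigma Gamma0 {U. openin Gamma0_topology U}"

lemma sets_Gamma0_borel: "sets Gamma0_borel = sigma_sets Gamma0 {U. openin Gamma0_topology U}"
  unfolding Gamma0_borel_def
  by (rule sets_measure_of) (auto simp: openin_Gamma0_topology)

lemma space_Gamma0_borel: "space Gamma0_borel = Gamma0"
  unfolding Gamma0_borel_def
  by (rule space_measure_of) (auto simp: openin_Gamma0_topology)

section \<open>Lebesgue-Poisson measure\<close>

text \<open>The diagonals, where the points of a tuple are not pairwise distinct, are Lebesgue null
  sets; they are removed so that the image measure lives on \<^term>\<open>Gamma0_n n\<close>.\<close>

definition lebesgue_image :: "nat \<Rightarrow> 'a::euclidean_space set measure" where
  "lebesgue_image n =
     distr (restrict_space (Pi\<^sub>M {..<n} (\<lambda>_. lborel)) (distinct_tuples n))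
       Gamma0_borel (\<lambda>x. x ` {..<n})"

definition lambda_LP :: "'a::euclidean_space set measure" where
  "lambda_LP = measure_of Gamma0 (sets Gamma0_borel)
     (\<lambda>A. indicator A {} +
          (\<Sum>n. ennreal (1 / fact (Suc n)) * emeasure (lebesgue_image (Suc n)) A))"

section \<open>The transition function of the Dieckmann-Law model\<close>

definition DL_rate ::
  "(real \<Rightarrow> real) \<Rightarrow> (real \<Rightarrow> real) \<Rightarrow> ('a::euclidean_space \<Rightarrow> real) \<Rightarrow> ('a \<Rightarrow> real) \<Rightarrow>
   ('a \<Rightarrow> real) \<Rightarrow> real \<Rightarrow> 'a set \<Rightarrow> 'a set set \<Rightarrow> ennreal" where
  "DL_rate m l am bp ap t \<eta> A =
     (\<Sum>x\<in>\<eta>. ennreal (m t + (\<Sum>y\<in>\<eta> - {x}. am (x - y))) * indicator A (\<eta> - {x})) +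
     (\<Sum>x\<in>\<eta>. ennreal (l t + (\<Sum>y\<in>\<eta> - {x}. bp (x - y))) *
        (\<integral>\<^sup>+ w. indicator A (\<eta> \<union> {w}) * ennreal (ap (x - w)) \<partial>lebesgue))"

definition DL_kernel ::
  "(real \<Rightarrow> real) \<Rightarrow> (real \<Rightarrow> real) \<Rightarrow> ('a::euclidean_space \<Rightarrow> real) \<Rightarrow> ('a \<Rightarrow> real) \<Rightarrow>
   ('a \<Rightarrow> real) \<Rightarrow> real \<Rightarrow> 'a set \<Rightarrow> 'a set measure" where
  "DL_kernel m l am bp ap t \<eta> =
     measure_of Gamma0 (sets Gamma0_borel) (DL_rate m l am bp ap t \<eta>)"

definition total_rate ::
  "(real \<Rightarrow> 'a::euclidean_space set \<Rightarrow> 'a set measure) \<Rightarrow> real \<Rightarrow> 'a set \<Rightarrow> real" where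
  "total_rate Q t \<eta> = measure (Q t \<eta>) Gamma0"

section \<open>Minimal transition function and evolution of states\<close>

primrec P_n ::
  "nat \<Rightarrow> (real \<Rightarrow> 'a::euclidean_space set \<Rightarrow> 'a set measure) \<Rightarrow>
   real \<Rightarrow> 'a set \<Rightarrow> real \<Rightarrow> 'a set set \<Rightarrow> ennreal" where
  "P_n 0 Q s \<eta> t A =
     indicator A \<eta> * ennreal (exp (- (LINT r:{s..t}|lborel. total_rate Q r \<eta>)))"
| "P_n (Suc n) Q s \<eta> t A =
     (\<integral>\<^sup>+ r\<in>{s..t}. (ennreal (exp (- (LINT \<tau>:{s..r}|lborel. total_rate Q \<tau> \<eta>))) *
        (\<integral>\<^sup>+ \<omega>. P_n n Q r \<omega> t A \<partial>Q r \<eta>)) \<partial>lborel)"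

definition P_min ::
  "(real \<Rightarrow> 'a::euclidean_space set \<Rightarrow> 'a set measure) \<Rightarrow>
   real \<Rightarrow> 'a set \<Rightarrow> real \<Rightarrow> 'a set set \<Rightarrow> ennreal" where
  "P_min Q s \<eta> t A = (\<Sum>n. P_n n Q s \<eta> t A)"

text \<open>A finite signed measure on \<^term>\<open>M\<close> is represented by its real-valued set function on
  \<^term>\<open>sets M\<close>. Integration goes through the Jordan decomposition, whose positive and negative
  parts send \<^term>\<open>A\<close> to the supremum of \<^term>\<open>\<nu> B\<close>, respectively of \<^term>\<open>- \<nu> B\<close>,
  over measurable \<^term>\<open>B \<subseteq> A\<close>.\<close>

definition positive_part :: "'b measure \<Rightarrow> ('b set \<Rightarrow> real) \<Rightarrow> 'b measure" where
  "positive_part M \<nu> = measure_of (space M) (sets M)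
     (\<lambda>A. SUP B\<in>{B \<in> sets M. B \<subseteq> A}. ennreal (\<nu> B))"

definition signed_integral :: "'b measure \<Rightarrow> ('b set \<Rightarrow> real) \<Rightarrow> ('b \<Rightarrow> real) \<Rightarrow> real" where
  "signed_integral M \<nu> f =
     (LINT x|positive_part M \<nu>. f x) - (LINT x|positive_part M (\<lambda>A. - \<nu> A). f x)"

definition U_star ::
  "(real \<Rightarrow> 'a::euclidean_space set \<Rightarrow> 'a set measure) \<Rightarrow> real \<Rightarrow> real \<Rightarrow>
   ('a set set \<Rightarrow> real) \<Rightarrow> 'a set set \<Rightarrow> real" where
  "U_star Q t s \<nu> A = signed_integral Gamma0_borel \<nu> (\<lambda>\<eta>. enn2real (P_min Q s \<eta> t A))"

end

theory Submission
  imports Defs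
begin

text \<open>
The topology of the configuration space enters only through one elementary description: a set of
configurations is open iff with each of its members \<open>\<eta>\<close> it contains every configuration obtained by
moving the points of \<open>\<eta>\<close> by less than some \<open>\<epsilon>\<close> (\<open>openin_Gamma0_iff\<close>). Hence continuity can be
tested along \<open>f k ` \<eta>\<close> with \<open>f k x\<close> tending to \<open>x\<close>, and the Borel \<open>\<sigma>\<close>-algebra is generated by
the numbers of points in open sets (\<open>measurable_into_Gamma0\<close>), so that adding a point, removing a
point and summing over the points of a configuration are measurable operations.

Writing the position of a newborn point as \<open>x - v\<close> turns the density of the dispersal kernel into
one fixed probability law \<open>\<alpha>\<close> of displacements \<open>v\<close>, and the integral against \<open>Q t \<eta>\<close> into a finite
sum \<open>Qint\<close> over the points of \<open>\<eta>\<close>. Then (D) and (E) are estimates of finite sums. (A) holds because a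
compact set of configurations has bounded cardinality, bounded support and a uniform separation of
points; these survive a death, and a birth destroys them only if \<open>v\<close> is far away or falls in one
of finitely many tiny balls, which has small probability since \<open>\<alpha>\<close> is tight and has no atoms. (C) is
dominated convergence under \<open>\<alpha>\<close>: for \<open>\<alpha>\<close>-almost every \<open>v\<close> the point \<open>x - v\<close> is not in \<open>\<eta>\<close>, and there
insertion of the new point is continuous.

(B) and the moment bounds rest on stability. It says that the total birth rate exceeds the total
death rate by at most a multiple of \<open>card \<eta>\<close> (\<open>birth_le_death\<close>), although both are quadratic in
\<open>card \<eta>\<close>. In the drift of a power of the cardinality the two quadratic rates therefore cancel to
leading order, and what remains is of the order of that power itself: \<open>W = card ^ n\<close> satisfies
\<open>Qint r \<eta> W \<le> (c + jump_rate r \<eta>) * W \<eta>\<close>. For every such \<open>W\<close>, the sum of the first \<open>N\<close> terms of the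
minimal transition function, applied to \<open>W\<close>, is at most \<open>exp (c * (t - s)) * W \<eta>\<close>. This follows by
induction on \<open>N\<close>, because the majorant is reproduced exactly by the recursion
(\<open>survival_balance\<close>, \<open>Pint_supermartingale\<close>). With \<open>W = 1\<close> and \<open>c = 0\<close> it shows that the transition
function is sub-Markovian, so that it transports finite measures to finite measures, and \<open>U_star\<close> of a
signed measure is the difference of the transported positive and negative parts
(\<open>U_star_eq_transport\<close>).

For the invariance of densities it suffices that transported densities do not charge
Lebesgue-Poisson null sets, by the Radon-Nikodym theorem. If \<open>N\<close> is a null set, then almost every
tuple stays outside \<open>N\<close> when a coordinate is deleted, or when almost any coordinate is added; since
\<open>\<alpha>\<close> has a density, \<open>Q t \<eta> N = 0\<close> for almost all \<open>\<eta>\<close> (\<open>Qint_lambda_LP_null\<close>). Tonelli's theorem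
carries this through the time integrals of the recursion (\<open>Pint_lambda_LP_null\<close>).
\<close>

section \<open>Topology and Borel structure of the configuration space\<close>

text \<open>Neighbourhoods by matching: the bijection plays the role of an optimal pairing of the points, so this
is a ball for the bottleneck distance between configurations of equal cardinality.\<close>

definition near :: "'a::euclidean_space set \<Rightarrow> real \<Rightarrow> 'a set set" where
  "near \<eta> \<epsilon> = {\<omega>. \<exists>f. bij_betw f \<eta> \<omega> \<and> (\<forall>x\<in>\<eta>. dist (f x) x < \<epsilon>)}"

lemma near_Gamma0: "\<eta> \<in> Gamma0 \<Longrightarrow> \<omega> \<in> near \<eta> \<epsilon> \<Longrightarrow> \<omega> \<in> Gamma0"
  unfolding near_def Gamma0_def using bij_betw_finite by blast

lemma near_card: "\<omega> \<in> near \<eta> \<epsilon> \<Longrightarrow> card \<omega> = card \<eta>"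
  unfolding near_def using bij_betw_same_card by fastforce

lemma near_self: "\<epsilon> > 0 \<Longrightarrow> \<eta> \<in> near \<eta> \<epsilon>"
  unfolding near_def by (auto intro!: exI[of _ id])

text \<open>For a property that persists when the radius shrinks, finitely many radii can be replaced by their
minimum; the extra \<open>1\<close> below covers the empty set.\<close>

lemma finite_uniform_radius:
  assumes "finite S" "\<And>x. x \<in> S \<Longrightarrow> \<exists>e>0::real. P x e"
    "\<And>x d e. P x e \<Longrightarrow> 0 < d \<Longrightarrow> d \<le> e \<Longrightarrow> P x d"
  shows "\<exists>e>0. \<forall>x\<in>S. P x e"
proof -
  from assms(2) obtain e where e: "\<And>x. x \<in> S \<Longrightarrow> e x > 0 \<and> P x (e x)" by metis
  let ?d = "Min (insert 1 (e ` S))"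
  have "?d > 0" using assms(1) e by (subst Min_gr_iff) auto
  moreover have "P x ?d" if "x \<in> S" for x
    using e[OF that] \<open>?d > 0\<close> assms(1) that by (rule_tac assms(3)[of x "e x"]) (auto intro: Min_le)
  ultimately show ?thesis by blast
qed

text \<open>The numbering of the points cancels out: a neighbourhood of a tuple moves each coordinate a little, and
composing with the numbering turns such a motion into a bijection of configurations, and conversely.\<close>

lemma openin_Gamma0_iff:
  fixes U :: "'a::euclidean_space set set"
  shows "openin Gamma0_topology U \<longleftrightarrow>
    U \<subseteq> Gamma0 \<and> (\<forall>\<eta>\<in>U. \<exists>\<epsilon>>0. near \<eta> \<epsilon> \<subseteq> U)" (is "_ \<longleftrightarrow> _ \<and> ?R")
proof (intro iffI conjI ballI)
  assume o: "openin Gamma0_topology U"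
  then show "U \<subseteq> Gamma0" by (simp add: openin_Gamma0_topology)
  fix \<eta> assume \<eta>: "\<eta> \<in> U"
  define n where "n = card \<eta>"
  have fin: "finite \<eta>" using \<eta> \<open>U \<subseteq> Gamma0\<close> by (auto simp: Gamma0_def)
  have \<eta>n: "\<eta> \<in> Gamma0_n n" using fin by (simp add: Gamma0_n_def n_def)
  then obtain x where x: "x \<in> distinct_tuples n" "x ` {..<n} = \<eta>"
    using image_distinct_tuples[of n, where ?'a='a] by (metis (lifting) image_iff)
  have "openin (tuple_topology n) {x \<in> distinct_tuples n. x ` {..<n} \<in> U \<inter> Gamma0_n n}"
    using o unfolding openin_Gamma0_topology openin_Gamma0_n_topology by blast
  then obtain T where T: "openin (product_topology (\<lambda>_. euclidean) {..<n}) T"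
    "{x \<in> distinct_tuples n. x ` {..<n} \<in> U \<inter> Gamma0_n n} = T \<inter> distinct_tuples n"
    unfolding tuple_topology_def openin_subtopology by blast
  have "x \<in> T" using T(2) x \<eta> \<eta>n by blast
  then obtain W where W: "\<And>i. i < n \<Longrightarrow> open (W i)" "x \<in> Pi\<^sub>E {..<n} W" "Pi\<^sub>E {..<n} W \<subseteq> T"
    using T(1) unfolding openin_product_topology_alt by (auto, metis lessThan_iff)
  have "\<exists>e>0. \<forall>i\<in>{..<n}. ball (x i) e \<subseteq> W i"
  proof (rule finite_uniform_radius)
    show "\<exists>e>0. ball (x i) e \<subseteq> W i" if "i \<in> {..<n}" for i
      using W that by (meson PiE_mem lessThan_iff openE)
  qed auto
  then obtain e where e: "e > 0" "\<And>i. i < n \<Longrightarrow> ball (x i) e \<subseteq> W i" by auto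
  have "near \<eta> e \<subseteq> U"
  proof
    fix \<omega> assume "\<omega> \<in> near \<eta> e"
    then obtain f where f: "bij_betw f \<eta> \<omega>" "\<And>x. x \<in> \<eta> \<Longrightarrow> dist (f x) x < e"
      by (auto simp: near_def)
    define y where "y = restrict (f \<circ> x) {..<n}"
    have "inj_on x {..<n}" using x by (auto simp: distinct_tuples_def)
    then have "inj_on y {..<n}"
      using f(1) x(2) unfolding y_def inj_on_restrict_eq by (intro comp_inj_on) (auto simp: bij_betw_def)
    then have yd: "y \<in> distinct_tuples n" by (simp add: distinct_tuples_def y_def)
    have "y ` {..<n} = \<omega>" using f(1) x(2) by (auto simp: y_def bij_betw_def image_comp)
    moreover have "y \<in> Pi\<^sub>E {..<n} W"
    proof (rule PiE_I)
      fix i assume "i \<in> {..<n}"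
      then have "i < n" "x i \<in> \<eta>" using x(2) by auto
      then show "y i \<in> W i" using f(2)[of "x i"] e(2)[of i]
        by (auto simp: y_def subset_eq dist_commute)
    qed (simp add: y_def)
    ultimately show "\<omega> \<in> U" using T(2) W(3) yd by blast
  qed
  then show "\<exists>\<epsilon>>0. near \<eta> \<epsilon> \<subseteq> U" using e(1) by blast
next
  assume a: "U \<subseteq> Gamma0 \<and> ?R"
  have "openin (tuple_topology n) {x \<in> distinct_tuples n. x ` {..<n} \<in> U \<inter> Gamma0_n n}" (is "openin _ ?S") for n
  proof (subst openin_subopen, intro ballI)
    fix x assume x: "x \<in> ?S"
    then obtain e where e: "e > 0" "near (x ` {..<n}) e \<subseteq> U" using a by auto
    let ?B = "Pi\<^sub>E {..<n} (\<lambda>i. ball (x i) e)"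
    have "openin (product_topology (\<lambda>_. euclidean) {..<n}) ?B"
      by (subst openin_PiE_gen) auto
    then have o: "openin (tuple_topology n) (?B \<inter> distinct_tuples n)"
      unfolding tuple_topology_def openin_subtopology by blast
    have xd: "inj_on x {..<n}" "x \<in> {..<n} \<rightarrow>\<^sub>E UNIV" using x by (auto simp: distinct_tuples_def)
    have "y \<in> ?S" if y: "y \<in> ?B" "y \<in> distinct_tuples n" for y
    proof -
      let ?f = "y \<circ> the_inv_into {..<n} x"
      have yd: "inj_on y {..<n}" using y by (auto simp: distinct_tuples_def)
      have "bij_betw ?f (x ` {..<n}) (y ` {..<n})"
        using xd(1) yd by (intro bij_betw_trans[of _ _ "{..<n}"] bij_betw_the_inv_into)
          (auto simp: bij_betw_def)
      moreover have "dist (?f z) z < e" if "z \<in> x ` {..<n}" for z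
        using that y(1) xd(1) by (auto simp: the_inv_into_f_f dist_commute PiE_iff)
      ultimately have "y ` {..<n} \<in> near (x ` {..<n}) e" unfolding near_def by blast
      then show ?thesis using e y(2) image_distinct_tuples by blast
    qed
    moreover have "x \<in> ?B" using xd e by auto
    ultimately show "\<exists>T. openin (tuple_topology n) T \<and> x \<in> T \<and> T \<subseteq> ?S"
      using o x by (intro exI[of _ "?B \<inter> distinct_tuples n"]) auto
  qed
  then show "openin Gamma0_topology U"
    using a unfolding openin_Gamma0_topology openin_Gamma0_n_topology by auto
qed

text \<open>The slack \<open>\<epsilon> - dist (f x) x\<close> is bounded below over the finitely many points, and matchings
compose.\<close>

lemma openin_near:
  assumes "\<eta> \<in> Gamma0"
  shows "openin Gamma0_topology (near \<eta> \<epsilon>)"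
  unfolding openin_Gamma0_iff
proof (intro conjI ballI)
  show "near \<eta> \<epsilon> \<subseteq> Gamma0" using near_Gamma0 assms by blast
  fix \<omega> assume "\<omega> \<in> near \<eta> \<epsilon>"
  then obtain f where f: "bij_betw f \<eta> \<omega>" "\<And>x. x \<in> \<eta> \<Longrightarrow> dist (f x) x < \<epsilon>"
    by (auto simp: near_def)
  have "\<exists>d>0. \<forall>x\<in>\<eta>. dist (f x) x + d \<le> \<epsilon>"
  proof (rule finite_uniform_radius)
    show "\<exists>d>0. dist (f x) x + d \<le> \<epsilon>" if "x \<in> \<eta>" for x
      using f(2)[OF that] by (intro exI[of _ "\<epsilon> - dist (f x) x"]) auto
  qed (use assms in \<open>auto simp: Gamma0_def\<close>)
  then obtain d where d: "d > 0" "\<And>x. x \<in> \<eta> \<Longrightarrow> dist (f x) x + d \<le> \<epsilon>" by blast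
  have "near \<omega> d \<subseteq> near \<eta> \<epsilon>"
  proof
    fix \<xi> assume "\<xi> \<in> near \<omega> d"
    then obtain g where g: "bij_betw g \<omega> \<xi>" "\<And>x. x \<in> \<omega> \<Longrightarrow> dist (g x) x < d"
      by (auto simp: near_def)
    have "bij_betw (g \<circ> f) \<eta> \<xi>" using f g by (auto intro: bij_betw_trans)
    moreover have "dist ((g \<circ> f) x) x < \<epsilon>" if "x \<in> \<eta>" for x
    proof -
      have "f x \<in> \<omega>" using f(1) that by (auto simp: bij_betw_def)
      then have "dist (g (f x)) (f x) < d" by (rule g(2))
      then show ?thesis using d(2)[OF that] dist_triangle[of "g (f x)" x "f x"] by simp
    qed
    ultimately show "\<xi> \<in> near \<eta> \<epsilon>" unfolding near_def by blast
  qed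
  then show "\<exists>\<epsilon>'>0. near \<omega> \<epsilon>' \<subseteq> near \<eta> \<epsilon>" using d by blast
qed

lemma separated_radius:
  assumes "finite (\<eta> :: 'a::metric_space set)"
  shows "\<exists>d>0. \<forall>x\<in>\<eta>. \<forall>y\<in>\<eta>. x \<noteq> y \<longrightarrow> d \<le> dist x y"
proof -
  have "\<exists>d>0. \<forall>p\<in>\<eta>\<times>\<eta>. fst p \<noteq> snd p \<longrightarrow> d \<le> dist (fst p) (snd p)"
  proof (rule finite_uniform_radius)
    show "\<exists>d>0. fst p \<noteq> snd p \<longrightarrow> d \<le> dist (fst p) (snd p)" for p :: "'a \<times> 'a"
      by (cases "fst p = snd p") (auto intro: exI[of _ "1::real"] exI[of _ "dist (fst p) (snd p)"])
  qed (use assms in auto)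
  then show ?thesis by auto
qed

text \<open>Points inside an open set stay inside under a small motion, so the number of points in an open set
is lower semicontinuous.\<close>

lemma openin_count_ge:
  fixes U :: "'a::euclidean_space set"
  assumes "open U"
  shows "openin Gamma0_topology {\<eta>\<in>Gamma0. k \<le> card (\<eta> \<inter> U)}"
  unfolding openin_Gamma0_iff
proof (intro conjI ballI)
  fix \<eta> assume "\<eta> \<in> {\<eta>\<in>Gamma0. k \<le> card (\<eta> \<inter> U)}"
  then have \<eta>: "\<eta> \<in> Gamma0" "k \<le> card (\<eta> \<inter> U)" by auto
  have "\<exists>d>0. \<forall>x\<in>\<eta>\<inter>U. ball x d \<subseteq> U"
    using assms \<eta> by (intro finite_uniform_radius) (auto simp: Gamma0_def elim: openE)
  then obtain d where d: "d > 0" "\<And>x. x \<in> \<eta> \<Longrightarrow> x \<in> U \<Longrightarrow> ball x d \<subseteq> U" by auto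
  have "k \<le> card (\<omega> \<inter> U)" if \<omega>: "\<omega> \<in> near \<eta> d" for \<omega>
  proof -
    obtain f where f: "bij_betw f \<eta> \<omega>" "\<And>x. x \<in> \<eta> \<Longrightarrow> dist (f x) x < d"
      using \<omega> by (auto simp: near_def)
    have "f ` (\<eta> \<inter> U) \<subseteq> \<omega> \<inter> U"
    proof safe
      fix x assume "x \<in> \<eta>" "x \<in> U"
      then show "f x \<in> \<omega>" "f x \<in> U" using f(1) f(2)[of x] d(2)[of x]
        by (auto simp: bij_betw_def subset_eq dist_commute)
    qed
    moreover have "finite (\<omega> \<inter> U)" using near_Gamma0[OF \<eta>(1) \<omega>] by (auto simp: Gamma0_def)
    moreover have "inj_on f (\<eta> \<inter> U)" using f(1) by (auto simp: bij_betw_def intro: inj_on_subset)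
    ultimately show ?thesis using \<eta>(2) card_inj_on_le le_trans by blast
  qed
  then show "\<exists>e>0. near \<eta> e \<subseteq> {\<eta>\<in>Gamma0. k \<le> card (\<eta> \<inter> U)}"
    using d(1) near_Gamma0[OF \<eta>(1)] by blast
qed auto

lemma openin_sets_Gamma0: "openin Gamma0_topology U \<Longrightarrow> U \<in> sets Gamma0_borel"
  by (auto simp: sets_Gamma0_borel)

lemma measurable_count_open:
  assumes "open U"
  shows "(\<lambda>\<eta>. card (\<eta> \<inter> U)) \<in> Gamma0_borel \<rightarrow>\<^sub>M count_space UNIV"
proof -
  have "{\<eta> \<in> space Gamma0_borel. k \<le> card (\<eta> \<inter> U)} \<in> sets Gamma0_borel" for k
    using openin_sets_Gamma0[OF openin_count_ge[OF assms]] by (simp add: space_Gamma0_borel)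
  then have *: "Measurable.pred Gamma0_borel (\<lambda>\<eta>. k \<le> card (\<eta> \<inter> U))" for k
    by (simp add: pred_def)
  have "{\<eta> \<in> space Gamma0_borel. card (\<eta> \<inter> U) = k} =
     {\<eta> \<in> space Gamma0_borel. k \<le> card (\<eta> \<inter> U) \<and> \<not> Suc k \<le> card (\<eta> \<inter> U)}" for k by auto
  moreover have "Measurable.pred Gamma0_borel (\<lambda>\<eta>. k \<le> card (\<eta> \<inter> U) \<and> \<not> Suc k \<le> card (\<eta> \<inter> U))" for k
    using * by measurable
  ultimately have "{\<eta> \<in> space Gamma0_borel. card (\<eta> \<inter> U) = k} \<in> sets Gamma0_borel" for k
    unfolding pred_def by (metis (mono_tags, lifting))
  then show ?thesis
    by (subst measurable_count_space_eq2_countable) (auto simp: vimage_def Int_def conj_commute)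
qed

lemma measurable_card: "card \<in> Gamma0_borel \<rightarrow>\<^sub>M count_space UNIV"
  using measurable_count_open[of UNIV] by simp

text \<open>Counts in open sets generate the Borel \<open>\<sigma>\<close>-algebra. Separate the points of \<open>\<eta>\<close> by disjoint small
sets from a countable base: a configuration of the same cardinality that meets each of these sets has
exactly one point in each, hence is near \<open>\<eta>\<close>. So every open set is a countable union of sets
described by counts. This criterion makes maps into the configuration space accessible to measurability
proofs, without measurable enumeration of the points.\<close>

theorem measurable_into_Gamma0:
  fixes f :: "'b \<Rightarrow> 'a::euclidean_space set"
  assumes fin: "\<And>x. x \<in> space M \<Longrightarrow> finite (f x)"
    and cnt: "\<And>U. open U \<Longrightarrow> (\<lambda>x. real (card (f x \<inter> U))) \<in> borel_measurable M"
  shows "f \<in> M \<rightarrow>\<^sub>M Gamma0_borel"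
  unfolding Gamma0_borel_def
proof (rule measurable_measure_of)
  show "{U. openin Gamma0_topology U} \<subseteq> Pow Gamma0" by (auto simp: openin_Gamma0_topology)
  show "f \<in> space M \<rightarrow> Gamma0" using fin by (auto simp: Gamma0_def)
  fix V :: "'a set set" assume "V \<in> {U. openin Gamma0_topology U}"
  then have V: "V \<subseteq> Gamma0" "\<And>\<eta>. \<eta> \<in> V \<Longrightarrow> \<exists>\<epsilon>>0. near \<eta> \<epsilon> \<subseteq> V"
    by (auto simp: openin_Gamma0_iff)
  obtain B :: "'a set set" where B: "countable B" "topological_basis B"
    using ex_countable_basis by blast
  define S where "S C = {\<omega>\<in>Gamma0. card \<omega> = card C \<and> (\<forall>b\<in>C. 1 \<le> card (\<omega> \<inter> b))}" for C :: "'a set set"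
  define \<C> where "\<C> = {C. finite C \<and> C \<subseteq> B \<and> S C \<subseteq> V}"
  have "countable \<C>"
    using countable_Collect_finite_subset[OF B(1)] by (rule countable_subset[rotated]) (auto simp: \<C>_def)
  have "V = (\<Union>C\<in>\<C>. S C)"
  proof
    show "V \<subseteq> (\<Union>C\<in>\<C>. S C)"
    proof
      fix \<eta> assume \<eta>: "\<eta> \<in> V"
      then have fin\<eta>: "finite \<eta>" using V(1) by (auto simp: Gamma0_def)
      obtain e where e: "e > 0" "near \<eta> e \<subseteq> V" using V(2) \<eta> by blast
      obtain d where d: "d > 0" "\<And>x y. x \<in> \<eta> \<Longrightarrow> y \<in> \<eta> \<Longrightarrow> x \<noteq> y \<Longrightarrow> d \<le> dist x y"
        using separated_radius[OF fin\<eta>] by blast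
      have "\<exists>b\<in>B. x \<in> b \<and> b \<subseteq> ball x (min e (d/2))" for x
        using topological_basisE[OF B(2), of "ball x (min e (d/2))" x] d(1) e(1)
        by (metis centre_in_ball half_gt_zero min_less_iff_conj open_ball)
      then obtain b where b: "\<And>x. b x \<in> B \<and> x \<in> b x \<and> b x \<subseteq> ball x (min e (d/2))"
        by metis
      have disj: "x = y" if "x \<in> \<eta>" "y \<in> \<eta>" "z \<in> b x" "z \<in> b y" for x y z
      proof (rule ccontr)
        assume "x \<noteq> y"
        have "dist x z < d/2" "dist y z < d/2" using b[of x] b[of y] that by auto
        then have "dist x y < d" using dist_triangle2[of x y z] by linarith
        then show False using d(2)[OF that(1,2) \<open>x \<noteq> y\<close>] by simp
      qed
      have inj: "inj_on b \<eta>" using disj b by (metis inj_onI)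
      have "S (b ` \<eta>) \<subseteq> near \<eta> e"
      proof
        fix \<omega> assume \<omega>: "\<omega> \<in> S (b ` \<eta>)"
        then have "\<forall>x\<in>\<eta>. \<exists>y. y \<in> \<omega> \<inter> b x" unfolding S_def
          by (metis (no_types, lifting) card.empty ex_in_conv imageI mem_Collect_eq not_one_le_zero)
        then obtain g where g: "\<And>x. x \<in> \<eta> \<Longrightarrow> g x \<in> \<omega> \<inter> b x" by metis
        have "inj_on g \<eta>" using disj g by (metis IntD2 inj_onI)
        moreover have "finite \<omega>" "card \<omega> = card \<eta>"
          using \<omega> inj by (auto simp: S_def Gamma0_def card_image)
        moreover have "g ` \<eta> \<subseteq> \<omega>" using g by auto
        ultimately have "g ` \<eta> = \<omega>" by (metis card_image card_subset_eq)
        then have "bij_betw g \<eta> \<omega>" using \<open>inj_on g \<eta>\<close> by (auto simp: bij_betw_def)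
        moreover have "dist (g x) x < e" if "x \<in> \<eta>" for x
          using g[OF that] b[of x] by (auto simp: dist_commute)
        ultimately show "\<omega> \<in> near \<eta> e" unfolding near_def by blast
      qed
      then have "b ` \<eta> \<in> \<C>" using b fin\<eta> e by (auto simp: \<C>_def)
      moreover have "\<eta> \<in> S (b ` \<eta>)"
        using inj fin\<eta> b by (auto simp: S_def Gamma0_def card_image Suc_le_eq card_gt_0_iff)
      ultimately show "\<eta> \<in> (\<Union>C\<in>\<C>. S C)" by blast
    qed
  qed (auto simp: \<C>_def)
  then have eq: "f -` V \<inter> space M = (\<Union>C\<in>\<C>. f -` S C \<inter> space M)" by blast
  have "f -` S C \<inter> space M \<in> sets M" if "C \<in> \<C>" for C
  proof -
    have C: "finite C" "\<And>b. b \<in> C \<Longrightarrow> open b"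
      using that topological_basis_open[OF B(2)] by (auto simp: \<C>_def)
    have "f -` S C \<inter> space M = {x\<in>space M. real (card (f x \<inter> UNIV)) = real (card C) \<and>
        (\<forall>b\<in>C. 1 \<le> real (card (f x \<inter> b)))}"
      using fin by (auto simp: S_def Gamma0_def)
    also have "\<dots> \<in> sets M"
      using cnt[OF C(2)] cnt[OF open_UNIV] C(1)
      by (intro sets.sets_Collect_conj sets.sets_Collect_finite_All borel_measurable_eq borel_measurable_le) auto
    finally show ?thesis .
  qed
  then show "f -` V \<inter> space M \<in> sets M"
    unfolding eq using \<open>countable \<C>\<close> by (intro sets.countable_UN'') auto
qed

section \<open>Measurability of operations on the points of a configuration\<close>

lemma finite_in_Gamma0_borel:
  "S \<in> M \<rightarrow>\<^sub>M Gamma0_borel \<Longrightarrow> z \<in> space M \<Longrightarrow> finite (S z)"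
  using measurable_space[of S M Gamma0_borel z] by (auto simp: space_Gamma0_borel Gamma0_def)

text \<open>The uniform distribution on the points, moved from the discrete \<open>\<sigma>\<close>-algebra to the Borel one so that
measurable dependence on \<open>\<eta>\<close> makes sense. On the empty configuration its value is an arbitrary
probability measure.\<close>

definition point_kernel :: "'a::euclidean_space set \<Rightarrow> 'a measure" where
  "point_kernel \<eta> = distr (measure_pmf (pmf_of_set \<eta>)) borel id"

lemma measurable_point_kernel:
  "point_kernel \<in> Gamma0_borel \<rightarrow>\<^sub>M subprob_algebra (borel :: 'a::euclidean_space measure)"
proof (rule measurable_subprob_algebra_generated[where \<Omega>=UNIV and G="{S. open S}"])
  show "sets borel = sigma_sets UNIV {S :: 'a set. open S}"
    by (simp add: borel_def)
  show "Int_stable {S :: 'a set. open S}" by (auto simp: Int_stable_def)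
  show "subprob_space (point_kernel \<eta>)" for \<eta> :: "'a set"
    unfolding point_kernel_def
    by (intro prob_space_imp_subprob_space prob_space.prob_space_distr) (auto simp: measure_pmf.prob_space_axioms)
  have "(\<lambda>\<eta>. emeasure (point_kernel \<eta>) A) \<in> borel_measurable Gamma0_borel" if "open A" for A :: "'a set"
  proof -
    have "emeasure (point_kernel \<eta>) A = (if card \<eta> = 0 then emeasure (point_kernel {}) A
       else ennreal (real (card (\<eta> \<inter> A)) / real (card \<eta>)))" if "\<eta> \<in> space Gamma0_borel" for \<eta>
    proof (cases "\<eta> = {}")
      case False
      then have "finite \<eta>" using that by (simp add: space_Gamma0_borel Gamma0_def)
      then show ?thesis using False \<open>open A\<close>
        by (simp add: point_kernel_def emeasure_distr emeasure_pmf_of_set)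
    qed simp
    then show ?thesis
      apply (subst measurable_cong, assumption)
      using measurable_count_open[OF \<open>open A\<close>] measurable_card by measurable
  qed
  note * = this
  show "(\<lambda>\<eta>. emeasure (point_kernel \<eta>) (UNIV :: 'a set)) \<in> borel_measurable Gamma0_borel"
    by (rule *[OF open_UNIV])
  show "(\<lambda>\<eta>. emeasure (point_kernel \<eta>) A) \<in> borel_measurable Gamma0_borel"
    if "A \<in> {S. open S}" for A :: "'a set"
    using that by (intro *) simp
qed (auto simp: point_kernel_def)

text \<open>A sum over the points is the cardinality times an integral against the point kernel, and integrals
against measurable kernels are jointly measurable. For the empty configuration the factor \<open>0\<close> hides the
arbitrary value of the kernel.\<close>

lemma measurable_sum_points:
  fixes H :: "'b \<Rightarrow> 'a::euclidean_space \<Rightarrow> ennreal"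
  assumes S: "S \<in> M \<rightarrow>\<^sub>M Gamma0_borel"
    and H: "(\<lambda>(z, x). H z x) \<in> borel_measurable (M \<Otimes>\<^sub>M borel)"
  shows "(\<lambda>z. \<Sum>x\<in>S z. H z x) \<in> borel_measurable M"
proof -
  note S[measurable] H[measurable] measurable_card[measurable]
  have "(\<Sum>x\<in>S z. H z x) = ennreal (real (card (S z))) * (\<integral>\<^sup>+ x. H z x \<partial>point_kernel (S z))"
    if z: "z \<in> space M" for z
  proof (cases "S z = {}")
    case False
    have fin: "finite (S z)" using finite_in_Gamma0_borel[OF S z] .
    have "H z \<in> borel_measurable borel"
      using measurable_Pair2[OF H z] by (simp add: case_prod_beta)
    then have "(\<integral>\<^sup>+ x. H z x \<partial>point_kernel (S z)) = (\<Sum>x\<in>S z. H z x) / card (S z)"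
      unfolding point_kernel_def by (subst nn_integral_distr) (simp_all add: nn_integral_pmf_of_set False fin)
    moreover have "card (S z) > 0" using False fin by (simp add: card_gt_0_iff)
    ultimately show ?thesis
      by (simp add: ennreal_times_divide ennreal_of_nat_eq_real_of_nat mult.commute[of "ennreal _"]
          mult_divide_eq_ennreal)
  qed simp
  moreover have [measurable]: "(\<lambda>z. \<integral>\<^sup>+ x. H z x \<partial>point_kernel (S z)) \<in> borel_measurable M"
    using measurable_compose[OF S measurable_point_kernel] H
    by (intro nn_integral_measurable_subprob_algebra2)
  have "(\<lambda>z. ennreal (real (card (S z))) * (\<integral>\<^sup>+ x. H z x \<partial>point_kernel (S z))) \<in> borel_measurable M"
    by measurable
  ultimately show ?thesis by (subst measurable_cong)
qed

lemma measurable_sum_points_real: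
  fixes H :: "'b \<Rightarrow> 'a::euclidean_space \<Rightarrow> real"
  assumes S: "S \<in> M \<rightarrow>\<^sub>M Gamma0_borel"
    and H: "(\<lambda>(z, x). H z x) \<in> borel_measurable (M \<Otimes>\<^sub>M borel)"
  shows "(\<lambda>z. \<Sum>x\<in>S z. H z x) \<in> borel_measurable M"
proof -
  have 1: "(\<lambda>(z, x). ennreal (H z x)) \<in> borel_measurable (M \<Otimes>\<^sub>M borel)"
    "(\<lambda>(z, x). ennreal (- H z x)) \<in> borel_measurable (M \<Otimes>\<^sub>M borel)"
    using H by (simp_all add: case_prod_beta)
  have e: "enn2real (\<Sum>x\<in>A. ennreal (f x)) = (\<Sum>x\<in>A. max 0 (f x))" for A and f :: "'a \<Rightarrow> real"
  proof -
    have "(\<Sum>x\<in>A. ennreal (f x)) = ennreal (\<Sum>x\<in>A. max 0 (f x))"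
      by (subst sum_ennreal[symmetric]) (auto simp: ennreal_max_0')
    then show ?thesis by (simp add: sum_nonneg)
  qed
  have "(\<Sum>x\<in>S z. H z x) = enn2real (\<Sum>x\<in>S z. ennreal (H z x)) - enn2real (\<Sum>x\<in>S z. ennreal (- H z x))" for z
    unfolding e sum_subtractf[symmetric] by (intro sum.cong) auto
  with measurable_sum_points[OF S 1(1)] measurable_sum_points[OF S 1(2)] show ?thesis by simp
qed

text \<open>Membership is the sum over the points of the indicator of equality.\<close>

lemma measurable_point_mem:
  fixes S :: "'b \<Rightarrow> 'a::euclidean_space set"
  assumes S: "S \<in> M \<rightarrow>\<^sub>M Gamma0_borel" and f[measurable]: "f \<in> borel_measurable M"
  shows "Measurable.pred M (\<lambda>z. f z \<in> S z)"
proof -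
  have "(\<lambda>z. \<Sum>x\<in>S z. if dist (f z) x = 0 then 1 else 0 :: ennreal) \<in> borel_measurable M"
    by (rule measurable_sum_points[OF S]) measurable
  moreover have "(\<Sum>x\<in>S z. if dist (f z) x = 0 then 1 else 0 :: ennreal) = (if f z \<in> S z then 1 else 0)"
    if "z \<in> space M" for z
    using finite_in_Gamma0_borel[OF S that] by (simp add: sum.delta')
  ultimately have [measurable]: "(\<lambda>z. if f z \<in> S z then 1 else 0 :: ennreal) \<in> borel_measurable M"
    by (simp cong: measurable_cong)
  have "Measurable.pred M (\<lambda>z. (if f z \<in> S z then 1 else 0 :: ennreal) = 1)" by measurable
  moreover have "(\<lambda>z. (if f z \<in> S z then 1 else 0 :: ennreal) = 1) = (\<lambda>z. f z \<in> S z)" by auto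
  ultimately show ?thesis by simp
qed

lemma measurable_insert_point [measurable (raw)]:
  fixes S :: "'b \<Rightarrow> 'a::euclidean_space set"
  assumes S[measurable]: "S \<in> M \<rightarrow>\<^sub>M Gamma0_borel" and f[measurable]: "f \<in> borel_measurable M"
  shows "(\<lambda>z. insert (f z) (S z)) \<in> M \<rightarrow>\<^sub>M Gamma0_borel"
proof (rule measurable_into_Gamma0)
  fix U :: "'a set" assume [measurable]: "open U"
  note measurable_count_open[OF \<open>open U\<close>, measurable]
  have preds: "{z \<in> space M. f z \<in> U} \<in> sets M" "{z \<in> space M. f z \<in> S z} \<in> sets M"
    using measurable_point_mem[OF S f] measurable_sets[OF f borel_open[OF \<open>open U\<close>]]
    by (simp_all add: pred_def vimage_def Int_def conj_commute)
  have "real (card (insert (f z) (S z) \<inter> U)) =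
     real (card (S z \<inter> U)) + (if f z \<in> U \<and> f z \<notin> S z then 1 else 0)" if "z \<in> space M" for z
    using finite_in_Gamma0_borel[OF S that] by (auto simp: Int_insert_left insert_absorb)
  moreover have "(\<lambda>z. real (card (S z \<inter> U)) + (if f z \<in> U \<and> f z \<notin> S z then 1 else 0)) \<in> borel_measurable M"
    by (intro borel_measurable_add measurable_If sets.sets_Collect_conj sets.sets_Collect_neg preds)
      measurable
  ultimately show "(\<lambda>z. real (card (insert (f z) (S z) \<inter> U))) \<in> borel_measurable M"
    by (subst measurable_cong)
qed (use finite_in_Gamma0_borel[OF S] in auto)

lemma measurable_remove_point [measurable (raw)]:
  fixes S :: "'b \<Rightarrow> 'a::euclidean_space set"
  assumes S[measurable]: "S \<in> M \<rightarrow>\<^sub>M Gamma0_borel" and f[measurable]: "f \<in> borel_measurable M"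
  shows "(\<lambda>z. S z - {f z}) \<in> M \<rightarrow>\<^sub>M Gamma0_borel"
proof (rule measurable_into_Gamma0)
  fix U :: "'a set" assume [measurable]: "open U"
  note measurable_count_open[OF \<open>open U\<close>, measurable]
  have preds: "{z \<in> space M. f z \<in> U} \<in> sets M" "{z \<in> space M. f z \<in> S z} \<in> sets M"
    using measurable_point_mem[OF S f] measurable_sets[OF f borel_open[OF \<open>open U\<close>]]
    by (simp_all add: pred_def vimage_def Int_def conj_commute)
  have "real (card ((S z - {f z}) \<inter> U)) =
     real (card (S z \<inter> U)) - (if f z \<in> U \<and> f z \<in> S z then 1 else 0)" if "z \<in> space M" for z
  proof -
    have eq: "(S z - {f z}) \<inter> U = S z \<inter> U - {f z}" by auto
    have fin: "finite (S z \<inter> U)" using finite_in_Gamma0_borel[OF S that] by auto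
    show ?thesis
    proof (cases "f z \<in> S z \<inter> U")
      case True
      then show ?thesis unfolding eq using card.remove[OF fin True] by simp
    qed (auto simp: eq)
  qed
  moreover have "(\<lambda>z. real (card (S z \<inter> U)) - (if f z \<in> U \<and> f z \<in> S z then 1 else 0)) \<in> borel_measurable M"
    by (intro borel_measurable_diff measurable_If sets.sets_Collect_conj preds) measurable
  ultimately show "(\<lambda>z. real (card ((S z - {f z}) \<inter> U))) \<in> borel_measurable M"
    by (subst measurable_cong)
qed (use finite_in_Gamma0_borel[OF S] in auto)

lemma measurable_tuple_image:
  fixes x :: "'b \<Rightarrow> 'i \<Rightarrow> 'a::euclidean_space"
  assumes I: "finite I" and x[measurable]: "\<And>i. i \<in> I \<Longrightarrow> (\<lambda>z. x z i) \<in> borel_measurable M"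
  shows "(\<lambda>z. x z ` I) \<in> M \<rightarrow>\<^sub>M Gamma0_borel"
  using I x
proof (induction I)
  case empty
  then show ?case by (simp add: space_Gamma0_borel Gamma0_def)
next
  case (insert i I)
  then have "(\<lambda>z. insert (x z i) (x z ` I)) \<in> M \<rightarrow>\<^sub>M Gamma0_borel"
    by (intro measurable_insert_point) auto
  then show ?case by simp
qed

section \<open>The transition function as a finite sum\<close>

text \<open>A positive functional that is homogeneous and additive over countable sums is integration against the
measure it induces on sets. Additivity over sequences already gives monotone convergence, by telescoping
an increasing sequence. The lemma identifies integrals for each of the measures that are defined here by a formula for their values on sets: the transition
function, the transported measures and the Lebesgue-Poisson measure.\<close>

lemma measure_of_functional:
  fixes L :: "('b \<Rightarrow> ennreal) \<Rightarrow> ennreal"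
  assumes cong: "\<And>f g. (\<And>x. x \<in> space M \<Longrightarrow> f x = g x) \<Longrightarrow> L f = L g"
    and cmult: "\<And>c f. f \<in> borel_measurable M \<Longrightarrow> L (\<lambda>x. c * f x) = c * L f"
    and suminf: "\<And>f. (\<And>i :: nat. f i \<in> borel_measurable M) \<Longrightarrow> L (\<lambda>x. \<Sum>i. f i x) = (\<Sum>i. L (f i))"
  defines "N \<equiv> measure_of (space M) (sets M) (\<lambda>A. L (indicator A))"
  shows "A \<in> sets M \<Longrightarrow> emeasure N A = L (indicator A)"
    and "g \<in> borel_measurable M \<Longrightarrow> nn_integral N g = L g"
proof -
  have zero: "L (\<lambda>_. 0) = 0" using cmult[of "\<lambda>_. 0" 0] by simp
  have sum: "L (\<lambda>x. \<Sum>i<n. f i x) = (\<Sum>i<n. L (f i))"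
    if "\<And>i. f i \<in> borel_measurable M" for f and n :: nat
  proof -
    have "(\<Sum>i. if i < n then f i x else 0) = (\<Sum>i<n. f i x)" for x
      by (subst suminf_finite[of "{..<n}"]) auto
    moreover have "(\<Sum>i. L (\<lambda>x. if i < n then f i x else 0)) = (\<Sum>i<n. L (f i))"
      using zero by (subst suminf_finite[of "{..<n}"]) auto
    ultimately show ?thesis
      using suminf[of "\<lambda>i x. if i < n then f i x else 0"] that by simp
  qed
  have N: "emeasure N A = L (indicator A)" if A: "A \<in> sets M" for A
    unfolding N_def
  proof (rule emeasure_measure_of_sigma)
    show "sigma_algebra (space M) (sets M)" ..
    show "positive (sets M) (\<lambda>A. L (indicator A))" using zero by (simp add: positive_def indicator_def[abs_def])
    show "countably_additive (sets M) (\<lambda>A. L (indicator A))"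
    proof (rule countably_additiveI)
      fix A :: "nat \<Rightarrow> 'b set" assume A: "range A \<subseteq> sets M" "disjoint_family A"
      then have "indicator (\<Union> (range A)) x = (\<Sum>i. indicator (A i) x :: ennreal)" for x
        by (simp add: suminf_indicator)
      then show "(\<Sum>i. L (indicator (A i))) = L (indicator (\<Union> (range A)))"
        using suminf[of "\<lambda>i. indicator (A i)"] A(1) by (simp add: range_subsetD cong: cong)
    qed
  qed fact
  then show "A \<in> sets M \<Longrightarrow> emeasure N A = L (indicator A)" .
  have sN: "sets N = sets M" by (simp add: N_def)
  have mN: "borel_measurable N = (borel_measurable M :: ('b \<Rightarrow> ennreal) set)"
    by (rule measurable_cong_sets[OF sN refl])
  show "nn_integral N g = L g" if "g \<in> borel_measurable M"
    using that
  proof (induction g rule: borel_measurable_induct)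
    case (cong f g)
    have "nn_integral N f = nn_integral N g"
      using cong(3) sets_eq_imp_space_eq[OF sN] by (intro nn_integral_cong) auto
    with cong(3,4) assms(1)[of f g] show ?case by simp
  next
    case (set A)
    then show ?case using N sN by (simp add: nn_integral_indicator)
  next
    case (mult u c)
    then show ?case by (simp add: cmult nn_integral_cmult mN)
  next
    case (add u v)
    have m: "u \<in> borel_measurable N" "v \<in> borel_measurable N"
      using add(1,3) by (simp_all add: mN)
    have "L (\<lambda>x. u x + v x) = L u + L v"
      using sum[of "\<lambda>i. if i = 0 then u else v" 2] add by (simp add: numeral_2_eq_2)
    then show ?case using add m by (simp add: nn_integral_add add.commute)
  next
    case (seq U)
    \<comment> \<open>Differences of consecutive members; subtraction may involve infinite values, but
      adding back the smaller number is always exact.\<close>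
    define d where "d i x = (case i of 0 \<Rightarrow> U 0 x | Suc j \<Rightarrow> U (Suc j) x - U j x)" for i x
    have dm: "d i \<in> borel_measurable M" for i
      using seq(1) unfolding d_def by (cases i) simp_all
    have dU: "(\<Sum>i<Suc n. d i x) = U n x" for n x
    proof (induction n)
      case (Suc n)
      have "U n x \<le> U (Suc n) x" using seq(3) by (auto simp: incseq_Suc_iff le_fun_def)
      then show ?case using Suc by (simp add: d_def add.commute diff_add_cancel_ennreal)
    qed (simp add: d_def)
    have dI: "(\<Sum>i. F i) = (SUP n. G n)" if "\<And>n. (\<Sum>i<Suc n. F i) = G n" for F G :: "nat \<Rightarrow> ennreal"
    proof -
      have "(\<Sum>i. F i) = (SUP n. \<Sum>i<Suc n. F i)"
        unfolding suminf_eq_SUP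
      proof (rule antisym)
        show "(SUP n. \<Sum>i<n. F i) \<le> (SUP n. \<Sum>i<Suc n. F i)"
          by (intro SUP_mono') (auto intro!: sum_mono2)
        show "(SUP n. \<Sum>i<Suc n. F i) \<le> (SUP n. \<Sum>i<n. F i)"
          by (intro SUP_least) (rule SUP_upper, simp)
      qed
      then show ?thesis using that by simp
    qed
    have "(\<lambda>x. \<Sum>i. d i x) = (SUP n. U n)"
      using dI[OF dU] by (auto simp: fun_eq_iff image_comp)
    then have "L (SUP n. U n) = (\<Sum>i. L (d i))" using suminf[of d, OF dm] by simp
    also have "\<dots> = (SUP n. L (U n))"
    proof (rule dI)
      fix n
      have "(\<lambda>x. \<Sum>i<Suc n. d i x) = U n" using dU by (rule ext)
      then show "(\<Sum>i<Suc n. L (d i)) = L (U n)" using sum[of d "Suc n", OF dm] by simp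
    qed
    also have "\<dots> = (SUP n. nn_integral N (U n))" using seq by simp
    also have "\<dots> = (\<integral>\<^sup>+ x. (SUP n. U n x) \<partial>N)"
      using seq(1,3) by (intro nn_integral_monotone_convergence_SUP[symmetric]) (auto simp: mN)
    also have "\<dots> = nn_integral N (SUP n. U n)"
      by (intro nn_integral_cong) (simp add: image_comp)
    finally show ?case by (rule sym)
  qed
qed

lemma lborel_reflect: "distr lborel borel (\<lambda>v. x - v) = (lborel :: 'a::euclidean_space measure)"
  using lborel_affine[of "-1" x, symmetric] by (simp add: density_1)

text \<open>Replace the Lebesgue measurable density by a Borel version, which changes nothing almost everywhere, and
substitute \<open>w = x - v\<close>; Lebesgue measure is invariant under this reflection. All points share the same law
of \<open>v\<close>.\<close>

lemma displacement_law:
  fixes ap :: "'a::euclidean_space \<Rightarrow> real"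
  assumes ap: "ap \<in> borel_measurable lebesgue" and one: "(\<integral>\<^sup>+ x. ennreal (ap x) \<partial>lebesgue) = 1"
  obtains \<alpha> where "prob_space \<alpha>" "sets \<alpha> = sets borel" "absolutely_continuous lborel \<alpha>"
    "\<And>h x. h \<in> borel_measurable borel \<Longrightarrow>
       (\<integral>\<^sup>+ w. h w * ennreal (ap (x - w)) \<partial>lebesgue) = (\<integral>\<^sup>+ v. h (x - v) \<partial>\<alpha>)"
proof -
  obtain g :: "'a \<Rightarrow> real" where g[measurable]: "g \<in> borel_measurable borel" and eq: "AE x in lborel. ap x = g x"
    using completion_ex_borel_measurable_real[OF ap] by auto
  define \<alpha> where "\<alpha> = density lborel (\<lambda>v. ennreal (g v))"
  show thesis
  proof
    have "(\<integral>\<^sup>+ v. ennreal (g v) \<partial>lborel) = (\<integral>\<^sup>+ v. ennreal (ap v) \<partial>lborel)"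
      using eq by (intro nn_integral_cong_AE) auto
    also have "\<dots> = 1" using one by (simp add: nn_integral_completion)
    finally show "prob_space \<alpha>"
      by (intro prob_spaceI) (simp add: \<alpha>_def emeasure_density)
    show "sets \<alpha> = sets borel" by (simp add: \<alpha>_def)
    show "absolutely_continuous lborel \<alpha>"
      unfolding \<alpha>_def by (rule absolutely_continuousI_density) simp
    fix h :: "'a \<Rightarrow> ennreal" and x assume h[measurable]: "h \<in> borel_measurable borel"
    have "AE v in distr lborel borel (\<lambda>v. x - v). ap v = g v" using eq by (subst lborel_reflect)
    then have "AE w in lborel. ap (x - w) = g (x - w)" by (rule AE_distrD[rotated]) simp
    then have "(\<integral>\<^sup>+ w. h w * ennreal (ap (x - w)) \<partial>lebesgue) = (\<integral>\<^sup>+ w. h w * ennreal (g (x - w)) \<partial>lborel)"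
      unfolding nn_integral_completion by (intro nn_integral_cong_AE) auto
    also have "\<dots> = (\<integral>\<^sup>+ w. h w * ennreal (g (x - w)) \<partial>distr lborel borel (\<lambda>v. x - v))"
      by (simp add: lborel_reflect)
    also have "\<dots> = (\<integral>\<^sup>+ v. h (x - v) \<partial>\<alpha>)"
      unfolding \<alpha>_def by (simp add: nn_integral_distr nn_integral_density mult.commute)
    finally show "(\<integral>\<^sup>+ w. h w * ennreal (ap (x - w)) \<partial>lebesgue) = (\<integral>\<^sup>+ v. h (x - v) \<partial>\<alpha>)" .
  qed
qed

text \<open>The rates are taken on the whole time axis, so that measurability in time needs no restriction to
half-lines; the model on \<open>{0..}\<close> is recovered by extending the rates constantly to negative times. The
measure \<open>\<alpha>\<close> is the law of displacements of newborn points.\<close>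

locale dieckmann_law = prob_space \<alpha>
  for \<alpha> :: "'a::euclidean_space measure" +
  fixes m l :: "real \<Rightarrow> real" and am bp ap :: "'a \<Rightarrow> real" and amax bmax :: real
  assumes sets_\<alpha> [measurable_cong, simp]: "sets \<alpha> = sets borel"
    and \<alpha>_continuous: "absolutely_continuous lborel \<alpha>"
    and displacement: "\<And>h x. h \<in> borel_measurable borel \<Longrightarrow>
       (\<integral>\<^sup>+ w. h w * ennreal (ap (x - w)) \<partial>lebesgue) = (\<integral>\<^sup>+ v. h (x - v) \<partial>\<alpha>)"
    and m_cont: "continuous_on UNIV m" and m_nonneg [simp]: "\<And>t. 0 \<le> m t"
    and l_cont: "continuous_on UNIV l" and l_nonneg [simp]: "\<And>t. 0 \<le> l t"
    and am_cont: "continuous_on UNIV am" and am_nonneg [simp]: "\<And>x. 0 \<le> am x" and am_le: "\<And>x. am x \<le> amax"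
    and bp_cont: "continuous_on UNIV bp" and bp_nonneg [simp]: "\<And>x. 0 \<le> bp x" and bp_le: "\<And>x. bp x \<le> bmax"
begin

abbreviation "Q \<equiv> DL_kernel m l am bp ap"

definition death :: "real \<Rightarrow> 'a set \<Rightarrow> 'a \<Rightarrow> real" where
  "death t \<eta> x = m t + (\<Sum>y\<in>\<eta> - {x}. am (x - y))"

definition birth :: "real \<Rightarrow> 'a set \<Rightarrow> 'a \<Rightarrow> real" where
  "birth t \<eta> x = l t + (\<Sum>y\<in>\<eta> - {x}. bp (x - y))"

text \<open>The integral of \<open>g\<close> against \<open>Q t \<eta>\<close>, as \<open>nn_integral_Q\<close> shows.\<close>

definition Qint :: "real \<Rightarrow> 'a set \<Rightarrow> ('a set \<Rightarrow> ennreal) \<Rightarrow> ennreal" where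
  "Qint t \<eta> g = (\<Sum>x\<in>\<eta>. ennreal (death t \<eta> x) * g (\<eta> - {x})) +
     (\<Sum>x\<in>\<eta>. ennreal (birth t \<eta> x) * (\<integral>\<^sup>+ v. g (insert (x - v) \<eta>) \<partial>\<alpha>))"

lemma death_nonneg [simp]: "0 \<le> death t \<eta> x" by (simp add: death_def sum_nonneg)
lemma birth_nonneg [simp]: "0 \<le> birth t \<eta> x" by (simp add: birth_def sum_nonneg)

lemma space_\<alpha> [simp]: "space \<alpha> = UNIV"
  using sets_eq_imp_space_eq[OF sets_\<alpha>] by simp

lemma measurable_offspring:
  "finite \<eta> \<Longrightarrow> (\<lambda>w. insert w \<eta>) \<in> borel \<rightarrow>\<^sub>M Gamma0_borel"
  using measurable_insert_point[of "\<lambda>_. \<eta>" borel "\<lambda>w. w"] by (simp add: space_Gamma0_borel Gamma0_def)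

lemma measurable_displaced:
  "finite \<eta> \<Longrightarrow> (\<lambda>v. insert (x - v) \<eta>) \<in> \<alpha> \<rightarrow>\<^sub>M Gamma0_borel"
  by (rule measurable_compose[OF _ measurable_offspring]) simp_all

lemma sets_Q [measurable_cong, simp]: "sets (Q t \<eta>) = sets Gamma0_borel"
  and space_Q [simp]: "space (Q t \<eta>) = Gamma0"
proof -
  have "sets Gamma0_borel \<subseteq> Pow (Gamma0 :: 'a set set)"
    using sets.sets_into_space[where M="Gamma0_borel :: 'a set measure"] by (auto simp: space_Gamma0_borel)
  then show "sets (Q t \<eta>) = sets Gamma0_borel" "space (Q t \<eta>) = Gamma0"
    unfolding DL_kernel_def
    using sets.sigma_sets_eq[of "Gamma0_borel :: 'a set measure"]
    by (auto simp: space_Gamma0_borel)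
qed

lemma Qint_cong:
  "\<eta> \<in> Gamma0 \<Longrightarrow> (\<And>\<omega>. \<omega> \<in> Gamma0 \<Longrightarrow> f \<omega> = g \<omega>) \<Longrightarrow> Qint t \<eta> f = Qint t \<eta> g"
  unfolding Qint_def Gamma0_def
  by (intro arg_cong2[where f=plus] sum.cong arg_cong2[where f=times] nn_integral_cong) auto

lemma Qint_mono:
  "\<eta> \<in> Gamma0 \<Longrightarrow> (\<And>\<omega>. \<omega> \<in> Gamma0 \<Longrightarrow> f \<omega> \<le> g \<omega>) \<Longrightarrow> Qint t \<eta> f \<le> Qint t \<eta> g"
  unfolding Qint_def Gamma0_def
  by (intro add_mono sum_mono mult_left_mono nn_integral_mono) auto

lemma Qint_cmult:
  assumes "\<eta> \<in> Gamma0" "f \<in> borel_measurable Gamma0_borel"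
  shows "Qint t \<eta> (\<lambda>\<omega>. c * f \<omega>) = c * Qint t \<eta> f"
proof -
  have "finite \<eta>" using assms by (simp add: Gamma0_def)
  note [measurable] = measurable_displaced[OF this] assms(2)
  show ?thesis
    by (simp add: Qint_def nn_integral_cmult distrib_left sum_distrib_left mult_ac)
qed

lemma Qint_suminf:
  assumes "\<eta> \<in> Gamma0" "\<And>i :: nat. f i \<in> borel_measurable Gamma0_borel"
  shows "Qint t \<eta> (\<lambda>\<omega>. \<Sum>i. f i \<omega>) = (\<Sum>i. Qint t \<eta> (f i))"
proof -
  have "finite \<eta>" using assms by (simp add: Gamma0_def)
  note [measurable] = measurable_displaced[OF this] assms(2)
  show ?thesis
    by (simp add: Qint_def nn_integral_suminf suminf_sum suminf_add[symmetric])
qed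

lemma DL_rate_eq_Qint:
  assumes "\<eta> \<in> Gamma0" "A \<in> sets Gamma0_borel"
  shows "DL_rate m l am bp ap t \<eta> A = Qint t \<eta> (indicator A)"
proof -
  have "finite \<eta>" using assms by (simp add: Gamma0_def)
  note [measurable] = measurable_offspring[OF this] assms(2)
  have "(\<lambda>w. indicator A (insert w \<eta>) :: ennreal) \<in> borel_measurable borel" by measurable
  from displacement[OF this] show ?thesis
    unfolding DL_rate_def Qint_def death_def birth_def by simp
qed

lemma
  assumes "\<eta> \<in> Gamma0"
  shows emeasure_Q: "A \<in> sets Gamma0_borel \<Longrightarrow> emeasure (Q t \<eta>) A = Qint t \<eta> (indicator A)"
    and nn_integral_Q: "g \<in> borel_measurable Gamma0_borel \<Longrightarrow> nn_integral (Q t \<eta>) g = Qint t \<eta> g"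
proof -
  have *: "Q t \<eta> = measure_of (space Gamma0_borel) (sets Gamma0_borel) (\<lambda>A. Qint t \<eta> (indicator A))"
    unfolding DL_kernel_def space_Gamma0_borel[symmetric]
    using DL_rate_eq_Qint[OF assms] sets.sigma_sets_eq[of "Gamma0_borel :: 'a set measure"]
    by (intro measure_of_eq) (auto simp: sets.space_closed)
  note ** = measure_of_functional[where M="Gamma0_borel" and L="Qint t \<eta>"]
  show "A \<in> sets Gamma0_borel \<Longrightarrow> emeasure (Q t \<eta>) A = Qint t \<eta> (indicator A)"
    unfolding * by (intro **) (auto intro!: Qint_cong Qint_cmult Qint_suminf assms simp: space_Gamma0_borel)
  show "g \<in> borel_measurable Gamma0_borel \<Longrightarrow> nn_integral (Q t \<eta>) g = Qint t \<eta> g"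
    unfolding * by (intro **) (auto intro!: Qint_cong Qint_cmult Qint_suminf assms simp: space_Gamma0_borel)
qed

definition jump_rate :: "real \<Rightarrow> 'a set \<Rightarrow> real" where
  "jump_rate t \<eta> = (\<Sum>x\<in>\<eta>. death t \<eta> x + birth t \<eta> x)"

lemma jump_rate_nonneg [simp]: "0 \<le> jump_rate t \<eta>" by (simp add: jump_rate_def sum_nonneg)

lemma Qint_const: "Qint t \<eta> (\<lambda>_. c) = ennreal (jump_rate t \<eta>) * c"
  unfolding Qint_def jump_rate_def
  using emeasure_space_1
  by (simp add: sum_distrib_right[symmetric] sum.distrib[symmetric] distrib_right[symmetric] sum_nonneg
      ennreal_plus[symmetric] del: ennreal_plus)

lemma emeasure_Q_space: "\<eta> \<in> Gamma0 \<Longrightarrow> emeasure (Q t \<eta>) Gamma0 = ennreal (jump_rate t \<eta>)"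
  using nn_integral_Q[of \<eta> "\<lambda>_. 1" t] by (simp add: Qint_const)

lemma total_rate_Q: "\<eta> \<in> Gamma0 \<Longrightarrow> total_rate Q t \<eta> = jump_rate t \<eta>"
  by (simp add: total_rate_def measure_def emeasure_Q_space)

end

section \<open>The terms of the minimal transition function acting on functions\<close>

context dieckmann_law begin

lemma measurable_rates:
  assumes \<tau>[measurable]: "\<tau> \<in> borel_measurable M"
    and S[measurable]: "S \<in> M \<rightarrow>\<^sub>M Gamma0_borel" and f[measurable]: "f \<in> borel_measurable M"
  shows "(\<lambda>z. death (\<tau> z) (S z) (f z)) \<in> borel_measurable M"
    and "(\<lambda>z. birth (\<tau> z) (S z) (f z)) \<in> borel_measurable M"
proof -
  have [measurable]: "m \<in> borel_measurable borel" "l \<in> borel_measurable borel"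
    "am \<in> borel_measurable borel" "bp \<in> borel_measurable borel"
    using m_cont l_cont am_cont bp_cont by (auto intro: borel_measurable_continuous_onI)
  have [measurable]: "(\<lambda>z. \<Sum>y\<in>S z - {f z}. k (f z - y)) \<in> borel_measurable M"
    if [measurable]: "k \<in> borel_measurable borel" for k :: "'a \<Rightarrow> real"
    by (rule measurable_sum_points_real[OF measurable_remove_point[OF S f]]) measurable
  show "(\<lambda>z. death (\<tau> z) (S z) (f z)) \<in> borel_measurable M"
    "(\<lambda>z. birth (\<tau> z) (S z) (f z)) \<in> borel_measurable M"
    unfolding death_def birth_def by measurable
qed

text \<open>The function may itself depend on the parameter, which is what the time-dependent recursion for the
minimal transition function requires.\<close>

lemma measurable_Qint:
  assumes \<tau>[measurable]: "\<tau> \<in> borel_measurable M"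
    and S[measurable]: "S \<in> M \<rightarrow>\<^sub>M Gamma0_borel"
    and g: "(\<lambda>(z, \<omega>). g z \<omega>) \<in> borel_measurable (M \<Otimes>\<^sub>M Gamma0_borel)"
  shows "(\<lambda>z. Qint (\<tau> z) (S z) (g z)) \<in> borel_measurable M"
proof -
  have g': "(\<lambda>y. g (h y) (R y)) \<in> borel_measurable N"
    if "h \<in> N \<rightarrow>\<^sub>M M" "R \<in> N \<rightarrow>\<^sub>M Gamma0_borel" for h R and N :: "'c measure"
    using measurable_compose[OF measurable_Pair[OF that] g] by simp
  have S1[measurable]: "(\<lambda>y. S (fst y)) \<in> (M \<Otimes>\<^sub>M borel) \<rightarrow>\<^sub>M Gamma0_borel" by measurable
  have d: "(\<lambda>y. death (\<tau> (fst y)) (S (fst y)) (snd y)) \<in> borel_measurable (M \<Otimes>\<^sub>M borel)"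
    "(\<lambda>y. birth (\<tau> (fst y)) (S (fst y)) (snd y)) \<in> borel_measurable (M \<Otimes>\<^sub>M borel)"
    by (intro measurable_rates; measurable)+
  have 1: "(\<lambda>y. g (fst y) (S (fst y) - {snd y})) \<in> borel_measurable (M \<Otimes>\<^sub>M borel)"
    by (rule g') measurable
  have 2: "(\<lambda>(y, v). g (fst y) (insert (snd y - v) (S (fst y)))) \<in> borel_measurable ((M \<Otimes>\<^sub>M borel) \<Otimes>\<^sub>M \<alpha>)"
    unfolding case_prod_beta by (rule g') measurable
  have 3: "(\<lambda>y. \<integral>\<^sup>+ v. g (fst y) (insert (snd y - v) (S (fst y))) \<partial>\<alpha>) \<in> borel_measurable (M \<Otimes>\<^sub>M borel)"
    by (rule borel_measurable_nn_integral[OF 2])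
  show ?thesis
    unfolding Qint_def
    by (intro borel_measurable_add measurable_sum_points S)
      (use d 1 3 in \<open>simp_all add: case_prod_beta\<close>)
qed

lemma measurable_jump_rate:
  assumes "\<tau> \<in> borel_measurable M" "S \<in> M \<rightarrow>\<^sub>M Gamma0_borel"
  shows "(\<lambda>z. jump_rate (\<tau> z) (S z)) \<in> borel_measurable M"
proof -
  have "(\<lambda>z. enn2real (Qint (\<tau> z) (S z) (\<lambda>_. 1))) \<in> borel_measurable M"
    using measurable_Qint[OF assms, of "\<lambda>_ _. 1"] by simp
  then show ?thesis by (simp add: Qint_const)
qed

text \<open>The probability that no jump occurs in \<open>{s..t}\<close>.\<close>

definition survival :: "real \<Rightarrow> real \<Rightarrow> 'a set \<Rightarrow> real" where
  "survival s t \<eta> = exp (- (LINT r:{s..t}|lborel. jump_rate r \<eta>))"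

lemma survival_nonneg [simp]: "0 \<le> survival s t \<eta>" by (simp add: survival_def)

lemma measurable_survival:
  assumes [measurable]: "\<sigma> \<in> borel_measurable M" "\<tau> \<in> borel_measurable M" "S \<in> M \<rightarrow>\<^sub>M Gamma0_borel"
  shows "(\<lambda>z. survival (\<sigma> z) (\<tau> z) (S z)) \<in> borel_measurable M"
proof -
  have "(\<lambda>y. jump_rate (snd y) (S (fst y))) \<in> borel_measurable (M \<Otimes>\<^sub>M lborel)"
    by (rule measurable_jump_rate) measurable
  then have "(\<lambda>(z, r). indicator {\<sigma> z..\<tau> z} r *\<^sub>R jump_rate r (S z)) \<in> borel_measurable (M \<Otimes>\<^sub>M lborel)"
    unfolding indicator_def atLeastAtMost_iff case_prod_beta by measurable
  from lborel.borel_measurable_lebesgue_integral[OF this]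
  show ?thesis unfolding survival_def set_lebesgue_integral_def by measurable
qed

text \<open>The recursion of \<open>P_n\<close> with the indicator replaced by an arbitrary function. Linearity and monotone
convergence in \<open>f\<close> are then ordinary properties of integrals, and countable additivity of \<open>P_n\<close> in the set
becomes a special case.\<close>

primrec Pint :: "nat \<Rightarrow> real \<Rightarrow> ('a set \<Rightarrow> ennreal) \<Rightarrow> real \<Rightarrow> 'a set \<Rightarrow> ennreal" where
  "Pint 0 t f s \<eta> = f \<eta> * ennreal (exp (- (LINT r:{s..t}|lborel. total_rate Q r \<eta>)))"
| "Pint (Suc n) t f s \<eta> =
     (\<integral>\<^sup>+ r\<in>{s..t}. (ennreal (exp (- (LINT \<tau>:{s..r}|lborel. total_rate Q \<tau> \<eta>))) *
        (\<integral>\<^sup>+ \<omega>. Pint n t f r \<omega> \<partial>Q r \<eta>)) \<partial>lborel)"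

lemma P_n_eq_Pint: "P_n n Q s \<eta> t A = Pint n t (indicator A) s \<eta>"
  by (induction n arbitrary: s \<eta>) simp_all

lemma Pint_0: "\<eta> \<in> Gamma0 \<Longrightarrow> Pint 0 t f s \<eta> = f \<eta> * ennreal (survival s t \<eta>)"
  by (simp add: survival_def total_rate_Q)

lemma Pint_Suc:
  assumes "\<eta> \<in> Gamma0" "\<And>r. Pint n t f r \<in> borel_measurable Gamma0_borel"
  shows "Pint (Suc n) t f s \<eta> =
    (\<integral>\<^sup>+ r. ennreal (survival s r \<eta>) * Qint r \<eta> (Pint n t f r) * indicator {s..t} r \<partial>lborel)"
  using assms by (simp add: survival_def total_rate_Q nn_integral_Q)

text \<open>Joint measurability in time and configuration has to be carried through the recursion, because the next
step integrates over both.\<close>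

lemma measurable_Pint_pair:
  assumes f[measurable]: "f \<in> borel_measurable Gamma0_borel"
  shows "(\<lambda>(s, \<eta>). Pint n t f s \<eta>) \<in> borel_measurable (borel \<Otimes>\<^sub>M Gamma0_borel)"
proof (induction n)
  case 0
  have "(\<lambda>y. survival (fst y) t (snd y)) \<in> borel_measurable (borel \<Otimes>\<^sub>M Gamma0_borel)"
    by (rule measurable_survival) measurable
  then have "(\<lambda>y. f (snd y) * ennreal (survival (fst y) t (snd y))) \<in> borel_measurable (borel \<Otimes>\<^sub>M Gamma0_borel)"
    by measurable
  then show ?case
    by (rule measurable_cong[THEN iffD1, rotated]) (auto simp: Pint_0 space_pair_measure space_Gamma0_borel simp del: Pint.simps)
next
  case (Suc n)
  have jt[measurable]: "Pint n t f r \<in> borel_measurable Gamma0_borel" for r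
    using measurable_Pair2[OF Suc, of r] by simp
  have 1: "(\<lambda>(y, \<omega>). Pint n t f (snd y) \<omega>)
      \<in> borel_measurable ((((borel :: real measure) \<Otimes>\<^sub>M (Gamma0_borel :: 'a set measure)) \<Otimes>\<^sub>M lborel) \<Otimes>\<^sub>M Gamma0_borel)"
  proof -
    have "(\<lambda>y. (snd (fst y), snd y)) \<in>
        ((((borel :: real measure) \<Otimes>\<^sub>M (Gamma0_borel :: 'a set measure)) \<Otimes>\<^sub>M lborel) \<Otimes>\<^sub>M Gamma0_borel) \<rightarrow>\<^sub>M borel \<Otimes>\<^sub>M Gamma0_borel"
      by measurable
    from measurable_compose[OF this Suc] show ?thesis by (simp add: case_prod_beta)
  qed
  have [measurable]: "(\<lambda>y. Qint (snd y) (snd (fst y)) (Pint n t f (snd y)))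
      \<in> borel_measurable (((borel :: real measure) \<Otimes>\<^sub>M Gamma0_borel) \<Otimes>\<^sub>M lborel)"
    by (rule measurable_Qint[where g="\<lambda>y. Pint n t f (snd y)", OF _ _ 1]) measurable
  have [measurable]: "(\<lambda>y. survival (fst (fst y)) (snd y) (snd (fst y)))
      \<in> borel_measurable ((borel \<Otimes>\<^sub>M Gamma0_borel) \<Otimes>\<^sub>M lborel)"
    by (rule measurable_survival) measurable
  have "(\<lambda>(y, r). ennreal (survival (fst y) r (snd y)) * Qint r (snd y) (Pint n t f r) * indicator {fst y..t} r)
      \<in> borel_measurable ((borel \<Otimes>\<^sub>M Gamma0_borel) \<Otimes>\<^sub>M lborel)"
    unfolding indicator_def atLeastAtMost_iff case_prod_beta by measurable
  from lborel.borel_measurable_nn_integral[OF this]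
  show ?case
    by (rule measurable_cong[THEN iffD1, rotated])
      (auto simp: Pint_Suc jt space_pair_measure space_Gamma0_borel simp del: Pint.simps)
qed

lemma measurable_Pint:
  "f \<in> borel_measurable Gamma0_borel \<Longrightarrow> Pint n t f r \<in> borel_measurable Gamma0_borel"
  using measurable_Pair2[OF measurable_Pint_pair, of f r] by simp

lemma measurable_Qint_Pint:
  assumes "f \<in> borel_measurable Gamma0_borel" "\<eta> \<in> Gamma0"
  shows "(\<lambda>r. Qint r \<eta> (Pint n t f r)) \<in> borel_measurable borel"
  using measurable_Pint_pair[OF assms(1)] assms(2) by (intro measurable_Qint) (auto simp: space_Gamma0_borel)

lemma measurable_survival_time: "\<eta> \<in> Gamma0 \<Longrightarrow> (\<lambda>r. survival s r \<eta>) \<in> borel_measurable borel"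
  by (rule measurable_survival) (auto simp: space_Gamma0_borel)

lemma Pint_cmult:
  assumes "\<eta> \<in> Gamma0" "f \<in> borel_measurable Gamma0_borel"
  shows "Pint n t (\<lambda>\<omega>. c * f \<omega>) s \<eta> = c * Pint n t f s \<eta>"
  using assms(1)
proof (induction n arbitrary: s \<eta>)
  case 0
  then show ?case by (simp add: mult_ac)
next
  case (Suc n)
  have "Qint r \<eta> (Pint n t (\<lambda>\<omega>. c * f \<omega>) r) = c * Qint r \<eta> (Pint n t f r)" for r
    by (rule trans[OF Qint_cong[OF Suc.prems Suc.IH] Qint_cmult[OF Suc.prems measurable_Pint[OF assms(2)]]])
  moreover note [measurable] = measurable_Qint_Pint[OF assms(2) Suc.prems] measurable_survival_time[OF Suc.prems]
  ultimately show ?case using assms(2) Suc.prems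
    by (simp add: Pint_Suc measurable_Pint nn_integral_cmult[symmetric] mult_ac del: Pint.simps)
qed

lemma Pint_suminf:
  assumes "\<eta> \<in> Gamma0" "\<And>i :: nat. f i \<in> borel_measurable Gamma0_borel"
  shows "Pint n t (\<lambda>\<omega>. \<Sum>i. f i \<omega>) s \<eta> = (\<Sum>i. Pint n t (f i) s \<eta>)"
  using assms(1)
proof (induction n arbitrary: s \<eta>)
  case 0
  then show ?case by simp
next
  case (Suc n)
  have 1: "Qint r \<eta> (Pint n t (\<lambda>\<omega>. \<Sum>i. f i \<omega>) r) = (\<Sum>i. Qint r \<eta> (Pint n t (f i) r))" for r
    by (rule trans[OF Qint_cong[OF Suc.prems Suc.IH] Qint_suminf[OF Suc.prems measurable_Pint[OF assms(2)]]])
  note [measurable] = measurable_Qint_Pint[OF assms(2) Suc.prems] measurable_survival_time[OF Suc.prems]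
  have "Pint (Suc n) t (\<lambda>\<omega>. \<Sum>i. f i \<omega>) s \<eta> =
    (\<integral>\<^sup>+ r. (\<Sum>i. ennreal (survival s r \<eta>) * Qint r \<eta> (Pint n t (f i) r) * indicator {s..t} r) \<partial>lborel)"
    using assms(2) Suc.prems by (simp add: Pint_Suc measurable_Pint 1 del: Pint.simps)
  also have "\<dots> = (\<Sum>i. Pint (Suc n) t (f i) s \<eta>)"
    using assms(2) Suc.prems by (subst nn_integral_suminf) (simp_all add: Pint_Suc measurable_Pint del: Pint.simps)
  finally show ?case .
qed

lemma Qint_sum:
  assumes "\<eta> \<in> Gamma0" "\<And>k. f k \<in> borel_measurable Gamma0_borel"
  shows "Qint t \<eta> (\<lambda>\<omega>. \<Sum>k<N. f k \<omega>) = (\<Sum>k<(N::nat). Qint t \<eta> (f k))"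
proof -
  have "finite \<eta>" using assms by (simp add: Gamma0_def)
  note [measurable] = measurable_displaced[OF this] assms(2)
  show ?thesis
  proof (induction N)
    case (Suc N)
    then show ?case
      by (simp add: Qint_def nn_integral_add distrib_left sum.distrib add_ac)
  qed (simp add: Qint_def)
qed

lemma jump_rate_cont: "continuous_on UNIV (\<lambda>r. jump_rate r \<eta>)"
  unfolding jump_rate_def death_def birth_def
  by (intro continuous_intros continuous_on_subset[OF m_cont] continuous_on_subset[OF l_cont]) auto

lemma survival_eq: "survival s r \<eta> = exp (- integral {s..r} (\<lambda>\<tau>. jump_rate \<tau> \<eta>))"
  unfolding survival_def
  by (subst set_borel_integral_eq_integral(2))
    (auto intro!: borel_integrable_atLeastAtMost' continuous_on_subset[OF jump_rate_cont])

text \<open>The integrand is the derivative in \<open>r\<close> of \<open>- survival s r \<eta> * exp (c * (t - r))\<close>.\<close>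

lemma survival_balance:
  assumes "s \<le> t" "0 \<le> c"
  shows "(\<integral>\<^sup>+ r. ennreal (survival s r \<eta> * exp (c * (t - r)) * (c + jump_rate r \<eta>)) * indicator {s..t} r \<partial>lborel)
    = ennreal (exp (c * (t - s)) - survival s t \<eta>)"
proof -
  let ?I = "\<lambda>r. integral {s..r} (\<lambda>\<tau>. jump_rate \<tau> \<eta>)"
  let ?F = "\<lambda>r. - exp (- ?I r + c * (t - r))"
  let ?f = "\<lambda>r. exp (- ?I r) * exp (c * (t - r)) * (c + jump_rate r \<eta>)"
  have D: "(?F has_real_derivative ?f r) (at r within {s..t})" if "r \<in> {s..t}" for r
  proof -
    have "(?I has_real_derivative jump_rate r \<eta>) (at r within {s..t})"
      using that by (intro integral_has_real_derivative continuous_on_subset[OF jump_rate_cont]) auto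
    then show ?thesis
      by (auto intro!: derivative_eq_intros simp: exp_add[symmetric] algebra_simps)
  qed
  have "(?f has_integral (?F t - ?F s)) {s..t}"
    using D assms(1) by (intro fundamental_theorem_of_calculus) (auto simp: has_real_derivative_iff_has_vector_derivative)
  from nn_integral_has_integral_lebesgue[OF _ this]
  have "(\<integral>\<^sup>+ r. ennreal (indicator {s..t} r * ?f r) \<partial>lborel) = ennreal (?F t - ?F s)"
    using \<open>0 \<le> c\<close> by simp
  moreover have "ennreal (indicator {s..t} r * ?f r) = ennreal (?f r) * indicator {s..t} r" for r
    by (auto split: split_indicator)
  ultimately show ?thesis unfolding survival_eq by simp
qed

text \<open>A function whose drift is at most \<open>c\<close> times itself grows in mean at most at rate \<open>c\<close>. The induction is
on the number \<open>N\<close> of terms, for all times and configurations at once: inserting the bound for \<open>N\<close> terms into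
the recursion leaves the integral of \<open>survival_balance\<close>, and the survival term that it subtracts is exactly
the contribution of the path without jumps.\<close>

lemma Pint_supermartingale:
  assumes W: "W \<in> borel_measurable Gamma0_borel" "\<And>\<eta>. 0 \<le> W \<eta>" and c: "0 \<le> c"
    and drift: "\<And>r \<eta>. r \<in> {s0..t} \<Longrightarrow> \<eta> \<in> Gamma0 \<Longrightarrow>
      Qint r \<eta> (\<lambda>\<omega>. ennreal (W \<omega>)) \<le> ennreal ((c + jump_rate r \<eta>) * W \<eta>)"
    and "s \<in> {s0..t}" "\<eta> \<in> Gamma0"
  shows "(\<Sum>k. Pint k t (\<lambda>\<omega>. ennreal (W \<omega>)) s \<eta>) \<le> ennreal (exp (c * (t - s)) * W \<eta>)"
proof -
  let ?W = "\<lambda>\<omega>. ennreal (W \<omega>)"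
  have mW: "?W \<in> borel_measurable Gamma0_borel" using W(1) by simp
  have "(\<Sum>k<N. Pint k t ?W s \<eta>) \<le> ennreal (exp (c * (t - s)) * W \<eta>)" for N
    using assms(5,6)
  proof (induction N arbitrary: s \<eta>)
    case (Suc N)
    have \<eta>: "\<eta> \<in> Gamma0" and s: "s0 \<le> s" "s \<le> t" using Suc.prems by auto
    note [measurable] = measurable_Qint_Pint[OF mW \<eta>] measurable_survival_time[OF \<eta>]
    have g: "(\<Sum>k<N. Qint r \<eta> (Pint k t ?W r)) \<le> ennreal (exp (c * (t - r)) * ((c + jump_rate r \<eta>) * W \<eta>))"
      if r: "r \<in> {s..t}" for r
    proof -
      have r': "r \<in> {s0..t}" using r s by auto
      have "(\<Sum>k<N. Qint r \<eta> (Pint k t ?W r)) = Qint r \<eta> (\<lambda>\<omega>. \<Sum>k<N. Pint k t ?W r \<omega>)"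
        using Qint_sum[OF \<eta> measurable_Pint[OF mW]] by simp
      also have "\<dots> \<le> Qint r \<eta> (\<lambda>\<omega>. ennreal (exp (c * (t - r))) * ?W \<omega>)"
        using Suc.IH[OF r'] W(2) by (intro Qint_mono \<eta>) (simp add: ennreal_mult')
      also have "\<dots> = ennreal (exp (c * (t - r))) * Qint r \<eta> ?W"
        by (rule Qint_cmult[OF \<eta> mW])
      also have "\<dots> \<le> ennreal (exp (c * (t - r))) * ennreal ((c + jump_rate r \<eta>) * W \<eta>)"
        by (intro mult_left_mono drift r' \<eta>) simp
      finally show ?thesis by (simp add: ennreal_mult')
    qed
    have "(\<Sum>k<N. Pint (Suc k) t ?W s \<eta>) =
      (\<integral>\<^sup>+ r. (\<Sum>k<N. ennreal (survival s r \<eta>) * Qint r \<eta> (Pint k t ?W r) * indicator {s..t} r) \<partial>lborel)"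
      using \<eta> mW by (subst nn_integral_sum) (simp_all add: Pint_Suc measurable_Pint del: Pint.simps)
    also have "\<dots> = (\<integral>\<^sup>+ r. ennreal (survival s r \<eta>) * (\<Sum>k<N. Qint r \<eta> (Pint k t ?W r)) * indicator {s..t} r \<partial>lborel)"
      by (simp add: sum_distrib_left sum_distrib_right)
    also have "\<dots> \<le> (\<integral>\<^sup>+ r. ennreal (W \<eta>) * (ennreal (survival s r \<eta> * exp (c * (t - r)) * (c + jump_rate r \<eta>)) * indicator {s..t} r) \<partial>lborel)"
    proof (intro nn_integral_mono)
      fix r
      show "ennreal (survival s r \<eta>) * (\<Sum>k<N. Qint r \<eta> (Pint k t ?W r)) * indicator {s..t} r \<le>
        ennreal (W \<eta>) * (ennreal (survival s r \<eta> * exp (c * (t - r)) * (c + jump_rate r \<eta>)) * indicator {s..t} r)"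
      proof (cases "r \<in> {s..t}")
        case True
        have "ennreal (survival s r \<eta>) * (\<Sum>k<N. Qint r \<eta> (Pint k t ?W r)) \<le>
           ennreal (survival s r \<eta>) * ennreal (exp (c * (t - r)) * ((c + jump_rate r \<eta>) * W \<eta>))"
          by (intro mult_left_mono g True) simp
        also have "\<dots> = ennreal (W \<eta>) * ennreal (survival s r \<eta> * exp (c * (t - r)) * (c + jump_rate r \<eta>))"
          using W(2) c by (simp add: ennreal_mult'[symmetric] mult_ac)
        finally show ?thesis using True by simp
      qed simp
    qed
    also have "\<dots> = ennreal (W \<eta>) * ennreal (exp (c * (t - s)) - survival s t \<eta>)"
    proof (subst nn_integral_cmult)
      have "(\<lambda>r. jump_rate r \<eta>) \<in> borel_measurable borel" by (intro borel_measurable_continuous_onI jump_rate_cont)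
      then show "(\<lambda>r. ennreal (survival s r \<eta> * exp (c * (t - r)) * (c + jump_rate r \<eta>)) * indicator {s..t} r) \<in> borel_measurable lborel"
        by measurable
    qed (simp add: survival_balance[OF s(2) c])
    finally have "(\<Sum>k<N. Pint (Suc k) t ?W s \<eta>) \<le> ennreal (W \<eta>) * ennreal (exp (c * (t - s)) - survival s t \<eta>)" .
    then have "(\<Sum>k<Suc N. Pint k t ?W s \<eta>) \<le> ennreal (W \<eta>) * ennreal (survival s t \<eta>) + ennreal (W \<eta>) * ennreal (exp (c * (t - s)) - survival s t \<eta>)"
      unfolding sum.lessThan_Suc_shift by (intro add_mono) (simp_all add: Pint_0 \<eta> del: Pint.simps)
    also have "\<dots> = ennreal (exp (c * (t - s)) * W \<eta>)"
    proof -
      have "0 \<le> integral {s..t} (\<lambda>\<tau>. jump_rate \<tau> \<eta>)" by (intro integral_nonneg) 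
        (auto intro!: integrable_continuous_interval continuous_on_subset[OF jump_rate_cont])
      then have "survival s t \<eta> \<le> 1" unfolding survival_eq by simp
      moreover have "1 \<le> exp (c * (t - s))" using c s by simp
      ultimately have "survival s t \<eta> \<le> exp (c * (t - s))" by linarith
      then show ?thesis using W(2)
        by (simp add: distrib_left[symmetric] ennreal_plus[symmetric] ennreal_mult''[symmetric] mult.commute
            del: ennreal_plus)
    qed
    finally show ?case .
  qed simp
  then show ?thesis unfolding suminf_eq_SUP by (rule SUP_least)
qed

end

section \<open>Transport of measures and the evolution of states\<close>

lemma suminf_swap_ennreal: "(\<Sum>n. \<Sum>i. f n i) = (\<Sum>i. \<Sum>n. f n i :: ennreal)"
proof -
  have "(\<Sum>n. \<Sum>i. f n i) = (\<integral>\<^sup>+ n. (\<Sum>i. f n i) \<partial>count_space UNIV)"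
    by (simp add: nn_integral_count_space_nat)
  also have "\<dots> = (\<Sum>i. \<Sum>n. f n i)"
    by (subst nn_integral_suminf) (simp_all add: nn_integral_count_space_nat)
  finally show ?thesis .
qed

text \<open>The supremum in the positive part is attained on the subset where the density is nonnegative.\<close>

lemma positive_part_density:
  assumes S: "sets M = sets M0" and R: "integrable M R"
    and \<nu>: "\<And>B. B \<in> sets M0 \<Longrightarrow> \<nu> B = (LINT x:B|M. R x)"
  shows "positive_part M0 \<nu> = density M (\<lambda>x. ennreal (R x))"
proof -
  have mR[measurable]: "R \<in> borel_measurable M" using R by simp
  have *: "(SUP B\<in>{B \<in> sets M0. B \<subseteq> A}. ennreal (\<nu> B)) = emeasure (density M (\<lambda>x. ennreal (R x))) A"
    if A: "A \<in> sets M0" for A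
  proof (rule antisym)
    have "ennreal (\<nu> B) \<le> emeasure (density M (\<lambda>x. ennreal (R x))) A" if B: "B \<in> sets M0" "B \<subseteq> A" for B
    proof -
      have BM: "B \<in> sets M" "A \<in> sets M" using B A S by auto
      have "ennreal (\<nu> B) \<le> ennreal (LINT x:B|M. max 0 (R x))"
        unfolding \<nu>[OF B(1)] set_lebesgue_integral_def using R BM
        by (intro ennreal_leI integral_mono integrable_mult_indicator) (auto split: split_indicator)
      also have "\<dots> = (\<integral>\<^sup>+ x. ennreal (indicator B x *\<^sub>R max 0 (R x)) \<partial>M)"
        unfolding set_lebesgue_integral_def using R BM
        by (intro nn_integral_eq_integral[symmetric] integrable_mult_indicator) auto
      also have "\<dots> \<le> (\<integral>\<^sup>+ x. ennreal (R x) * indicator A x \<partial>M)"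
        using B(2) by (intro nn_integral_mono) (auto split: split_indicator simp: ennreal_max_0')
      finally show ?thesis using BM by (simp add: emeasure_density)
    qed
    then show "(SUP B\<in>{B \<in> sets M0. B \<subseteq> A}. ennreal (\<nu> B)) \<le> emeasure (density M (\<lambda>x. ennreal (R x))) A"
      by (auto intro!: SUP_least)
    have AM: "A \<in> sets M" using A S by simp
    have B: "A \<inter> {x \<in> space M. 0 \<le> R x} \<in> sets M" using AM by measurable
    have "emeasure (density M (\<lambda>x. ennreal (R x))) A =
       (\<integral>\<^sup>+ x. ennreal (indicator (A \<inter> {x \<in> space M. 0 \<le> R x}) x *\<^sub>R R x) \<partial>M)"
      using AM by (auto simp: emeasure_density ennreal_neg intro!: nn_integral_cong split: split_indicator)
    also have "\<dots> = ennreal (\<nu> (A \<inter> {x \<in> space M. 0 \<le> R x}))"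
    proof -
      have B0: "A \<inter> {x \<in> space M. 0 \<le> R x} \<in> sets M0" using B S by simp
      show ?thesis unfolding \<nu>[OF B0] set_lebesgue_integral_def
        by (intro nn_integral_eq_integral integrable_mult_indicator B R) (auto split: split_indicator)
    qed
    also have "\<dots> \<le> (SUP B\<in>{B \<in> sets M0. B \<subseteq> A}. ennreal (\<nu> B))"
      using B S by (intro SUP_upper) auto
    finally show "emeasure (density M (\<lambda>x. ennreal (R x))) A \<le> (SUP B\<in>{B \<in> sets M0. B \<subseteq> A}. ennreal (\<nu> B))" .
  qed
  have "positive_part M0 \<nu> = measure_of (space M0) (sets M0) (emeasure (density M (\<lambda>x. ennreal (R x))))"
    unfolding positive_part_def using *
    by (intro measure_of_eq) (auto simp: sets.space_closed sets.sigma_sets_eq)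
  also have "\<dots> = density M (\<lambda>x. ennreal (R x))"
    using measure_of_of_measure[of "density M (\<lambda>x. ennreal (R x))"] S sets_eq_imp_space_eq[OF S] by simp
  finally show ?thesis .
qed

text \<open>Asymptotically the difference is \<open>2 * n * k ^ (n - 1)\<close>. Induction on \<open>n\<close> yields a constant without
expanding binomials.\<close>

lemma power_first_difference:
  "\<exists>C\<ge>0. \<forall>k\<ge>1::real. k * ((k + 1) ^ n - (k - 1) ^ n) \<le> C * k ^ n"
proof (induction n)
  case 0
  then show ?case by (intro exI[of _ 0]) auto
next
  case (Suc n)
  then obtain C where C: "C \<ge> 0" "\<And>k::real. k \<ge> 1 \<Longrightarrow> k * ((k + 1) ^ n - (k - 1) ^ n) \<le> C * k ^ n" by auto
  have "k * ((k + 1) ^ Suc n - (k - 1) ^ Suc n) \<le> (C + 2 * 2 ^ n) * k ^ Suc n" if k: "k \<ge> 1" for k :: real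
  proof -
    have "(k + 1) ^ n \<le> (2 * k) ^ n" "(k - 1) ^ n \<le> (2 * k) ^ n"
      using k by (intro power_mono; simp)+
    then have "(k + 1) ^ n + (k - 1) ^ n \<le> 2 * 2 ^ n * k ^ n" by (simp add: power_mult_distrib)
    then have "k * (k * ((k + 1) ^ n - (k - 1) ^ n)) + k * ((k + 1) ^ n + (k - 1) ^ n)
        \<le> k * (C * k ^ n) + k * (2 * 2 ^ n * k ^ n)"
      using C(2)[OF k] k by (intro add_mono mult_left_mono) auto
    then show ?thesis by (simp add: algebra_simps)
  qed
  then show ?case using C(1) by (intro exI[of _ "C + 2 * 2 ^ n"]) auto
qed

text \<open>The second difference has order \<open>k ^ (n - 2)\<close>, two orders below \<open>k ^ n\<close>. It will be multiplied by a
death rate of order \<open>k ^ 2\<close>, which is why the estimate is stated with that factor.\<close>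

lemma power_second_difference:
  "\<exists>C\<ge>0. \<forall>k\<ge>1::real. 0 \<le> (k + 1) ^ n + (k - 1) ^ n - 2 * k ^ n \<and>
     k\<^sup>2 * ((k + 1) ^ n + (k - 1) ^ n - 2 * k ^ n) \<le> C * k ^ n"
proof (induction n)
  case 0
  then show ?case by (intro exI[of _ 0]) auto
next
  case (Suc n)
  let ?S = "\<lambda>n k :: real. (k + 1) ^ n + (k - 1) ^ n - 2 * k ^ n"
  obtain C where C: "C \<ge> 0" "\<And>k::real. k \<ge> 1 \<Longrightarrow> 0 \<le> ?S n k \<and> k\<^sup>2 * ?S n k \<le> C * k ^ n"
    using Suc by auto
  obtain E where E: "E \<ge> 0" "\<And>k::real. k \<ge> 1 \<Longrightarrow> k * ((k + 1) ^ n - (k - 1) ^ n) \<le> E * k ^ n"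
    using power_first_difference[of n] by auto
  have "0 \<le> ?S (Suc n) k \<and> k\<^sup>2 * ?S (Suc n) k \<le> (C + E) * k ^ Suc n" if k: "k \<ge> 1" for k :: real
  proof -
    have eq: "?S (Suc n) k = k * ?S n k + ((k + 1) ^ n - (k - 1) ^ n)" by (simp add: algebra_simps)
    have "(k - 1) ^ n \<le> (k + 1) ^ n" using k by (intro power_mono) auto
    moreover have "k\<^sup>2 * ?S (Suc n) k = k * (k\<^sup>2 * ?S n k) + k * (k * ((k + 1) ^ n - (k - 1) ^ n))"
      unfolding eq by (simp add: algebra_simps power2_eq_square)
    moreover have "\<dots> \<le> k * (C * k ^ n) + k * (E * k ^ n)"
      using C(2)[OF k] E(2)[OF k] k by (intro add_mono mult_left_mono) auto
    moreover have "0 \<le> k * ?S n k" using C(2)[OF k] k by (intro mult_nonneg_nonneg) auto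
    moreover have "k * (C * k ^ n) + k * (E * k ^ n) = (C + E) * k ^ Suc n" by (simp add: algebra_simps)
    ultimately show ?thesis unfolding eq by linarith
  qed
  then show ?case using C(1) E(1) by (intro exI[of _ "C + E"]) auto
qed

context dieckmann_law begin

lemma Pint_cong:
  assumes "\<And>\<omega>. \<omega> \<in> Gamma0 \<Longrightarrow> f \<omega> = g \<omega>"
  shows "\<eta> \<in> Gamma0 \<Longrightarrow> Pint n t f s \<eta> = Pint n t g s \<eta>"
proof (induction n arbitrary: s \<eta>)
  case (Suc n)
  have "(\<integral>\<^sup>+ \<omega>. Pint n t f r \<omega> \<partial>Q r \<eta>) = (\<integral>\<^sup>+ \<omega>. Pint n t g r \<omega> \<partial>Q r \<eta>)" for r
    using Suc.IH by (intro nn_integral_cong) simp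
  then show ?case by simp
qed (use assms in simp)

lemma P_min_eq: "P_min Q s \<eta> t A = (\<Sum>n. Pint n t (indicator A) s \<eta>)"
  by (simp add: P_min_def P_n_eq_Pint)

text \<open>The image of \<open>M\<close> under the minimal transition function from time \<open>s\<close> to time \<open>t\<close>.\<close>

definition transport :: "real \<Rightarrow> real \<Rightarrow> 'a set measure \<Rightarrow> 'a set measure" where
  "transport t s M = measure_of (space Gamma0_borel) (sets Gamma0_borel)
     (\<lambda>A. \<integral>\<^sup>+ \<eta>. (\<Sum>n. Pint n t (indicator A) s \<eta>) \<partial>M)"

lemma sets_transport [measurable_cong, simp]: "sets (transport t s M) = sets Gamma0_borel"
  and space_transport [simp]: "space (transport t s M) = Gamma0"
  unfolding transport_def sets.sets_measure_of_eq sets.space_measure_of_eq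
  by (simp_all add: space_Gamma0_borel)

lemma nn_integral_transport:
  assumes M: "sets M = sets Gamma0_borel" and g: "g \<in> borel_measurable Gamma0_borel"
  shows "nn_integral (transport t s M) g = (\<integral>\<^sup>+ \<eta>. (\<Sum>n. Pint n t g s \<eta>) \<partial>M)"
proof -
  have sp: "space M = Gamma0" using sets_eq_imp_space_eq[OF M] by (simp add: space_Gamma0_borel)
  have mjt: "Pint n t f s \<in> borel_measurable M" if "f \<in> borel_measurable Gamma0_borel" for f n
    using measurable_Pint[OF that] measurable_cong_sets[OF M refl] by blast
  show ?thesis
    unfolding transport_def
  proof (rule measure_of_functional(2)[where L="\<lambda>f. \<integral>\<^sup>+ \<eta>. (\<Sum>n. Pint n t f s \<eta>) \<partial>M", OF _ _ _ g])
    fix f g :: "'a set \<Rightarrow> ennreal" assume "\<And>x. x \<in> space Gamma0_borel \<Longrightarrow> f x = g x"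
    then show "(\<integral>\<^sup>+ \<eta>. (\<Sum>n. Pint n t f s \<eta>) \<partial>M) = (\<integral>\<^sup>+ \<eta>. (\<Sum>n. Pint n t g s \<eta>) \<partial>M)"
      by (intro nn_integral_cong) (simp add: Pint_cong[of f g] space_Gamma0_borel sp)
  next
    fix c and f :: "'a set \<Rightarrow> ennreal" assume f: "f \<in> borel_measurable Gamma0_borel"
    have "(\<integral>\<^sup>+ \<eta>. (\<Sum>n. Pint n t (\<lambda>x. c * f x) s \<eta>) \<partial>M) = (\<integral>\<^sup>+ \<eta>. c * (\<Sum>n. Pint n t f s \<eta>) \<partial>M)"
      by (intro nn_integral_cong) (simp add: Pint_cmult f sp)
    then show "(\<integral>\<^sup>+ \<eta>. (\<Sum>n. Pint n t (\<lambda>x. c * f x) s \<eta>) \<partial>M) = c * (\<integral>\<^sup>+ \<eta>. (\<Sum>n. Pint n t f s \<eta>) \<partial>M)"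
      using mjt[OF f] by (simp add: nn_integral_cmult)
  next
    fix f :: "nat \<Rightarrow> 'a set \<Rightarrow> ennreal" assume f: "\<And>i. f i \<in> borel_measurable Gamma0_borel"
    have "(\<integral>\<^sup>+ \<eta>. (\<Sum>n. Pint n t (\<lambda>x. \<Sum>i. f i x) s \<eta>) \<partial>M) = (\<integral>\<^sup>+ \<eta>. (\<Sum>i. \<Sum>n. Pint n t (f i) s \<eta>) \<partial>M)"
    proof (intro nn_integral_cong)
      fix \<eta> assume "\<eta> \<in> space M"
      then show "(\<Sum>n. Pint n t (\<lambda>x. \<Sum>i. f i x) s \<eta>) = (\<Sum>i. \<Sum>n. Pint n t (f i) s \<eta>)"
        by (subst suminf_swap_ennreal[symmetric]) (simp add: Pint_suminf f sp)
    qed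
    also have "\<dots> = (\<Sum>i. \<integral>\<^sup>+ \<eta>. (\<Sum>n. Pint n t (f i) s \<eta>) \<partial>M)"
      using mjt[OF f] by (intro nn_integral_suminf) simp
    finally show "(\<integral>\<^sup>+ \<eta>. (\<Sum>n. Pint n t (\<lambda>x. \<Sum>i. f i x) s \<eta>) \<partial>M) =
      (\<Sum>i. \<integral>\<^sup>+ \<eta>. (\<Sum>n. Pint n t (f i) s \<eta>) \<partial>M)" .
  qed
qed

lemma emeasure_transport:
  assumes M: "sets M = sets Gamma0_borel" and A: "A \<in> sets Gamma0_borel"
  shows "emeasure (transport t s M) A = (\<integral>\<^sup>+ \<eta>. P_min Q s \<eta> t A \<partial>M)"
  using nn_integral_transport[OF M, of "indicator A" t s] A by (simp add: P_min_eq)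

lemma measurable_P_min:
  "A \<in> sets Gamma0_borel \<Longrightarrow> (\<lambda>\<eta>. P_min Q s \<eta> t A) \<in> borel_measurable Gamma0_borel"
  unfolding P_min_eq using measurable_Pint[of "indicator A" _ t s] by simp

text \<open>The constant function \<open>1\<close> has drift \<open>0\<close>.\<close>

lemma P_min_le_1:
  assumes "A \<in> sets Gamma0_borel" "s \<le> t" "\<eta> \<in> Gamma0"
  shows "P_min Q s \<eta> t A \<le> 1"
proof -
  have "P_min Q s \<eta> t A \<le> (\<Sum>k. Pint k t (\<lambda>_. ennreal 1) s \<eta>)"
  proof -
    have "Pint n t (indicator A) s \<eta> \<le> Pint n t (\<lambda>_. ennreal 1) s \<eta>" for n
    proof (induction n arbitrary: s \<eta>)
      case 0
      then show ?case by (auto intro!: mult_right_mono split: split_indicator)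
    next
      case (Suc n)
      then show ?case
        by (auto intro!: nn_integral_mono mult_right_mono mult_left_mono)
    qed
    then show ?thesis unfolding P_min_eq by (intro suminf_le) auto
  qed
  also have "\<dots> \<le> ennreal (exp (0 * (t - s)) * 1)"
    using assms(2,3) by (intro Pint_supermartingale[where s0=s]) (auto simp: Qint_const)
  finally show ?thesis by simp
qed

lemma finite_measure_transport:
  assumes "finite_measure M" and M: "sets M = sets Gamma0_borel" and "s \<le> t"
  shows "finite_measure (transport t s M)"
proof
  interpret finite_measure M by fact
  have sp: "space M = Gamma0" using sets_eq_imp_space_eq[OF M] by (simp add: space_Gamma0_borel)
  have G: "Gamma0 \<in> sets (Gamma0_borel :: 'a set measure)"
    using sets.top[of "Gamma0_borel :: 'a set measure"] by (simp add: space_Gamma0_borel)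
  have "emeasure (transport t s M) Gamma0 \<le> (\<integral>\<^sup>+ \<eta>. 1 \<partial>M)"
    unfolding emeasure_transport[OF M G]
    using P_min_le_1[OF G \<open>s \<le> t\<close>] by (intro nn_integral_mono) (simp add: sp)
  also have "\<dots> < \<infinity>" by (simp add: emeasure_eq_measure)
  finally show "emeasure (transport t s M) (space (transport t s M)) \<noteq> \<infinity>" by simp
qed

lemma integral_P_min:
  assumes M: "finite_measure M" "sets M = sets Gamma0_borel" and A: "A \<in> sets Gamma0_borel" and "s \<le> t"
  shows "(LINT \<eta>|M. enn2real (P_min Q s \<eta> t A)) = measure (transport t s M) A"
proof -
  have sp: "space M = Gamma0" using sets_eq_imp_space_eq[OF M(2)] by (simp add: space_Gamma0_borel)
  have fin: "P_min Q s \<eta> t A \<noteq> top" if "\<eta> \<in> Gamma0" for \<eta>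
    using P_min_le_1[OF A \<open>s \<le> t\<close> that] by (auto simp: top_unique)
  have "(\<lambda>\<eta>. P_min Q s \<eta> t A) \<in> borel_measurable M"
    using measurable_P_min[OF A] measurable_cong_sets[OF M(2) refl] by blast
  then have "(LINT \<eta>|M. enn2real (P_min Q s \<eta> t A)) = enn2real (\<integral>\<^sup>+ \<eta>. ennreal (enn2real (P_min Q s \<eta> t A)) \<partial>M)"
    by (intro integral_eq_nn_integral) auto
  also have "(\<integral>\<^sup>+ \<eta>. ennreal (enn2real (P_min Q s \<eta> t A)) \<partial>M) = (\<integral>\<^sup>+ \<eta>. P_min Q s \<eta> t A \<partial>M)"
    using fin by (intro nn_integral_cong) (simp add: sp less_top)
  finally show ?thesis by (simp add: emeasure_transport[OF M(2) A] measure_def)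
qed

lemma finite_measure_density_integrable:
  "integrable M R \<Longrightarrow> finite_measure (density M (\<lambda>x. ennreal (R x)))"
  by (rule finite_measureI) (auto simp: emeasure_density real_integrable_def cong: nn_integral_cong)

text \<open>The Jordan decomposition of a measure with density \<open>R\<close> consists of the densities \<open>max 0 R\<close> and
\<open>max 0 (- R)\<close>; conversion to extended nonnegative reals performs the truncation.\<close>

lemma U_star_eq_transport:
  assumes M: "sets M = sets Gamma0_borel" and R: "integrable M R"
    and \<nu>: "\<And>B. B \<in> sets Gamma0_borel \<Longrightarrow> \<nu> B = (LINT x:B|M. R x)"
    and A: "A \<in> sets Gamma0_borel" and "s \<le> t"
  shows "U_star Q t s \<nu> A = measure (transport t s (density M (\<lambda>x. ennreal (R x)))) A
     - measure (transport t s (density M (\<lambda>x. ennreal (- R x)))) A"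
proof -
  have "positive_part Gamma0_borel \<nu> = density M (\<lambda>x. ennreal (R x))"
    by (rule positive_part_density[OF M R \<nu>])
  moreover have "positive_part Gamma0_borel (\<lambda>A. - \<nu> A) = density M (\<lambda>x. ennreal (- R x))"
    using R by (intro positive_part_density M) (auto simp: \<nu> set_lebesgue_integral_def)
  ultimately show ?thesis
    unfolding U_star_def signed_integral_def using R M A \<open>s \<le> t\<close>
    by (simp add: integral_P_min finite_measure_density_integrable)
qed

end

section \<open>Growth of rates, drift of powers of the cardinality, moments\<close>

context dieckmann_law begin

definition death_sum :: "real \<Rightarrow> 'a set \<Rightarrow> real" where
  "death_sum t \<eta> = (\<Sum>x\<in>\<eta>. death t \<eta> x)"

definition birth_sum :: "real \<Rightarrow> 'a set \<Rightarrow> real" where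
  "birth_sum t \<eta> = (\<Sum>x\<in>\<eta>. birth t \<eta> x)"

lemma death_sum_nonneg [simp]: "0 \<le> death_sum t \<eta>" by (simp add: death_sum_def sum_nonneg)
lemma birth_sum_nonneg [simp]: "0 \<le> birth_sum t \<eta>" by (simp add: birth_sum_def sum_nonneg)

lemma jump_rate_eq: "jump_rate t \<eta> = death_sum t \<eta> + birth_sum t \<eta>"
  by (simp add: jump_rate_def death_sum_def birth_sum_def sum.distrib)

lemma amax_nonneg: "0 \<le> amax" using am_nonneg[of 0] am_le[of 0] by linarith
lemma bmax_nonneg: "0 \<le> bmax" using bp_nonneg[of 0] bp_le[of 0] by linarith

lemma
  assumes "finite \<eta>" "x \<in> \<eta>"
  shows death_le: "death t \<eta> x \<le> m t + real (card \<eta>) * amax"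
    and birth_le: "birth t \<eta> x \<le> l t + real (card \<eta>) * bmax"
proof -
  have c: "real (card (\<eta> - {x})) \<le> real (card \<eta>)" using assms by (simp add: card_Diff1_le)
  have "(\<Sum>y\<in>\<eta> - {x}. am (x - y)) \<le> real (card (\<eta> - {x})) * amax"
    by (rule sum_bounded_above) (rule am_le)
  also have "\<dots> \<le> real (card \<eta>) * amax" by (rule mult_right_mono[OF c amax_nonneg])
  finally show "death t \<eta> x \<le> m t + real (card \<eta>) * amax" by (simp add: death_def)
  have "(\<Sum>y\<in>\<eta> - {x}. bp (x - y)) \<le> real (card (\<eta> - {x})) * bmax"
    by (rule sum_bounded_above) (rule bp_le)
  also have "\<dots> \<le> real (card \<eta>) * bmax" by (rule mult_right_mono[OF c bmax_nonneg])
  finally show "birth t \<eta> x \<le> l t + real (card \<eta>) * bmax" by (simp add: birth_def)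
qed

lemma card_le_square: "real (n :: nat) \<le> (real n)\<^sup>2"
  by (cases n) (auto simp: power2_eq_square)

lemma sum_rates_le:
  assumes "finite \<eta>"
  shows "death_sum t \<eta> \<le> m t * real (card \<eta>) + amax * (real (card \<eta>))\<^sup>2"
    and "birth_sum t \<eta> \<le> l t * real (card \<eta>) + bmax * (real (card \<eta>))\<^sup>2"
proof -
  have "death_sum t \<eta> \<le> real (card \<eta>) * (m t + real (card \<eta>) * amax)"
    unfolding death_sum_def by (rule sum_bounded_above) (rule death_le[OF assms])
  then show "death_sum t \<eta> \<le> m t * real (card \<eta>) + amax * (real (card \<eta>))\<^sup>2"
    by (simp add: algebra_simps power2_eq_square)
  have "birth_sum t \<eta> \<le> real (card \<eta>) * (l t + real (card \<eta>) * bmax)"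
    unfolding birth_sum_def by (rule sum_bounded_above) (rule birth_le[OF assms])
  then show "birth_sum t \<eta> \<le> l t * real (card \<eta>) + bmax * (real (card \<eta>))\<^sup>2"
    by (simp add: algebra_simps power2_eq_square)
qed

text \<open>A death lowers the cardinality by one and a birth raises it by at most one; the newborn point may
coincide with an old one.\<close>

lemma Qint_card_le:
  assumes \<eta>: "\<eta> \<in> Gamma0" and f: "mono f" "\<And>k. 0 \<le> f k"
  shows "Qint t \<eta> (\<lambda>\<omega>. ennreal (f (card \<omega>))) \<le>
    ennreal (death_sum t \<eta> * f (card \<eta> - 1) + birth_sum t \<eta> * f (card \<eta> + 1))"
proof -
  have fin: "finite \<eta>" using \<eta> by (simp add: Gamma0_def)
  have 1: "(\<integral>\<^sup>+ v. ennreal (f (card (insert (x - v) \<eta>))) \<partial>\<alpha>) \<le> ennreal (f (card \<eta> + 1))" for x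
  proof -
    have "(\<integral>\<^sup>+ v. ennreal (f (card (insert (x - v) \<eta>))) \<partial>\<alpha>) \<le> (\<integral>\<^sup>+ v. ennreal (f (card \<eta> + 1)) \<partial>\<alpha>)"
      using fin by (intro nn_integral_mono ennreal_leI monoD[OF f(1)]) (simp add: card_insert_if)
    then show ?thesis using emeasure_space_1 by simp
  qed
  have "Qint t \<eta> (\<lambda>\<omega>. ennreal (f (card \<omega>))) \<le>
     (\<Sum>x\<in>\<eta>. ennreal (death t \<eta> x) * ennreal (f (card \<eta> - 1))) +
     (\<Sum>x\<in>\<eta>. ennreal (birth t \<eta> x) * ennreal (f (card \<eta> + 1)))"
    unfolding Qint_def using fin 1 by (intro add_mono sum_mono mult_left_mono) auto
  also have "\<dots> = ennreal (death_sum t \<eta> * f (card \<eta> - 1) + birth_sum t \<eta> * f (card \<eta> + 1))"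
    using f(2) by (simp add: death_sum_def birth_sum_def ennreal_mult' sum_nonneg sum_distrib_right[symmetric])
  finally show ?thesis .
qed

lemma rates_bounded: "\<exists>C\<ge>0. \<forall>r\<in>{s..t}. m r \<le> C \<and> l r \<le> C"
proof -
  have "compact (m ` {s..t})" "compact (l ` {s..t})"
    using m_cont l_cont by (auto intro!: compact_continuous_image intro: continuous_on_subset)
  then have "bounded (m ` {s..t})" "bounded (l ` {s..t})" by (simp_all add: compact_imp_bounded)
  then obtain C1 C2 where "\<forall>r\<in>{s..t}. norm (m r) \<le> C1" "\<forall>r\<in>{s..t}. norm (l r) \<le> C2"
    unfolding bounded_iff by blast
  then show ?thesis by (intro exI[of _ "max 0 (max C1 C2)"]) fastforce
qed

lemma jump_rate_le_V:
  "\<exists>a>0. \<forall>\<eta>\<in>Gamma0. \<forall>t\<in>{s..T}. jump_rate t \<eta> \<le> a * (real (card \<eta>) + (real (card \<eta>))\<^sup>2)"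
proof -
  obtain C where C: "C \<ge> 0" "\<And>r. r \<in> {s..T} \<Longrightarrow> m r \<le> C \<and> l r \<le> C" using rates_bounded by blast
  have "jump_rate t \<eta> \<le> (2 * C + amax + bmax + 1) * (real (card \<eta>) + (real (card \<eta>))\<^sup>2)"
    if "\<eta> \<in> Gamma0" "t \<in> {s..T}" for t \<eta>
  proof -
    have fin: "finite \<eta>" using that by (simp add: Gamma0_def)
    let ?k = "real (card \<eta>)"
    have "jump_rate t \<eta> \<le> (m t + l t) * ?k + (amax + bmax) * ?k\<^sup>2"
      using sum_rates_le[OF fin, of t] by (simp add: jump_rate_eq algebra_simps)
    also have "\<dots> \<le> (2 * C + amax + bmax + 1) * ?k + (2 * C + amax + bmax + 1) * ?k\<^sup>2"
    proof (intro add_mono)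
      show "(m t + l t) * ?k \<le> (2 * C + amax + bmax + 1) * ?k"
        using C(2)[OF that(2)] amax_nonneg bmax_nonneg by (intro mult_right_mono) auto
      show "(amax + bmax) * ?k\<^sup>2 \<le> (2 * C + amax + bmax + 1) * ?k\<^sup>2"
        using C(1) by (intro mult_right_mono) auto
    qed
    finally show ?thesis by (simp add: algebra_simps)
  qed
  then show ?thesis using C(1) amax_nonneg bmax_nonneg
    by (intro exI[of _ "2 * C + amax + bmax + 1"]) auto
qed

text \<open>The interaction terms do not depend on time, so only \<open>m\<close> and \<open>l\<close> have to be compared. Taking the ratio
\<open>b\<close> at most \<open>1\<close> lets the interaction terms pass.\<close>

lemma jump_rate_lower_bound:
  assumes pos: "\<And>t. 0 < m t" "\<And>t. 0 < l t" and "s \<le> T"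
  shows "\<exists>b>0. \<forall>\<eta>\<in>Gamma0. \<forall>t\<in>{s..T}. b * jump_rate T \<eta> \<le> jump_rate t \<eta>"
proof -
  have ne: "{s..T} \<noteq> {}" using \<open>s \<le> T\<close> by simp
  obtain t1 where t1: "\<And>r. r \<in> {s..T} \<Longrightarrow> m t1 \<le> m r"
    using continuous_attains_inf[OF compact_Icc ne continuous_on_subset[OF m_cont subset_UNIV]] by blast
  obtain t2 where t2: "\<And>r. r \<in> {s..T} \<Longrightarrow> l t2 \<le> l r"
    using continuous_attains_inf[OF compact_Icc ne continuous_on_subset[OF l_cont subset_UNIV]] by blast
  define b where "b = min 1 (min (m t1 / m T) (l t2 / l T))"
  have b: "0 < b" "b \<le> 1" "b * m T \<le> m t1" "b * l T \<le> l t2"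
    using pos by (auto simp: b_def pos_le_divide_eq[symmetric])
  have "b * jump_rate T \<eta> \<le> jump_rate t \<eta>" if t: "t \<in> {s..T}" for t \<eta>
  proof -
    have "b * (m T + A) \<le> m t + A" "b * (l T + A) \<le> l t + A" if "0 \<le> A" for A
    proof -
      have "b * A \<le> 1 * A" using b(2) that by (rule mult_right_mono)
      then show "b * (m T + A) \<le> m t + A" "b * (l T + A) \<le> l t + A"
        using b(3,4) t1[OF t] t2[OF t] by (simp_all add: distrib_left)
    qed
    then have "b * (death T \<eta> x + birth T \<eta> x) \<le> death t \<eta> x + birth t \<eta> x" for x
      unfolding death_def birth_def distrib_left[of b "m T + _"]
      by (intro add_mono) (simp_all add: sum_nonneg)
    then show ?thesis unfolding jump_rate_def sum_distrib_left by (intro sum_mono)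
  qed
  then show ?thesis using b(1) by blast
qed

end

locale stable_dieckmann_law = dieckmann_law +
  fixes b :: real
  assumes b_nonneg: "0 \<le> b"
    and stable: "\<And>\<eta>. finite \<eta> \<Longrightarrow>
      - b * real (card \<eta>) \<le> (\<Sum>x\<in>\<eta>. \<Sum>y\<in>\<eta> - {x}. am (x - y) - bp (x - y))"
begin

text \<open>This is the stability condition rewritten for the total rates.\<close>

lemma birth_le_death:
  assumes "finite \<eta>"
  shows "birth_sum t \<eta> \<le> death_sum t \<eta> + (l t + b) * real (card \<eta>)"
proof -
  have "birth_sum t \<eta> - l t * real (card \<eta>) - b * real (card \<eta>) \<le> death_sum t \<eta> - m t * real (card \<eta>)"
    using stable[OF assms]
    by (simp add: birth_sum_def death_sum_def birth_def death_def sum.distrib sum_subtractf algebra_simps)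
  moreover have "0 \<le> m t * real (card \<eta>)" by simp
  ultimately show ?thesis unfolding distrib_right by linarith
qed

text \<open>With \<open>k = card \<eta>\<close>, a death changes \<open>k + k\<^sup>2\<close> by \<open>- 2 * k\<close> and a birth by \<open>2 * k + 2\<close>. The drift is
\<open>2 * k\<close> times the excess of births over deaths, which is linear in \<open>k\<close> by stability, plus twice the
birth rate, which is at most quadratic.\<close>

lemma V_drift:
  assumes \<eta>: "\<eta> \<in> Gamma0"
  defines "V \<equiv> \<lambda>\<omega> :: 'a set. real (card \<omega>) + (real (card \<omega>))\<^sup>2"
  shows "Qint t \<eta> (\<lambda>\<omega>. ennreal (V \<omega>)) \<le> ennreal ((4 * l t + 2 * b + 2 * bmax) * V \<eta> + jump_rate t \<eta> * V \<eta>)"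
proof -
  have fin: "finite \<eta>" using \<eta> by (simp add: Gamma0_def)
  define k where "k = real (card \<eta>)"
  let ?D = "death_sum t \<eta>" and ?B = "birth_sum t \<eta>"
  have k: "0 \<le> k" "k \<le> k\<^sup>2" using card_le_square by (simp_all add: k_def)
  have B1: "?B \<le> ?D + (l t + b) * k" and B2: "?B \<le> l t * k + bmax * k\<^sup>2"
    using birth_le_death[OF fin] sum_rates_le(2)[OF fin] by (simp_all add: k_def)
  have D0: "?D = 0" if "card \<eta> = 0" using that fin by (simp add: death_sum_def)
  have "Qint t \<eta> (\<lambda>\<omega>. ennreal (V \<omega>)) \<le>
     ennreal (?D * (real (card \<eta> - 1) + (real (card \<eta> - 1))\<^sup>2) + ?B * (real (card \<eta> + 1) + (real (card \<eta> + 1))\<^sup>2))"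
    unfolding V_def
    by (rule Qint_card_le[OF \<eta>, where f="\<lambda>n. real n + (real n)\<^sup>2"]) (auto simp: mono_def add_mono power_mono)
  also have "?D * (real (card \<eta> - 1) + (real (card \<eta> - 1))\<^sup>2) = ?D * (k\<^sup>2 - k)"
    using D0 by (cases "card \<eta>") (auto simp: k_def power2_eq_square algebra_simps)
  also have "?B * (real (card \<eta> + 1) + (real (card \<eta> + 1))\<^sup>2) = ?B * (k\<^sup>2 + k + 2 * k + 2)"
    by (simp add: k_def power2_eq_square algebra_simps)
  also have "?D * (k\<^sup>2 - k) + ?B * (k\<^sup>2 + k + 2 * k + 2) \<le>
     (4 * l t + 2 * b + 2 * bmax) * V \<eta> + jump_rate t \<eta> * V \<eta>"
  proof -
    have "2 * k * ?B \<le> 2 * k * (?D + (l t + b) * k)" using B1 k by (intro mult_left_mono) auto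
    moreover have "l t * k \<le> l t * k\<^sup>2" using k by (intro mult_left_mono) auto
    moreover have "0 \<le> b * k" "0 \<le> bmax * k" "0 \<le> l t * k" using b_nonneg bmax_nonneg k by auto
    ultimately show ?thesis using B2
      unfolding jump_rate_eq V_def k_def[symmetric] by (simp add: algebra_simps power2_eq_square)
  qed
  finally show ?thesis by (simp add: ennreal_leI)
qed

text \<open>Bound the births by the deaths plus \<open>(l + b) * k\<close>. The deaths then multiply the second difference of
\<open>k ^ n\<close>, the remainder multiplies a first difference, and both products are of order \<open>k ^ n\<close>.\<close>

lemma power_drift:
  "\<exists>c\<ge>0. \<forall>r\<in>{s..t}. \<forall>\<eta>\<in>Gamma0.
     Qint r \<eta> (\<lambda>\<omega>. ennreal (real (card \<omega>) ^ n)) \<le> ennreal ((c + jump_rate r \<eta>) * real (card \<eta>) ^ n)"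
proof -
  obtain R where R: "R \<ge> 0" "\<And>r. r \<in> {s..t} \<Longrightarrow> m r \<le> R \<and> l r \<le> R" using rates_bounded by blast
  obtain C where C: "C \<ge> 0" "\<And>k::real. k \<ge> 1 \<Longrightarrow> 0 \<le> (k + 1) ^ n + (k - 1) ^ n - 2 * k ^ n \<and>
     k\<^sup>2 * ((k + 1) ^ n + (k - 1) ^ n - 2 * k ^ n) \<le> C * k ^ n"
    using power_second_difference[of n] by auto
  obtain E where E: "E \<ge> 0" "\<And>k::real. k \<ge> 1 \<Longrightarrow> k * ((k + 1) ^ n - (k - 1) ^ n) \<le> E * k ^ n"
    using power_first_difference[of n] by auto
  let ?c = "(R + amax) * C + (R + b) * E"
  have "Qint r \<eta> (\<lambda>\<omega>. ennreal (real (card \<omega>) ^ n)) \<le> ennreal ((?c + jump_rate r \<eta>) * real (card \<eta>) ^ n)"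
    if r: "r \<in> {s..t}" and \<eta>: "\<eta> \<in> Gamma0" for r \<eta>
  proof -
    have fin: "finite \<eta>" using \<eta> by (simp add: Gamma0_def)
    define k where "k = real (card \<eta>)"
    let ?D = "death_sum r \<eta>" and ?B = "birth_sum r \<eta>"
    have "Qint r \<eta> (\<lambda>\<omega>. ennreal (real (card \<omega>) ^ n)) \<le>
       ennreal (?D * real (card \<eta> - 1) ^ n + ?B * real (card \<eta> + 1) ^ n)"
      by (rule Qint_card_le[OF \<eta>, where f="\<lambda>j. real j ^ n"]) (auto simp: mono_def power_mono)
    also have "?D * real (card \<eta> - 1) ^ n + ?B * real (card \<eta> + 1) ^ n \<le> (?c + jump_rate r \<eta>) * k ^ n"
    proof (cases "\<eta> = {}")
      case True
      then show ?thesis using C(1) E(1) R(1) amax_nonneg b_nonneg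
        by (simp add: death_sum_def birth_sum_def k_def)
    next
      case False
      then have card1: "card \<eta> \<ge> 1" using fin by (simp add: Suc_le_eq card_gt_0_iff)
      then have k: "k \<ge> 1" by (simp add: k_def)
      let ?S = "(k + 1) ^ n + (k - 1) ^ n - 2 * k ^ n"
      have km: "(k - 1) ^ n \<le> k ^ n" "k ^ n \<le> (k + 1) ^ n" using k by (auto intro!: power_mono)
      have "?D * (k - 1) ^ n + ?B * (k + 1) ^ n - (?D + ?B) * k ^ n =
        ?D * ((k - 1) ^ n - k ^ n) + ?B * ((k + 1) ^ n - k ^ n)" by (simp add: algebra_simps)
      also have "\<dots> \<le> ?D * ((k - 1) ^ n - k ^ n) + (?D + (l r + b) * k) * ((k + 1) ^ n - k ^ n)"
        using birth_le_death[OF fin, of r] km by (intro add_left_mono mult_right_mono) (auto simp: k_def)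
      also have "\<dots> = ?D * ?S + (l r + b) * (k * ((k + 1) ^ n - k ^ n))" by (simp add: algebra_simps)
      also have "\<dots> \<le> ((R + amax) * k\<^sup>2) * ?S + (R + b) * (k * ((k + 1) ^ n - (k - 1) ^ n))"
      proof (intro add_mono mult_right_mono mult_mono)
        have "?D \<le> m r * k + amax * k\<^sup>2" using sum_rates_le(1)[OF fin, of r] by (simp add: k_def)
        also have "\<dots> \<le> R * k\<^sup>2 + amax * k\<^sup>2"
          using R(1) R(2)[OF r] k by (intro add_right_mono mult_mono) (auto simp: power2_eq_square)
        finally show "?D \<le> (R + amax) * k\<^sup>2" by (simp add: algebra_simps)
      qed (use R r C(2)[OF k] k km b_nonneg in auto)
      also have "\<dots> = (R + amax) * (k\<^sup>2 * ?S) + (R + b) * (k * ((k + 1) ^ n - (k - 1) ^ n))"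
        by (simp only: mult.assoc)
      also have "\<dots> \<le> (R + amax) * (C * k ^ n) + (R + b) * (E * k ^ n)"
        using C(2)[OF k] E(2)[OF k] R(1) amax_nonneg b_nonneg by (intro add_mono mult_left_mono) auto
      finally show ?thesis using card1 by (simp add: k_def jump_rate_eq of_nat_diff algebra_simps)
    qed
    finally show ?thesis by (simp add: k_def ennreal_leI)
  qed
  moreover have "0 \<le> ?c" using C(1) E(1) R(1) amax_nonneg b_nonneg by simp
  ultimately show ?thesis by blast
qed

text \<open>The transported measure represents \<open>U_star\<close>, since a probability measure has density \<open>1\<close> with respect to
itself and no negative part. Its moment is the integral of the supermartingale bound for \<open>card ^ n\<close>.\<close>

theorem moments_propagate:
  assumes \<mu>: "prob_space \<mu>" "sets \<mu> = sets Gamma0_borel"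
    and mom: "(\<integral>\<^sup>+ \<eta>. ennreal (real (card \<eta>) ^ n) \<partial>\<mu>) < \<infinity>" and st: "s \<le> t"
  shows "\<exists>\<nu>. finite_measure \<nu> \<and> sets \<nu> = sets Gamma0_borel \<and>
    (\<forall>A\<in>sets Gamma0_borel. measure \<nu> A = U_star Q t s (measure \<mu>) A) \<and>
    (\<integral>\<^sup>+ \<eta>. ennreal (real (card \<eta>) ^ n) \<partial>\<nu>) < \<infinity>"
proof (intro exI[of _ "transport t s \<mu>"] conjI ballI)
  interpret \<mu>: prob_space \<mu> by fact
  have sp: "space \<mu> = Gamma0" using sets_eq_imp_space_eq[OF \<mu>(2)] by (simp add: space_Gamma0_borel)
  show "finite_measure (transport t s \<mu>)"
    using \<mu>(2) st by (intro finite_measure_transport) unfold_locales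
  show "measure (transport t s \<mu>) A = U_star Q t s (measure \<mu>) A" if A: "A \<in> sets Gamma0_borel" for A
  proof -
    have "U_star Q t s (measure \<mu>) A = measure (transport t s (density \<mu> (\<lambda>x. ennreal 1))) A
       - measure (transport t s (density \<mu> (\<lambda>x. ennreal (- 1)))) A"
      using \<mu>(2) A st
      by (intro U_star_eq_transport) (auto simp: set_lebesgue_integral_def sets.Int_space_eq2)
    moreover have "density \<mu> (\<lambda>x. ennreal 1) = \<mu>" by (simp add: density_1)
    moreover have "measure (transport t s (density \<mu> (\<lambda>x. ennreal (- 1)))) A = 0"
      using \<mu>(2) A measurable_P_min[OF A, of s t]
      by (simp add: measure_def emeasure_transport nn_integral_density ennreal_neg cong: measurable_cong_sets)
    ultimately show ?thesis by simp
  qed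
  obtain c where c: "c \<ge> 0" "\<And>r \<eta>. r \<in> {s..t} \<Longrightarrow> \<eta> \<in> Gamma0 \<Longrightarrow>
     Qint r \<eta> (\<lambda>\<omega>. ennreal (real (card \<omega>) ^ n)) \<le> ennreal ((c + jump_rate r \<eta>) * real (card \<eta>) ^ n)"
    using power_drift[of s t n] by blast
  note measurable_card[measurable]
  have [measurable]: "(\<lambda>\<eta>. real (card \<eta>) ^ n) \<in> borel_measurable (Gamma0_borel :: 'a set measure)" by measurable
  have "(\<integral>\<^sup>+ \<eta>. ennreal (real (card \<eta>) ^ n) \<partial>transport t s \<mu>) =
     (\<integral>\<^sup>+ \<eta>. (\<Sum>k. Pint k t (\<lambda>\<eta>. ennreal (real (card \<eta>) ^ n)) s \<eta>) \<partial>\<mu>)"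
    by (rule nn_integral_transport[OF \<mu>(2)]) measurable
  also have "\<dots> \<le> (\<integral>\<^sup>+ \<eta>. ennreal (exp (c * (t - s))) * ennreal (real (card \<eta>) ^ n) \<partial>\<mu>)"
  proof (intro nn_integral_mono)
    fix \<eta> assume "\<eta> \<in> space \<mu>"
    then have "(\<Sum>k. Pint k t (\<lambda>\<eta>. ennreal (real (card \<eta>) ^ n)) s \<eta>) \<le> ennreal (exp (c * (t - s)) * real (card \<eta>) ^ n)"
      using c st by (intro Pint_supermartingale[where s0=s]) (auto simp: sp)
    then show "(\<Sum>k. Pint k t (\<lambda>\<eta>. ennreal (real (card \<eta>) ^ n)) s \<eta>) \<le>
       ennreal (exp (c * (t - s))) * ennreal (real (card \<eta>) ^ n)" by (simp add: ennreal_mult')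
  qed
  also have "\<dots> = ennreal (exp (c * (t - s))) * (\<integral>\<^sup>+ \<eta>. ennreal (real (card \<eta>) ^ n) \<partial>\<mu>)"
  proof (rule nn_integral_cmult)
    show "(\<lambda>\<eta>. ennreal (real (card \<eta>) ^ n)) \<in> borel_measurable \<mu>"
      unfolding measurable_cong_sets[OF \<mu>(2) refl] by measurable
  qed
  also have "\<dots> < \<infinity>" using mom by (simp add: ennreal_mult_less_top)
  finally show "(\<integral>\<^sup>+ \<eta>. ennreal (real (card \<eta>) ^ n) \<partial>transport t s \<mu>) < \<infinity>" .
qed simp

end

section \<open>Continuity of the transition function\<close>

text \<open>Close to the limit the moved points cannot collide, since distinct points of \<open>S\<close> have a positive distance.
So injectivity of \<open>f k\<close> need not be assumed.\<close>

lemma continuous_config_tendsto: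
  assumes F: "continuous_map Gamma0_topology euclideanreal F"
    and S: "finite S" and f: "\<And>x. x \<in> S \<Longrightarrow> (\<lambda>k. f k x) \<longlonglongrightarrow> x"
  shows "(\<lambda>k. F (f k ` S)) \<longlonglongrightarrow> F S"
proof (rule tendstoI)
  fix e :: real assume e: "0 < e"
  have S0: "S \<in> Gamma0" using S by (simp add: Gamma0_def)
  have "openin Gamma0_topology {\<omega> \<in> topspace Gamma0_topology. F \<omega> \<in> ball (F S) e}"
    by (rule openin_continuous_map_preimage[OF F]) simp
  then obtain d where d: "d > 0" "near S d \<subseteq> {\<omega> \<in> Gamma0. F \<omega> \<in> ball (F S) e}"
    using S0 e unfolding openin_Gamma0_iff topspace_Gamma0_topology by auto
  obtain r where r: "r > 0" "\<And>x y. x \<in> S \<Longrightarrow> y \<in> S \<Longrightarrow> x \<noteq> y \<Longrightarrow> r \<le> dist x y"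
    using separated_radius[OF S] by blast
  have "\<forall>\<^sub>F k in sequentially. \<forall>x\<in>S. dist (f k x) x < min d (r / 2)"
    using S f d(1) r(1) by (intro eventually_ball_finite ballI tendstoD) auto
  then show "\<forall>\<^sub>F k in sequentially. dist (F (f k ` S)) (F S) < e"
  proof eventually_elim
    case (elim k)
    have "inj_on (f k) S"
    proof (rule inj_onI, rule ccontr)
      fix x y assume xy: "x \<in> S" "y \<in> S" "f k x = f k y" "x \<noteq> y"
      have "dist (f k x) x < r / 2" "dist (f k y) y < r / 2" using elim xy by auto
      then have "dist x y < r" using dist_triangle3[of x y "f k x"] xy(3) by simp
      then show False using r(2)[OF xy(1,2,4)] by simp
    qed
    then have "f k ` S \<in> near S d"
      using elim unfolding near_def by (auto intro!: exI[of _ "f k"] simp: inj_on_imp_bij_betw)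
    then show ?case using d(2) by (auto simp: dist_commute)
  qed
qed

lemma measurable_continuous_config:
  assumes F: "continuous_map Gamma0_topology euclideanreal F"
  shows "F \<in> borel_measurable Gamma0_borel"
proof (rule borel_measurableI)
  fix U :: "real set" assume "open U"
  then have "openin Gamma0_topology {\<omega> \<in> topspace Gamma0_topology. F \<omega> \<in> U}"
    by (intro openin_continuous_map_preimage[OF F]) simp
  from openin_sets_Gamma0[OF this] show "F -` U \<inter> space Gamma0_borel \<in> sets Gamma0_borel"
    by (simp add: topspace_Gamma0_topology space_Gamma0_borel vimage_def Int_def conj_commute)
qed

text \<open>A failure of continuity at \<open>(t, \<eta>)\<close> yields times and configurations within \<open>1 / (k + 1)\<close> of it with
values outside a neighbourhood; the matchings that witness this proximity are the maps \<open>f k\<close>.\<close>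

lemma continuous_map_time_config:
  fixes G :: "real \<Rightarrow> 'a::euclidean_space set \<Rightarrow> real"
  assumes seq: "\<And>\<tau> t \<eta> f. \<lbrakk>\<And>k. \<tau> k \<in> S; t \<in> S; \<tau> \<longlonglongrightarrow> t; \<eta> \<in> Gamma0;
      \<And>k. inj_on (f k) \<eta>; \<And>x. x \<in> \<eta> \<Longrightarrow> (\<lambda>k. f k x) \<longlonglongrightarrow> x\<rbrakk>
      \<Longrightarrow> (\<lambda>k. G (\<tau> k) (f k ` \<eta>)) \<longlonglongrightarrow> G t \<eta>"
  shows "continuous_map (prod_topology (top_of_set S) Gamma0_topology) euclideanreal (\<lambda>(t, \<eta>). G t \<eta>)"
  unfolding continuous_map_def
proof (intro conjI allI impI)
  let ?X = "prod_topology (top_of_set S) (Gamma0_topology :: 'a set topology)"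
  fix U :: "real set" assume "openin euclideanreal U"
  then have U: "open U" by simp
  show "openin ?X {p \<in> topspace ?X. (case p of (t, \<eta>) \<Rightarrow> G t \<eta>) \<in> U}" (is "openin _ ?P")
  proof (subst openin_subopen, intro ballI)
    fix p assume p: "p \<in> ?P"
    obtain t \<eta> where pe: "p = (t, \<eta>)" by (cases p)
    have t: "t \<in> S" and \<eta>: "\<eta> \<in> Gamma0" and GU: "G t \<eta> \<in> U"
      using p by (auto simp: pe topspace_Gamma0_topology)
    have "\<exists>d>0. \<forall>t'\<in>S. \<forall>\<omega>. dist t' t < d \<longrightarrow> \<omega> \<in> near \<eta> d \<longrightarrow> G t' \<omega> \<in> U"
    proof (rule ccontr)
      assume "\<not> ?thesis"
      then have "\<exists>t' \<omega>. t' \<in> S \<and> dist t' t < inverse (real (Suc k)) \<and>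
         \<omega> \<in> near \<eta> (inverse (real (Suc k))) \<and> G t' \<omega> \<notin> U" for k
        by (metis inverse_positive_iff_positive of_nat_0_less_iff zero_less_Suc)
      then obtain \<tau> \<omega> where \<tau>: "\<And>k. \<tau> k \<in> S" "\<And>k. dist (\<tau> k) t < inverse (real (Suc k))"
        and \<omega>: "\<And>k. \<omega> k \<in> near \<eta> (inverse (real (Suc k)))" and nU: "\<And>k. G (\<tau> k) (\<omega> k) \<notin> U"
        by metis
      from \<omega> have "\<exists>f. bij_betw f \<eta> (\<omega> k) \<and> (\<forall>x\<in>\<eta>. dist (f x) x < inverse (real (Suc k)))" for k
        by (simp add: near_def)
      then obtain f where f: "\<And>k. bij_betw (f k) \<eta> (\<omega> k)"
        "\<And>k x. x \<in> \<eta> \<Longrightarrow> dist (f k x) x < inverse (real (Suc k))" by metis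
      have lim: "X \<longlonglongrightarrow> x" if "\<And>k. dist (X k) x < inverse (real (Suc k))" for X and x :: "'c::metric_space"
      proof (rule metric_LIMSEQ_I)
        fix r :: real assume "0 < r"
        then obtain N where N: "inverse (real (Suc N)) < r" using reals_Archimedean by blast
        have "dist (X n) x < r" if "n \<ge> N" for n
        proof -
          have "inverse (real (Suc n)) \<le> inverse (real (Suc N))" using that by (intro le_imp_inverse_le) auto
          then show ?thesis using \<open>\<And>k. dist (X k) x < _\<close>[of n] N by linarith
        qed
        then show "\<exists>no. \<forall>n\<ge>no. dist (X n) x < r" by blast
      qed
      have "(\<lambda>k. G (\<tau> k) (f k ` \<eta>)) \<longlonglongrightarrow> G t \<eta>"
        using \<tau> t \<eta> f by (intro seq lim) (auto simp: bij_betw_def)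
      then have "\<forall>\<^sub>F k in sequentially. G (\<tau> k) (f k ` \<eta>) \<in> U" by (rule topological_tendstoD[OF _ U GU])
      then obtain k where "G (\<tau> k) (f k ` \<eta>) \<in> U" by (auto simp: eventually_sequentially)
      moreover have "f k ` \<eta> = \<omega> k" using f(1)[of k] by (simp add: bij_betw_def)
      ultimately show False using nU[of k] by simp
    qed
    then obtain d where d: "d > 0" "\<And>t' \<omega>. t' \<in> S \<Longrightarrow> dist t' t < d \<Longrightarrow> \<omega> \<in> near \<eta> d \<Longrightarrow> G t' \<omega> \<in> U"
      by blast
    have o: "openin (top_of_set S) (S \<inter> ball t d)" by (rule openin_open_Int) simp
    show "\<exists>T. openin ?X T \<and> p \<in> T \<and> T \<subseteq> ?P"
    proof (intro exI conjI)
      show "openin ?X ((S \<inter> ball t d) \<times> near \<eta> d)"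
        using o openin_near[OF \<eta>] by (simp add: openin_prod_Times_iff)
      show "p \<in> (S \<inter> ball t d) \<times> near \<eta> d" using t d(1) near_self[of d \<eta>] by (simp add: pe)
      show "(S \<inter> ball t d) \<times> near \<eta> d \<subseteq> ?P"
        using d(2) near_Gamma0[OF \<eta>] by (auto simp: topspace_Gamma0_topology dist_commute)
    qed
  qed
qed simp

context dieckmann_law begin

text \<open>Finite sets are Lebesgue null, hence null for the displacement law.\<close>

lemma AE_displaced_new: "finite \<eta> \<Longrightarrow> AE v in \<alpha>. x - v \<notin> \<eta>"
proof -
  assume "finite \<eta>"
  then have "(\<lambda>y. x - y) ` \<eta> \<in> null_sets lborel" by (intro finite_imp_null_set_lborel) simp
  then have "(\<lambda>y. x - y) ` \<eta> \<in> null_sets \<alpha>" using \<alpha>_continuous by (auto simp: absolutely_continuous_def)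
  then show ?thesis by (rule AE_I') (clarsimp, rule image_eqI[rotated], assumption, simp)
qed

text \<open>The same finite sum as \<open>Qint\<close>, for signed functions.\<close>

definition Qint_real :: "real \<Rightarrow> 'a set \<Rightarrow> ('a set \<Rightarrow> real) \<Rightarrow> real" where
  "Qint_real t \<eta> F = (\<Sum>x\<in>\<eta>. death t \<eta> x * F (\<eta> - {x})) +
     (\<Sum>x\<in>\<eta>. birth t \<eta> x * (LINT v|\<alpha>. F (insert (x - v) \<eta>)))"

context
  fixes F :: "'a set \<Rightarrow> real" and C :: real
  assumes F[measurable]: "F \<in> borel_measurable Gamma0_borel"
    and bound: "\<And>\<omega>. \<omega> \<in> Gamma0 \<Longrightarrow> \<bar>F \<omega>\<bar> \<le> C * (1 + real (card \<omega>) + (real (card \<omega>))\<^sup>2)"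
begin

lemma C_nonneg: "0 \<le> C"
  using bound[of "{}"] by (simp add: Gamma0_def)

lemma offspring_bound:
  assumes "finite \<eta>" "card \<eta> \<le> k"
  shows "\<bar>F (insert w \<eta>)\<bar> \<le> C * (1 + real (Suc k) + (real (Suc k))\<^sup>2)"
proof -
  have "card (insert w \<eta>) \<le> Suc k" using assms by (simp add: card_insert_if)
  then have "1 + real (card (insert w \<eta>)) + (real (card (insert w \<eta>)))\<^sup>2 \<le> 1 + real (Suc k) + (real (Suc k))\<^sup>2"
    by (intro add_mono power_mono) auto
  then have "C * (1 + real (card (insert w \<eta>)) + (real (card (insert w \<eta>)))\<^sup>2) \<le> C * (1 + real (Suc k) + (real (Suc k))\<^sup>2)"
    by (rule mult_left_mono[OF _ C_nonneg])
  moreover have "insert w \<eta> \<in> Gamma0" using assms by (simp add: Gamma0_def)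
  ultimately show ?thesis using bound by force
qed

lemma measurable_offspring_value: "finite \<eta> \<Longrightarrow> (\<lambda>v. F (insert (x - v) \<eta>)) \<in> borel_measurable \<alpha>"
  using measurable_compose[OF measurable_displaced F] by simp

lemma integrable_offspring: "finite \<eta> \<Longrightarrow> integrable \<alpha> (\<lambda>v. F (insert (x - v) \<eta>))"
  using measurable_offspring_value offspring_bound[of \<eta> "card \<eta>"]
  by (intro integrable_const_bound[where B="C * (1 + real (Suc (card \<eta>)) + (real (Suc (card \<eta>)))\<^sup>2)"]) auto

lemma Qint_eq_Qint_real:
  assumes "\<eta> \<in> Gamma0" and nn: "\<And>\<omega>. 0 \<le> F \<omega>"
  shows "Qint t \<eta> (\<lambda>\<omega>. ennreal (F \<omega>)) = ennreal (Qint_real t \<eta> F)"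
proof -
  have "finite \<eta>" using assms by (simp add: Gamma0_def)
  then have "(\<integral>\<^sup>+ v. ennreal (F (insert (x - v) \<eta>)) \<partial>\<alpha>) = ennreal (LINT v|\<alpha>. F (insert (x - v) \<eta>))" for x
    using nn by (intro nn_integral_eq_integral integrable_offspring) auto
  then show ?thesis using nn
    by (simp add: Qint_def Qint_real_def ennreal_mult'[symmetric] sum_nonneg ennreal_plus[symmetric] integral_nonneg
        del: ennreal_plus)
qed

end

lemma
  assumes F[measurable]: "F \<in> borel_measurable Gamma0_borel" and \<eta>: "\<eta> \<in> Gamma0"
    and bound: "\<And>\<omega>. \<omega> \<in> Gamma0 \<Longrightarrow> \<bar>F \<omega>\<bar> \<le> C * (1 + real (card \<omega>) + (real (card \<omega>))\<^sup>2)"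
  shows integrable_Q: "integrable (Q t \<eta>) F" and integral_Q: "(LINT \<omega>|Q t \<eta>. F \<omega>) = Qint_real t \<eta> F"
proof -
  have fin: "finite \<eta>" using \<eta> by (simp add: Gamma0_def)
  have nn: "integrable (Q t \<eta>) G \<and> (LINT \<omega>|Q t \<eta>. G \<omega>) = Qint_real t \<eta> G"
    if G[measurable]: "G \<in> borel_measurable Gamma0_borel" and "\<And>\<omega>. 0 \<le> G \<omega>" "\<And>\<omega>. G \<omega> \<le> \<bar>F \<omega>\<bar>" for G
  proof -
    have b: "\<bar>G \<omega>\<bar> \<le> C * (1 + real (card \<omega>) + (real (card \<omega>))\<^sup>2)" if "\<omega> \<in> Gamma0" for \<omega>
      using bound[OF that] \<open>\<And>\<omega>. 0 \<le> G \<omega>\<close>[of \<omega>] \<open>\<And>\<omega>. G \<omega> \<le> \<bar>F \<omega>\<bar>\<close>[of \<omega>] by linarith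
    have *: "(\<integral>\<^sup>+ \<omega>. ennreal (G \<omega>) \<partial>Q t \<eta>) = ennreal (Qint_real t \<eta> G)"
      using \<open>\<And>\<omega>. 0 \<le> G \<omega>\<close> by (simp add: nn_integral_Q[OF \<eta>] Qint_eq_Qint_real[OF G b \<eta>])
    have r0: "0 \<le> Qint_real t \<eta> G"
      using \<open>\<And>\<omega>. 0 \<le> G \<omega>\<close> by (auto simp: Qint_real_def intro!: add_nonneg_nonneg sum_nonneg mult_nonneg_nonneg integral_nonneg)
    have "integrable (Q t \<eta>) G"
      using * \<open>\<And>\<omega>. 0 \<le> G \<omega>\<close> by (intro integrableI_nonneg) auto
    then show ?thesis
      using * r0 \<open>\<And>\<omega>. 0 \<le> G \<omega>\<close> by (simp add: integral_eq_nn_integral)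
  qed
  have p: "integrable (Q t \<eta>) (\<lambda>\<omega>. max 0 (F \<omega>)) \<and> (LINT \<omega>|Q t \<eta>. max 0 (F \<omega>)) = Qint_real t \<eta> (\<lambda>\<omega>. max 0 (F \<omega>))"
    by (intro nn) auto
  have n: "integrable (Q t \<eta>) (\<lambda>\<omega>. max 0 (- F \<omega>)) \<and> (LINT \<omega>|Q t \<eta>. max 0 (- F \<omega>)) = Qint_real t \<eta> (\<lambda>\<omega>. max 0 (- F \<omega>))"
    by (intro nn) auto
  have eq: "F = (\<lambda>\<omega>. max 0 (F \<omega>) - max 0 (- F \<omega>))" by auto
  show "integrable (Q t \<eta>) F" by (subst eq) (use p n in auto)
  have i: "integrable \<alpha> (\<lambda>v. F (insert (x - v) \<eta>))" for x
    by (rule integrable_offspring[OF F bound fin])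
  have "(LINT v|\<alpha>. max 0 (F (insert (x - v) \<eta>))) - (LINT v|\<alpha>. max 0 (- F (insert (x - v) \<eta>))) =
     (LINT v|\<alpha>. F (insert (x - v) \<eta>))" for x
  proof -
    have "(LINT v|\<alpha>. max 0 (F (insert (x - v) \<eta>))) - (LINT v|\<alpha>. max 0 (- F (insert (x - v) \<eta>))) =
       (LINT v|\<alpha>. max 0 (F (insert (x - v) \<eta>)) - max 0 (- F (insert (x - v) \<eta>)))"
      using i[of x] by (intro Bochner_Integration.integral_diff[symmetric]) auto
    also have "\<dots> = (LINT v|\<alpha>. F (insert (x - v) \<eta>))"
      by (intro Bochner_Integration.integral_cong) auto
    finally show ?thesis .
  qed
  then have "Qint_real t \<eta> (\<lambda>\<omega>. max 0 (F \<omega>)) - Qint_real t \<eta> (\<lambda>\<omega>. max 0 (- F \<omega>)) = Qint_real t \<eta> F"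
    unfolding Qint_real_def add_diff_add sum_subtractf[symmetric] right_diff_distrib[symmetric]
    by (intro arg_cong2[where f=plus] sum.cong arg_cong2[where f=times]) auto
  then show "(LINT \<omega>|Q t \<eta>. F \<omega>) = Qint_real t \<eta> F"
    by (subst eq) (use p n in simp)
qed

text \<open>Indexing all sums by the points of the limit configuration leaves finitely many terms. The
rates converge by continuity. Outside the null set of displacements onto existing points the
values after a birth converge by \<open>continuous_config_tendsto\<close>, applied to \<open>f k\<close> extended by the moving newborn
point, and they are bounded because the cardinality is fixed.\<close>

lemma Qint_real_tendsto:
  assumes F: "continuous_map Gamma0_topology euclideanreal F"
    and bound: "\<And>\<omega>. \<omega> \<in> Gamma0 \<Longrightarrow> \<bar>F \<omega>\<bar> \<le> C * (1 + real (card \<omega>) + (real (card \<omega>))\<^sup>2)"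
    and \<eta>: "\<eta> \<in> Gamma0" and \<tau>: "\<tau> \<longlonglongrightarrow> t"
    and inj: "\<And>k. inj_on (f k) \<eta>" and f: "\<And>x. x \<in> \<eta> \<Longrightarrow> (\<lambda>k. f k x) \<longlonglongrightarrow> x"
  shows "(\<lambda>k. Qint_real (\<tau> k) (f k ` \<eta>) F) \<longlonglongrightarrow> Qint_real t \<eta> F"
proof -
  have fin: "finite \<eta>" using \<eta> by (simp add: Gamma0_def)
  have mF: "F \<in> borel_measurable Gamma0_borel" by (rule measurable_continuous_config[OF F])
  have rem: "f k ` \<eta> - {f k x} = f k ` (\<eta> - {x})" if "x \<in> \<eta>" for k x
    using inj[of k] that by (auto simp: inj_on_def)
  have eq: "Qint_real (\<tau> k) (f k ` \<eta>) F =
     (\<Sum>x\<in>\<eta>. (m (\<tau> k) + (\<Sum>y\<in>\<eta> - {x}. am (f k x - f k y))) * F (f k ` (\<eta> - {x}))) +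
     (\<Sum>x\<in>\<eta>. (l (\<tau> k) + (\<Sum>y\<in>\<eta> - {x}. bp (f k x - f k y))) * (LINT v|\<alpha>. F (insert (f k x - v) (f k ` \<eta>))))" for k
  proof -
    have s: "(\<Sum>z\<in>f k ` (\<eta> - {x}). c (f k x - z)) = (\<Sum>y\<in>\<eta> - {x}. c (f k x - f k y))" if "x \<in> \<eta>" for x and c :: "'a \<Rightarrow> real"
      using inj_on_subset[OF inj[of k], of "\<eta> - {x}"] by (simp add: sum.reindex)
    show ?thesis
      unfolding Qint_real_def sum.reindex[OF inj] death_def birth_def o_def
      by (intro arg_cong2[where f=plus] sum.cong) (simp_all add: s rem)
  qed
  have isc: "isCont m u" "isCont l u" "isCont am z" "isCont bp z" for u z
    using m_cont l_cont am_cont bp_cont by (simp_all add: continuous_on_eq_continuous_at)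
  have mt: "(\<lambda>k. m (\<tau> k)) \<longlonglongrightarrow> m t" "(\<lambda>k. l (\<tau> k)) \<longlonglongrightarrow> l t"
    by (rule isCont_tendsto_compose[OF isc(1) \<tau>], rule isCont_tendsto_compose[OF isc(2) \<tau>])
  have at: "(\<lambda>k. am (f k x - f k y)) \<longlonglongrightarrow> am (x - y)" "(\<lambda>k. bp (f k x - f k y)) \<longlonglongrightarrow> bp (x - y)"
    if "x \<in> \<eta>" "y \<in> \<eta>" for x y
    by (rule isCont_tendsto_compose[OF isc(3)] isCont_tendsto_compose[OF isc(4)]; intro tendsto_diff f that)+
  have int: "(\<lambda>k. LINT v|\<alpha>. F (insert (f k x - v) (f k ` \<eta>))) \<longlonglongrightarrow> (LINT v|\<alpha>. F (insert (x - v) \<eta>))"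
    if x: "x \<in> \<eta>" for x
  proof (rule integral_dominated_convergence)
    let ?K = "C * (1 + real (Suc (card \<eta>)) + (real (Suc (card \<eta>)))\<^sup>2)"
    show "integrable \<alpha> (\<lambda>_. ?K)" by simp
    show "(\<lambda>v. F (insert (x - v) \<eta>)) \<in> borel_measurable \<alpha>"
      by (rule measurable_offspring_value[OF mF bound fin])
    show "(\<lambda>v. F (insert (f k x - v) (f k ` \<eta>))) \<in> borel_measurable \<alpha>" for k
      using fin by (intro measurable_offspring_value[OF mF bound]) auto
    show "AE v in \<alpha>. norm (F (insert (f k x - v) (f k ` \<eta>))) \<le> ?K" for k
      using offspring_bound[OF mF bound, of "f k ` \<eta>" "card \<eta>"] fin by (simp add: card_image_le)
    have "AE v in \<alpha>. x - v \<notin> \<eta>" by (rule AE_displaced_new[OF fin])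
    then show "AE v in \<alpha>. (\<lambda>k. F (insert (f k x - v) (f k ` \<eta>))) \<longlonglongrightarrow> F (insert (x - v) \<eta>)"
    proof (rule AE_mp, intro AE_I2 impI)
      fix v assume v: "x - v \<notin> \<eta>"
      \<comment> \<open>The matching \<open>f k\<close>, extended by the motion of the newborn point.\<close>
      let ?g = "\<lambda>k y. if y = x - v then f k x - v else f k y"
      have "(\<lambda>k. F (?g k ` insert (x - v) \<eta>)) \<longlonglongrightarrow> F (insert (x - v) \<eta>)"
      proof (rule continuous_config_tendsto[OF F])
        fix y assume "y \<in> insert (x - v) \<eta>"
        then show "(\<lambda>k. ?g k y) \<longlonglongrightarrow> y"
          using f x by (cases "y = x - v") (auto intro!: tendsto_diff)
      qed (use fin in simp)
      moreover have "?g k ` insert (x - v) \<eta> = insert (f k x - v) (f k ` \<eta>)" for k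
        using v by (auto simp: image_iff)
      ultimately show "(\<lambda>k. F (insert (f k x - v) (f k ` \<eta>))) \<longlonglongrightarrow> F (insert (x - v) \<eta>)" by simp
    qed
  qed
  show ?thesis
    unfolding eq unfolding Qint_real_def death_def birth_def
    by (intro tendsto_add tendsto_sum tendsto_mult mt at int continuous_config_tendsto[OF F])
      (use fin f in auto)
qed

theorem Q_continuous:
  assumes F: "continuous_map Gamma0_topology euclideanreal F"
    and bound: "\<And>\<omega>. \<omega> \<in> Gamma0 \<Longrightarrow> \<bar>F \<omega>\<bar> \<le> C * (1 + real (card \<omega>) + (real (card \<omega>))\<^sup>2)"
  shows "continuous_map (prod_topology (top_of_set S) Gamma0_topology) euclideanreal
     (\<lambda>(t, \<eta>). LINT \<omega>|Q t \<eta>. F \<omega>)"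
proof (rule continuous_map_time_config)
  fix \<tau> :: "nat \<Rightarrow> real" and t and \<eta> :: "'a set" and f
  assume a: "\<tau> \<longlonglongrightarrow> t" "\<eta> \<in> Gamma0" "\<And>k. inj_on (f k) \<eta>" "\<And>x. x \<in> \<eta> \<Longrightarrow> (\<lambda>k. f k x) \<longlonglongrightarrow> x"
  have "f k ` \<eta> \<in> Gamma0" for k using a(2) by (simp add: Gamma0_def)
  then show "(\<lambda>k. LINT \<omega>|Q (\<tau> k) (f k ` \<eta>). F \<omega>) \<longlonglongrightarrow> (LINT \<omega>|Q t \<eta>. F \<omega>)"
    using Qint_real_tendsto[OF F bound a(2,1,3,4)]
    by (simp add: integral_Q[OF measurable_continuous_config[OF F] _ bound] a(2))
qed

end

section \<open>Tightness of jumps on compact sets of configurations\<close>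

text \<open>These sets serve as a basis of compact sets: every compact set of configurations is contained in one.\<close>

definition confined :: "nat \<Rightarrow> real \<Rightarrow> real \<Rightarrow> 'a::euclidean_space set set" where
  "confined N R d = {\<omega>\<in>Gamma0. card \<omega> \<le> N \<and> \<omega> \<subseteq> cball 0 R \<and> (\<forall>x\<in>\<omega>. \<forall>y\<in>\<omega>. x \<noteq> y \<longrightarrow> d \<le> dist x y)}"

lemma continuous_map_tuple_image:
  "continuous_map (tuple_topology n) Gamma0_topology (\<lambda>x. x ` {..<n} :: 'a::euclidean_space set)"
  unfolding continuous_map_def topspace_tuple_topology topspace_Gamma0_topology
proof (intro conjI allI impI)
  have *: "x ` {..<n} \<in> Gamma0_n n" if "x \<in> distinct_tuples n" for x :: "nat \<Rightarrow> 'a"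
    using image_distinct_tuples that by blast
  then show "(\<lambda>x. x ` {..<n}) \<in> distinct_tuples n \<rightarrow> (Gamma0 :: 'a set set)"
    by (auto simp: Gamma0_def)
  fix U :: "'a set set" assume "openin Gamma0_topology U"
  then have "openin (tuple_topology n) {x \<in> distinct_tuples n. x ` {..<n} \<in> U \<inter> Gamma0_n n}"
    unfolding openin_Gamma0_topology openin_Gamma0_n_topology by blast
  moreover have "{x \<in> distinct_tuples n. x ` {..<n} \<in> U \<inter> Gamma0_n n} = {x \<in> distinct_tuples n. x ` {..<n} \<in> U}"
    using * by auto
  ultimately show "openin (tuple_topology n) {x \<in> distinct_tuples n. x ` {..<n} \<in> U}" by simp
qed

text \<open>Tuples with coordinates in a ball form a compact set, on which the separation of the coordinates is a
closed condition; the configurations are their continuous images. A positive \<open>d\<close> keeps the limits away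
from the diagonals.\<close>

lemma compactin_confined:
  assumes "0 < d"
  shows "compactin Gamma0_topology (confined N R d :: 'a::euclidean_space set set)"
proof -
  define T where "T n = {x \<in> {..<n} \<rightarrow>\<^sub>E cball (0::'a) R. \<forall>i\<in>{..<n}. \<forall>j\<in>{..<n}. i \<noteq> j \<longrightarrow> d \<le> dist (x i) (x j)}" for n :: nat
  have T: "T n \<subseteq> distinct_tuples n" for n
  proof
    fix x assume x: "x \<in> T n"
    have "inj_on x {..<n}"
    proof (rule inj_onI, rule ccontr)
      fix i j assume ij: "i \<in> {..<n}" "j \<in> {..<n}" "x i = x j" "i \<noteq> j"
      then have "d \<le> dist (x i) (x j)" using x unfolding T_def by blast
      then show False using ij(3) assms by simp
    qed
    then show "x \<in> distinct_tuples n" using x by (auto simp: distinct_tuples_def T_def)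
  qed
  have "compactin (tuple_topology n) (T n)" for n
    unfolding tuple_topology_def compactin_subtopology
  proof
    let ?P = "product_topology (\<lambda>_. euclidean :: 'a topology) {..<n}"
    have K: "compactin ?P ({..<n} \<rightarrow>\<^sub>E cball 0 R)" by (simp add: compactin_PiE)
    have c: "closedin ?P {x \<in> topspace ?P. dist (x i) (x j) \<in> {d..}}" if "i < n" "j < n" for i j
    proof (rule closedin_continuous_map_preimage)
      have "continuous_map ?P (prod_topology euclidean euclidean) (\<lambda>x. (x i, x j))"
        using that by (intro continuous_map_pairedI continuous_map_product_projection) auto
      then have 1: "continuous_map ?P euclidean (\<lambda>x. (x i, x j))" by simp
      have "continuous_map euclidean euclideanreal (\<lambda>p :: 'a \<times> 'a. dist (fst p) (snd p))"
        by (simp add: continuous_on_dist continuous_on_fst continuous_on_snd)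
      from continuous_map_compose[OF 1 this]
      show "continuous_map ?P euclideanreal (\<lambda>x. dist (x i) (x j))" by (simp add: o_def)
    qed simp
    have top: "closedin ?P ({..<n} \<rightarrow>\<^sub>E UNIV)" using closedin_topspace[of ?P] by simp
    have "T n = ({..<n} \<rightarrow>\<^sub>E cball 0 R) \<inter>
        \<Inter>(insert (topspace ?P) ((\<lambda>(i, j). {x \<in> topspace ?P. dist (x i) (x j) \<in> {d..}}) ` {p \<in> {..<n} \<times> {..<n}. fst p \<noteq> snd p}))"
      unfolding T_def by (fastforce simp: PiE_iff)
    also have "compactin ?P \<dots>"
      by (intro compact_Int_closedin K closedin_Inter) (use c top in auto)
    finally show "compactin ?P (T n)" .
  qed (rule T)
  then have "compactin Gamma0_topology ((\<lambda>x. x ` {..<n}) ` T n)" for n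
    by (rule image_compactin[OF _ continuous_map_tuple_image])
  then have "compactin Gamma0_topology (\<Union>n\<in>{..N}. (\<lambda>x. x ` {..<n}) ` T n)"
    by (intro compactin_Union) auto
  also have "(\<Union>n\<in>{..N}. (\<lambda>x. x ` {..<n}) ` T n) = confined N R d"
  proof
    show "(\<Union>n\<in>{..N}. (\<lambda>x. x ` {..<n}) ` T n) \<subseteq> confined N R d"
    proof clarify
      fix n x assume "n \<le> N" and x: "x \<in> T n"
      have "card (x ` {..<n}) \<le> n" using card_image_le[of "{..<n}" x] by simp
      moreover have "x ` {..<n} \<subseteq> cball 0 R" using x by (auto simp: T_def PiE_iff simp del: mem_cball)
      moreover have "d \<le> dist (x i) (x j)" if "i < n" "j < n" "x i \<noteq> x j" for i j
      proof -
        have "i \<noteq> j" using that by auto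
        moreover have "i \<noteq> j \<Longrightarrow> d \<le> dist (x i) (x j)" using x that(1,2) unfolding T_def by simp
        ultimately show ?thesis by blast
      qed
      ultimately show "x ` {..<n} \<in> confined N R d"
        using \<open>n \<le> N\<close> unfolding confined_def Gamma0_def by auto
    qed
    show "confined N R d \<subseteq> (\<Union>n\<in>{..N}. (\<lambda>x. x ` {..<n}) ` T n)"
    proof
      fix \<omega> :: "'a set" assume \<omega>: "\<omega> \<in> confined N R d"
      then have "\<omega> \<in> Gamma0_n (card \<omega>)" by (simp add: confined_def Gamma0_def Gamma0_n_def)
      then obtain x where x: "x \<in> distinct_tuples (card \<omega>)" "x ` {..<card \<omega>} = \<omega>"
        using image_distinct_tuples by (metis (lifting) image_iff)
      have xm: "x i \<in> \<omega>" if "i \<in> {..<card \<omega>}" for i using x(2) that by blast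
      have "x \<in> T (card \<omega>)"
        unfolding T_def
      proof (intro CollectI conjI ballI impI)
        show "x \<in> {..<card \<omega>} \<rightarrow>\<^sub>E cball 0 R"
        proof (rule PiE_I)
          show "x i \<in> cball 0 R" if "i \<in> {..<card \<omega>}" for i
            using xm[OF that] \<omega> unfolding confined_def by blast
          show "x i = undefined" if "i \<notin> {..<card \<omega>}" for i
            using x(1) that unfolding distinct_tuples_def by (auto simp: PiE_def extensional_def)
        qed
        fix i j assume ij: "i \<in> {..<card \<omega>}" "j \<in> {..<card \<omega>}" "i \<noteq> j"
        then have "x i \<noteq> x j" using x(1) unfolding distinct_tuples_def inj_on_def by blast
        then show "d \<le> dist (x i) (x j)" using \<omega> xm[OF ij(1)] xm[OF ij(2)] unfolding confined_def by blast
      qed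
      moreover have "card \<omega> \<le> N" using \<omega> by (simp add: confined_def)
      ultimately show "\<omega> \<in> (\<Union>n\<in>{..N}. (\<lambda>x. x ` {..<n}) ` T n)" using x(2) by blast
    qed
  qed
  finally show ?thesis .
qed

text \<open>The sets \<open>O' j\<close> below are open, increase with \<open>j\<close> and cover everything, because each single configuration
is finite and hence bounded and separated.\<close>

lemma compactin_imp_confined:
  fixes B :: "'a::euclidean_space set set"
  assumes "compactin Gamma0_topology B"
  obtains N R d where "0 < d" "0 \<le> R" "B \<subseteq> confined N R d"
proof -
  define O' where "O' j = {\<omega>\<in>Gamma0. card \<omega> \<le> j \<and> \<omega> \<subseteq> ball (0::'a) (real j) \<and>
     (\<forall>x\<in>\<omega>. \<forall>y\<in>\<omega>. x \<noteq> y \<longrightarrow> inverse (real (Suc j)) < dist x y)}" for j :: nat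
  have o: "openin Gamma0_topology (O' j)" for j
    unfolding openin_Gamma0_iff
  proof (intro conjI ballI)
    fix \<omega> assume \<omega>: "\<omega> \<in> O' j"
    then have fin: "finite \<omega>" and \<omega>0: "\<omega> \<in> Gamma0" by (auto simp: O'_def Gamma0_def)
    let ?j = "inverse (real (Suc j))"
    have "\<exists>e>0. \<forall>x\<in>\<omega>. norm x + e \<le> real j"
    proof (rule finite_uniform_radius[OF fin])
      show "\<exists>e>0. norm x + e \<le> real j" if "x \<in> \<omega>" for x
        using \<omega> that by (intro exI[of _ "real j - norm x"]) (auto simp: O'_def)
    qed auto
    then obtain e1 where e1: "e1 > 0" "\<And>x. x \<in> \<omega> \<Longrightarrow> norm x + e1 \<le> real j" by blast
    have "\<exists>e>0. \<forall>p\<in>{p\<in>\<omega>\<times>\<omega>. fst p \<noteq> snd p}. ?j + 2 * e \<le> dist (fst p) (snd p)"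
    proof (rule finite_uniform_radius)
      show "finite {p\<in>\<omega>\<times>\<omega>. fst p \<noteq> snd p}" using fin by auto
      show "\<exists>e>0. ?j + 2 * e \<le> dist (fst p) (snd p)" if "p \<in> {p\<in>\<omega>\<times>\<omega>. fst p \<noteq> snd p}" for p
        using \<omega> that by (intro exI[of _ "(dist (fst p) (snd p) - ?j) / 2"]) (auto simp: O'_def diff_divide_distrib)
    qed auto
    then obtain e2 where e2: "e2 > 0"
      "\<And>x y. x \<in> \<omega> \<Longrightarrow> y \<in> \<omega> \<Longrightarrow> x \<noteq> y \<Longrightarrow> ?j + 2 * e2 \<le> dist x y" by fastforce
    have "near \<omega> (min e1 e2) \<subseteq> O' j"
    proof
      fix \<xi> assume \<xi>: "\<xi> \<in> near \<omega> (min e1 e2)"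
      then obtain f where f: "bij_betw f \<omega> \<xi>" "\<And>x. x \<in> \<omega> \<Longrightarrow> dist (f x) x < min e1 e2"
        by (auto simp: near_def)
      have \<xi>f: "\<xi> = f ` \<omega>" using f(1) by (simp add: bij_betw_def)
      have "norm (f x) < real j" if "x \<in> \<omega>" for x
        using e1(2)[OF that] f(2)[OF that] norm_triangle_sub[of "f x" x] by (simp add: dist_norm)
      moreover have "?j < dist (f x) (f y)" if "x \<in> \<omega>" "y \<in> \<omega>" "f x \<noteq> f y" for x y
      proof -
        have "x \<noteq> y" using that by auto
        then have "?j + 2 * e2 \<le> dist x y" using e2(2) that by blast
        moreover have "dist x y \<le> dist (f x) x + dist (f x) (f y) + dist (f y) y"
          using dist_triangle[of x y "f x"] dist_triangle[of "f x" y "f y"] dist_commute[of x "f x"] by linarith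
        ultimately show ?thesis using f(2)[OF that(1)] f(2)[OF that(2)] by linarith
      qed
      ultimately show "\<xi> \<in> O' j"
        using \<omega> near_Gamma0[OF \<omega>0 \<xi>] near_card[OF \<xi>] unfolding O'_def \<xi>f by auto
    qed
    then show "\<exists>e>0. near \<omega> e \<subseteq> O' j" using e1(1) e2(1) by (intro exI[of _ "min e1 e2"]) auto
  qed (auto simp: O'_def)
  have mono: "O' i \<subseteq> O' j" if "i \<le> j" for i j
  proof -
    have "inverse (real (Suc j)) \<le> inverse (real (Suc i))" using that by (intro le_imp_inverse_le) auto
    moreover have "ball (0::'a) (real i) \<subseteq> ball 0 (real j)" using that by (intro subset_ball) simp
    ultimately show ?thesis unfolding O'_def
      using that by (intro subsetI CollectI conjI ballI impI) (blast intro: order_trans le_less_trans)+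
  qed
  have "B \<subseteq> \<Union>(range O')"
  proof
    fix \<omega> assume "\<omega> \<in> B"
    then have \<omega>: "\<omega> \<in> Gamma0" "finite \<omega>"
      using compactin_subset_topspace[OF assms] by (auto simp: topspace_Gamma0_topology Gamma0_def)
    obtain r where r: "r > 0" "\<And>x y. x \<in> \<omega> \<Longrightarrow> y \<in> \<omega> \<Longrightarrow> x \<noteq> y \<Longrightarrow> r \<le> dist x y"
      using separated_radius[OF \<omega>(2)] by blast
    obtain n1 where n1: "inverse (real (Suc n1)) < r" using reals_Archimedean r(1) by blast
    obtain n2 where n2: "\<And>x. x \<in> \<omega> \<Longrightarrow> norm x < real n2"
    proof -
      obtain n2 where "Max (insert 0 (norm ` \<omega>)) < real n2" using reals_Archimedean2 by blast
      then have "\<And>x. x \<in> \<omega> \<Longrightarrow> norm x < real n2" using \<omega>(2) by (simp add: Max_less_iff)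
      then show thesis by (rule that)
    qed
    let ?j = "max (card \<omega>) (max n1 n2)"
    have "inverse (real (Suc ?j)) \<le> inverse (real (Suc n1))" by (intro le_imp_inverse_le) auto
    then have "inverse (real (Suc ?j)) < r" using n1 by linarith
    have "\<omega> \<in> O' ?j"
      unfolding O'_def
    proof (intro CollectI conjI ballI impI)
      show "\<omega> \<subseteq> ball 0 (real ?j)" using n2 by fastforce
      fix x y assume "x \<in> \<omega>" "y \<in> \<omega>" "x \<noteq> y"
      then have "r \<le> dist x y" by (rule r(2))
      then show "inverse (real (Suc ?j)) < dist x y" using \<open>inverse (real (Suc ?j)) < r\<close> by linarith
    qed (use \<omega> in auto)
    then show "\<omega> \<in> \<Union>(range O')" by blast
  qed
  obtain \<F> where \<F>: "finite \<F>" "\<F> \<subseteq> range O'" "B \<subseteq> \<Union>\<F>"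
  proof -
    have "\<forall>U\<in>range O'. openin Gamma0_topology U" using o by blast
    then show thesis using compactinD[OF assms, of "range O'"] \<open>B \<subseteq> \<Union>(range O')\<close> that by meson
  qed
  then obtain J where J: "finite J" "\<F> = O' ` J" by (metis finite_subset_image)
  have "B \<subseteq> O' (Max (insert 0 J))"
  proof
    fix \<omega> assume "\<omega> \<in> B"
    then obtain j where "j \<in> J" "\<omega> \<in> O' j" using \<F>(3) J(2) by auto
    then show "\<omega> \<in> O' (Max (insert 0 J))" using mono[of j "Max (insert 0 J)"] J(1) by auto
  qed
  also have "O' j \<subseteq> confined j (real j) (inverse (real (Suc j)))" for j
    unfolding O'_def confined_def by (auto simp: subset_eq intro: less_imp_le)
  finally show thesis by (intro that[of "inverse (real (Suc (Max (insert 0 J))))" "real (Max (insert 0 J))"]) auto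
qed

context dieckmann_law begin

lemma displacement_tight:
  assumes "0 < \<epsilon>" shows "\<exists>R\<ge>0. prob (- cball 0 R) < \<epsilon>"
proof -
  have "(\<lambda>n. prob (cball 0 (real n))) \<longlonglongrightarrow> prob (\<Union>n. cball 0 (real n))"
    by (intro finite_Lim_measure_incseq) (auto simp: incseq_def)
  moreover have "(\<Union>n. cball (0::'a) (real n)) = UNIV"
    using real_arch_simple by (auto simp: )
  ultimately have "(\<lambda>n. prob (cball 0 (real n))) \<longlonglongrightarrow> 1" using prob_space by simp
  then have "\<forall>\<^sub>F n in sequentially. 1 - \<epsilon> < prob (cball 0 (real n))"
    using assms by (intro order_tendstoD) auto
  then obtain n where "1 - \<epsilon> < prob (cball 0 (real n))" by (auto simp: eventually_sequentially)
  moreover have "prob (- cball 0 (real n)) = 1 - prob (cball 0 (real n))"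
    using prob_compl[of "cball 0 (real n)"] by (simp add: Compl_eq_Diff_UNIV)
  ultimately show ?thesis by (intro exI[of _ "real n"]) auto
qed

text \<open>Each point has a ball of small probability because there are no atoms; a finite cover of the compact ball
of centres by half as large balls makes the radius uniform.\<close>

lemma displacement_small_balls:
  assumes "0 < \<epsilon>" shows "\<exists>d>0. \<forall>z\<in>cball 0 R. prob (ball z d) < \<epsilon>"
proof -
  have "\<exists>r>0. prob (cball z r) < \<epsilon>" for z
  proof -
    have "(\<lambda>n. prob (cball z (inverse (real (Suc n))))) \<longlonglongrightarrow> prob (\<Inter>n. cball z (inverse (real (Suc n))))"
    proof (intro finite_Lim_measure_decseq decseq_SucI)
      fix n
      have "inverse (real (Suc (Suc n))) \<le> inverse (real (Suc n))" by (intro le_imp_inverse_le) auto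
      then show "cball z (inverse (real (Suc (Suc n)))) \<subseteq> cball z (inverse (real (Suc n)))" by (rule subset_cball)
    qed auto
    also have "(\<Inter>n. cball z (inverse (real (Suc n)))) = {z}"
    proof -
      have "x = z" if "\<And>n. dist z x \<le> inverse (real (Suc n))" for x
      proof (rule ccontr)
        assume "x \<noteq> z"
        then obtain n where "inverse (real (Suc n)) < dist z x" using reals_Archimedean[of "dist z x"] by auto
        then show False using that[of n] by simp
      qed
      then show ?thesis by auto
    qed
    also have "prob {z} = 0"
    proof -
      have "{z} \<in> null_sets \<alpha>" using \<alpha>_continuous finite_imp_null_set_lborel[of "{z}"]
        by (auto simp: absolutely_continuous_def)
      then show ?thesis by (simp add: measure_def null_sets_def)
    qed
    finally have "\<forall>\<^sub>F n in sequentially. prob (cball z (inverse (real (Suc n)))) < \<epsilon>"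
      using assms by (intro order_tendstoD)
    then obtain n where "prob (cball z (inverse (real (Suc n)))) < \<epsilon>" by (auto simp: eventually_sequentially)
    then show ?thesis by (intro exI[of _ "inverse (real (Suc n))"]) auto
  qed
  then obtain r where r: "\<And>z. r z > 0 \<and> prob (cball z (r z)) < \<epsilon>" by metis
  have cov: "cball (0::'a) R \<subseteq> (\<Union>z\<in>cball 0 R. ball z (r z / 2))" using r by force
  obtain Z where Z: "Z \<subseteq> cball (0::'a) R" "finite Z" "cball 0 R \<subseteq> (\<Union>z\<in>Z. ball z (r z / 2))"
    by (rule compactE_image[OF compact_cball _ cov]) auto
  have "\<exists>d>0. \<forall>z\<in>Z. d \<le> r z / 2"
  proof (rule finite_uniform_radius[OF Z(2)])
    show "\<exists>d>0. d \<le> r z / 2" for z using r[of z] by (intro exI[of _ "r z / 2"]) auto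
  qed auto
  then obtain d where d: "d > 0" "\<And>z. z \<in> Z \<Longrightarrow> d \<le> r z / 2" by blast
  have "prob (ball y d) < \<epsilon>" if y: "y \<in> cball 0 R" for y
  proof -
    obtain z where z: "z \<in> Z" "dist z y < r z / 2" using Z(3) y by auto
    have "ball y d \<subseteq> cball z (r z)"
    proof
      fix x assume "x \<in> ball y d"
      then show "x \<in> cball z (r z)" using z(2) d(2)[OF z(1)] dist_triangle[of z x y] by simp
    qed
    then have "prob (ball y d) \<le> prob (cball z (r z))" by (intro finite_measure_mono) auto
    then show ?thesis using r[of z] by linarith
  qed
  then show ?thesis using d(1) by blast
qed

text \<open>A death keeps a configuration in the confined set. A birth leaves the enlarged one only if the displacement
is longer than \<open>\<rho>\<close> or brings the newborn within \<open>d1\<close> of an old point \<open>y\<close>, that is \<open>v\<close> lies in the ball about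
\<open>x - y\<close>; these centres stay in the ball of radius \<open>2 * R\<close>.\<close>

theorem Q_tight:
  assumes "0 < \<epsilon>" "0 < T" and B: "compactin Gamma0_topology B"
  shows "\<exists>A. compactin Gamma0_topology A \<and>
    (\<forall>\<eta>\<in>B. (\<integral>\<^sup>+ r\<in>{0..T}. emeasure (Q r \<eta>) (Gamma0 - A) \<partial>lborel) < ennreal \<epsilon>)"
proof -
  obtain N R d where d: "0 < d" "0 \<le> R" and BK: "B \<subseteq> confined N R d"
    by (rule compactin_imp_confined[OF B])
  obtain C where C: "C \<ge> 0" "\<And>r. r \<in> {0..T} \<Longrightarrow> m r \<le> C \<and> l r \<le> C" using rates_bounded by blast
  define \<beta> where "\<beta> = real N * (C + real N * bmax)"
  define X where "X = T * (\<beta> * (1 + real N))"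
  \<comment> \<open>The final bound is \<open>X * \<epsilon>'\<close>; the summand \<open>1\<close> makes it strictly smaller than \<open>\<epsilon>\<close>, also if \<open>X = 0\<close>.\<close>
  define \<epsilon>' where "\<epsilon>' = \<epsilon> / (X + 1)"
  have \<beta>0: "0 \<le> \<beta>" using C(1) bmax_nonneg by (simp add: \<beta>_def)
  then have X0: "0 \<le> X" using assms(2) by (simp add: X_def)
  then have \<epsilon>': "0 < \<epsilon>'" using assms(1) by (simp add: \<epsilon>'_def)
  have X\<epsilon>: "X * \<epsilon>' < \<epsilon>"
    using X0 assms(1) by (simp add: \<epsilon>'_def divide_simps algebra_simps)
  obtain \<rho> where \<rho>: "0 \<le> \<rho>" "prob (- cball 0 \<rho>) < \<epsilon>'" using displacement_tight[OF \<epsilon>'] by blast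
  obtain d1 where d1: "0 < d1" "\<And>z. z \<in> cball 0 (2 * R) \<Longrightarrow> prob (ball z d1) < \<epsilon>'"
    using displacement_small_balls[OF \<epsilon>'] by blast
  define A :: "'a set set" where "A = confined (Suc N) (R + \<rho>) (min d d1)"
  have bound: "emeasure (Q r \<eta>) (Gamma0 - A) \<le> ennreal (\<beta> * (1 + real N) * \<epsilon>')"
    if \<eta>B: "\<eta> \<in> B" and r: "r \<in> {0..T}" for r \<eta>
  proof (cases "Gamma0 - A \<in> sets Gamma0_borel")
    \<comment> \<open>Outside the \<open>\<sigma>\<close>-algebra the measure is \<open>0\<close> by convention.\<close>
    case False
    then show ?thesis by (simp add: emeasure_notin_sets)
  next
    case True
    have \<eta>: "\<eta> \<in> Gamma0" "finite \<eta>" "card \<eta> \<le> N" "\<eta> \<subseteq> cball 0 R"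
      "\<And>x y. x \<in> \<eta> \<Longrightarrow> y \<in> \<eta> \<Longrightarrow> x \<noteq> y \<Longrightarrow> d \<le> dist x y"
      using \<eta>B BK by (auto simp: confined_def Gamma0_def)
    have sub: "\<omega> \<in> A" if "\<omega> \<subseteq> \<eta>" for \<omega>
    proof -
      have "card \<omega> \<le> card \<eta>" "finite \<omega>" using that \<eta>(2) by (auto intro: card_mono finite_subset)
      moreover have "\<omega> \<subseteq> cball 0 (R + \<rho>)" using that \<eta>(4) \<rho>(1) by (force simp: subset_eq)
      ultimately show ?thesis using that \<eta>(3,5) unfolding A_def confined_def Gamma0_def by fastforce
    qed
    have birth_out: "(\<integral>\<^sup>+ v. indicator (Gamma0 - A) (insert (x - v) \<eta>) \<partial>\<alpha>) \<le> ennreal ((1 + real N) * \<epsilon>')"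
      if x: "x \<in> \<eta>" for x
    proof -
      let ?E = "- cball 0 \<rho> \<union> (\<Union>y\<in>\<eta>. ball (x - y) d1)"
      have "insert (x - v) \<eta> \<in> A" if v: "v \<notin> ?E" for v
      proof -
        have vn: "norm v \<le> \<rho>" and vy: "\<And>y. y \<in> \<eta> \<Longrightarrow> d1 \<le> dist (x - y) v" using v by (auto simp: not_less)
        have dy: "d1 \<le> dist (x - v) y" if "y \<in> \<eta>" for y
        proof -
          have "dist (x - y) v = dist (x - v) y" by (simp add: dist_norm algebra_simps)
          then show ?thesis using vy[OF that] by simp
        qed
        have "card (insert (x - v) \<eta>) \<le> Suc N" using \<eta>(2,3) by (simp add: card_insert_if)
        moreover have "insert (x - v) \<eta> \<subseteq> cball 0 (R + \<rho>)"
        proof -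
          have "norm x \<le> R" using x \<eta>(4) by auto
          then have "norm (x - v) \<le> R + \<rho>" using vn norm_triangle_ineq4[of x v] by linarith
          then show ?thesis using \<eta>(4) \<rho>(1) by (force simp: subset_eq)
        qed
        moreover have "min d d1 \<le> dist a b"
          if "a \<in> insert (x - v) \<eta>" "b \<in> insert (x - v) \<eta>" "a \<noteq> b" for a b
          using that dy[of b] dy[of a] \<eta>(5)[of a b] by (auto simp: dist_commute min_le_iff_disj)
        ultimately show ?thesis using \<eta>(2) unfolding A_def confined_def Gamma0_def by blast
      qed
      then have "(\<integral>\<^sup>+ v. indicator (Gamma0 - A) (insert (x - v) \<eta>) \<partial>\<alpha>) \<le> (\<integral>\<^sup>+ v. indicator ?E v \<partial>\<alpha>)"
        by (intro nn_integral_mono) (auto split: split_indicator)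
      also have "\<dots> = ennreal (prob ?E)"
      proof -
        have "?E \<in> sets \<alpha>" using \<eta>(2) unfolding sets_\<alpha> by (intro sets.Un borel_comp sets.finite_UN) auto
        then show ?thesis by (simp add: emeasure_eq_measure)
      qed
      also have "prob ?E \<le> prob (- cball 0 \<rho>) + (\<Sum>y\<in>\<eta>. prob (ball (x - y) d1))"
      proof -
        have "prob ?E \<le> prob (- cball 0 \<rho>) + prob (\<Union>y\<in>\<eta>. ball (x - y) d1)"
          using \<eta>(2) by (intro measure_Un_le) (auto intro!: borel_comp sets.finite_UN)
        also have "prob (\<Union>y\<in>\<eta>. ball (x - y) d1) \<le> (\<Sum>y\<in>\<eta>. prob (ball (x - y) d1))"
          using \<eta>(2) by (intro finite_measure_subadditive_finite) auto
        finally show ?thesis by simp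
      qed
      also have "(\<Sum>y\<in>\<eta>. prob (ball (x - y) d1)) \<le> (\<Sum>y\<in>\<eta>. \<epsilon>')"
      proof (rule sum_mono)
        fix y assume "y \<in> \<eta>"
        then have "norm x \<le> R" "norm y \<le> R" using x \<eta>(4) by auto
        then have "x - y \<in> cball 0 (2 * R)" using norm_triangle_ineq4[of x y] by simp
        then show "prob (ball (x - y) d1) \<le> \<epsilon>'" using d1(2) by (simp add: less_imp_le)
      qed
      also have "(\<Sum>y\<in>\<eta>. \<epsilon>') \<le> real N * \<epsilon>'" using \<eta>(3) \<epsilon>' by simp
      also have "prob (- cball 0 \<rho>) + real N * \<epsilon>' \<le> (1 + real N) * \<epsilon>'"
        using \<rho>(2) by (simp add: algebra_simps)
      finally show ?thesis by (simp add: ennreal_leI)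
    qed
    have birth: "birth r \<eta> x \<le> C + real N * bmax" if "x \<in> \<eta>" for x
    proof -
      have "birth r \<eta> x \<le> l r + real (card \<eta>) * bmax" by (rule birth_le[OF \<eta>(2) that])
      also have "\<dots> \<le> C + real N * bmax"
        using C(2)[OF r] \<eta>(3) bmax_nonneg by (intro add_mono mult_right_mono) auto
      finally show ?thesis .
    qed
    have "emeasure (Q r \<eta>) (Gamma0 - A) = Qint r \<eta> (indicator (Gamma0 - A))"
      by (rule emeasure_Q[OF \<eta>(1) True])
    also have "\<dots> \<le> 0 + (\<Sum>x\<in>\<eta>. ennreal (C + real N * bmax) * ennreal ((1 + real N) * \<epsilon>'))"
      unfolding Qint_def using birth birth_out
    proof (intro add_mono sum_mono mult_mono)
      have "\<eta> - {x} \<in> A" for x by (rule sub) auto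
      then show "(\<Sum>x\<in>\<eta>. ennreal (death r \<eta> x) * indicator (Gamma0 - A) (\<eta> - {x})) \<le> 0" by simp
    qed (auto intro: ennreal_leI)
    also have "\<dots> = (\<Sum>x\<in>\<eta>. ennreal ((C + real N * bmax) * ((1 + real N) * \<epsilon>')))"
      using C(1) bmax_nonneg \<epsilon>' by (subst ennreal_mult) auto
    also have "\<dots> = ennreal (\<Sum>x\<in>\<eta>. (C + real N * bmax) * ((1 + real N) * \<epsilon>'))"
      using C(1) bmax_nonneg \<epsilon>' by (intro sum_ennreal) auto
    also have "(\<Sum>x\<in>\<eta>. (C + real N * bmax) * ((1 + real N) * \<epsilon>'))
        = real (card \<eta>) * ((C + real N * bmax) * ((1 + real N) * \<epsilon>'))" by simp
    also have "\<dots> \<le> ennreal (real N * ((C + real N * bmax) * ((1 + real N) * \<epsilon>')))"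
      using C(1) bmax_nonneg \<epsilon>' \<eta>(3) by (intro ennreal_leI mult_right_mono) auto
    finally show ?thesis by (simp add: \<beta>_def mult_ac)
  qed
  have "(\<integral>\<^sup>+ r\<in>{0..T}. emeasure (Q r \<eta>) (Gamma0 - A) \<partial>lborel) < ennreal \<epsilon>" if "\<eta> \<in> B" for \<eta>
  proof -
    have "(\<integral>\<^sup>+ r\<in>{0..T}. emeasure (Q r \<eta>) (Gamma0 - A) \<partial>lborel) \<le>
       (\<integral>\<^sup>+ r. ennreal (\<beta> * (1 + real N) * \<epsilon>') * indicator {0..T} r \<partial>lborel)"
      using bound[OF that] by (intro nn_integral_mono) (auto split: split_indicator)
    also have "\<dots> = ennreal (X * \<epsilon>')"
      using assms(2) \<beta>0 \<epsilon>'
      by (subst nn_integral_cmult_indicator) (simp_all add: X_def ennreal_mult'[symmetric] mult_ac)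
    also have "\<dots> < ennreal \<epsilon>" using X\<epsilon> assms(1) by (simp add: ennreal_lessI)
    finally show ?thesis .
  qed
  moreover have "compactin Gamma0_topology A" unfolding A_def using d d1(1) by (intro compactin_confined) simp
  ultimately show ?thesis by blast
qed

end

section \<open>Null sets of the Lebesgue-Poisson measure\<close>

abbreviation lebesgue_tuples :: "'i set \<Rightarrow> ('i \<Rightarrow> 'a::euclidean_space) measure" where
  "lebesgue_tuples I \<equiv> Pi\<^sub>M I (\<lambda>_. lborel)"

lemma product_lborel: "product_sigma_finite (\<lambda>_. lborel :: 'a::euclidean_space measure)"
  by (simp add: product_sigma_finite_def lborel.sigma_finite_measure_axioms)

lemma sets_inj_tuples:
  assumes "finite I"
  shows "{x \<in> space (lebesgue_tuples I :: ('i \<Rightarrow> 'a::euclidean_space) measure). inj_on x I} \<in> sets (lebesgue_tuples I)"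
proof -
  let ?M = "lebesgue_tuples I :: ('i \<Rightarrow> 'a) measure"
  have "{x \<in> space ?M. inj_on x I} = {x \<in> space ?M. \<forall>i\<in>I. \<forall>j\<in>I. dist (x i) (x j) = 0 \<longrightarrow> i = j}"
    by (auto simp: inj_on_def)
  also have "\<dots> \<in> sets ?M"
    using assms by (intro sets.sets_Collect_finite_All sets.sets_Collect_imp sets.sets_Collect_const
      borel_measurable_eq borel_measurable_dist measurable_component_singleton[of _ I, THEN measurable_compose[where L=borel]])
      (auto intro!: measurable_component_singleton)
  finally show ?thesis .
qed

text \<open>The factor removes the diagonals, on which the image of a tuple has too few points.\<close>

lemma measurable_tuple_config:
  assumes "finite I" and f: "f \<in> borel_measurable Gamma0_borel"
  shows "(\<lambda>x. (f (x ` I) :: ennreal) * indicator {x. inj_on x I} x) \<in> borel_measurable (lebesgue_tuples I)"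
proof -
  have "(\<lambda>x. x ` I) \<in> lebesgue_tuples I \<rightarrow>\<^sub>M Gamma0_borel"
    using assms(1) by (intro measurable_tuple_image) (auto intro: measurable_component_singleton[of _ I "\<lambda>_. lborel", simplified])
  then have 1: "(\<lambda>x. f (x ` I)) \<in> borel_measurable (lebesgue_tuples I)"
    by (rule measurable_compose) (rule f)
  have 2: "indicator {x. inj_on x I} \<in> borel_measurable (lebesgue_tuples I)"
    using sets_inj_tuples[OF assms(1)] by (intro borel_measurable_indicator'[where A="\<lambda>_. {x. inj_on x I}"]) simp
  show ?thesis using 1 2 by (rule borel_measurable_times_ennreal)
qed

lemma distinct_tuples_eq:
  "distinct_tuples n = {x \<in> space (lebesgue_tuples {..<n}). inj_on x {..<n}}"
  by (auto simp: distinct_tuples_def space_PiM)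

lemma nn_integral_lebesgue_image:
  fixes f :: "'a::euclidean_space set \<Rightarrow> ennreal"
  assumes f: "f \<in> borel_measurable Gamma0_borel"
  shows "(\<integral>\<^sup>+ \<eta>. f \<eta> \<partial>lebesgue_image n) =
    (\<integral>\<^sup>+ x. f (x ` {..<n}) * indicator {x. inj_on x {..<n}} x \<partial>lebesgue_tuples {..<n})"
proof -
  let ?M = "lebesgue_tuples {..<n} :: (nat \<Rightarrow> 'a) measure"
  have d: "distinct_tuples n \<inter> space ?M \<in> sets ?M"
  proof -
    have "distinct_tuples n \<inter> space ?M = {x \<in> space ?M. inj_on x {..<n}}"
      by (auto simp: distinct_tuples_eq)
    then show ?thesis using sets_inj_tuples[of "{..<n}", where ?'a='a] by simp
  qed
  have "(\<lambda>x. x ` {..<n}) \<in> ?M \<rightarrow>\<^sub>M Gamma0_borel"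
    by (intro measurable_tuple_image) (auto intro: measurable_component_singleton[of _ "{..<n}" "\<lambda>_. lborel", simplified])
  then have m: "(\<lambda>x. x ` {..<n}) \<in> restrict_space ?M (distinct_tuples n) \<rightarrow>\<^sub>M Gamma0_borel"
    by (rule measurable_restrict_space1)
  show ?thesis
    unfolding lebesgue_image_def
    by (subst nn_integral_distr[OF m], simp add: f, subst nn_integral_restrict_space[OF d], intro nn_integral_cong)
      (auto simp: distinct_tuples_eq split: split_indicator)
qed

lemma
  shows sets_lambda_LP [measurable_cong, simp]: "sets lambda_LP = sets Gamma0_borel"
    and space_lambda_LP [simp]: "space lambda_LP = Gamma0"
  unfolding lambda_LP_def space_Gamma0_borel[symmetric]
  by (simp_all only: sets.sets_measure_of_eq sets.space_measure_of_eq)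

lemma nn_integral_lambda_LP:
  fixes f :: "'a::euclidean_space set \<Rightarrow> ennreal"
  assumes f: "f \<in> borel_measurable Gamma0_borel"
  shows "(\<integral>\<^sup>+ \<eta>. f \<eta> \<partial>lambda_LP) = f {} +
    (\<Sum>n. ennreal (1 / fact (Suc n)) * (\<integral>\<^sup>+ \<eta>. f \<eta> \<partial>lebesgue_image (Suc n)))"
proof -
  let ?G = "Gamma0_borel :: 'a set measure"
  let ?L = "\<lambda>f :: 'a set \<Rightarrow> ennreal. f {} + (\<Sum>n. ennreal (1 / fact (Suc n)) * (\<integral>\<^sup>+ \<eta>. f \<eta> \<partial>lebesgue_image (Suc n)))"
  have [measurable_cong, simp]: "sets (lebesgue_image n) = sets ?G" for n by (simp add: lebesgue_image_def)
  have sp: "space (lebesgue_image n) = space ?G" for n by (simp add: lebesgue_image_def)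
  have eq: "lambda_LP = measure_of (space ?G) (sets ?G) (\<lambda>A. ?L (indicator A))"
    unfolding lambda_LP_def space_Gamma0_borel[symmetric]
    by (intro measure_of_eq) (auto simp: sets.space_closed sets.sigma_sets_eq)
  show ?thesis
    unfolding eq
  proof (rule measure_of_functional(2)[where L="?L", OF _ _ _ f])
    fix f g :: "'a set \<Rightarrow> ennreal" assume "\<And>x. x \<in> space ?G \<Longrightarrow> f x = g x"
    moreover have "{} \<in> space ?G" by (simp add: space_Gamma0_borel Gamma0_def)
    moreover have "(\<integral>\<^sup>+ \<eta>. f \<eta> \<partial>lebesgue_image n) = (\<integral>\<^sup>+ \<eta>. g \<eta> \<partial>lebesgue_image n)" for n
      using calculation by (intro nn_integral_cong) (simp add: sp)
    ultimately show "?L f = ?L g" by simp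
  next
    fix c and f :: "'a set \<Rightarrow> ennreal" assume [measurable]: "f \<in> borel_measurable ?G"
    show "?L (\<lambda>x. c * f x) = c * ?L f"
      by (simp add: nn_integral_cmult distrib_left mult.left_commute[of _ c])
  next
    fix f :: "nat \<Rightarrow> 'a set \<Rightarrow> ennreal" assume [measurable]: "\<And>i. f i \<in> borel_measurable ?G"
    have "(\<Sum>n. ennreal (1 / fact (Suc n)) * (\<integral>\<^sup>+ \<eta>. (\<Sum>i. f i \<eta>) \<partial>lebesgue_image (Suc n))) =
       (\<Sum>n. \<Sum>i. ennreal (1 / fact (Suc n)) * (\<integral>\<^sup>+ \<eta>. f i \<eta> \<partial>lebesgue_image (Suc n)))"
      by (simp add: nn_integral_suminf)
    also have "\<dots> = (\<Sum>i. \<Sum>n. ennreal (1 / fact (Suc n)) * (\<integral>\<^sup>+ \<eta>. f i \<eta> \<partial>lebesgue_image (Suc n)))"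
      by (rule suminf_swap_ennreal)
    finally show "?L (\<lambda>x. \<Sum>i. f i x) = (\<Sum>i. ?L (f i))"
      by (simp only: suminf_add[symmetric, OF summableI summableI])
  qed
qed

text \<open>The product over no coordinates is the unit mass at the only tuple, which is everywhere undefined.\<close>

lemma AE_tuples_0:
  fixes P :: "('i \<Rightarrow> 'a::euclidean_space) \<Rightarrow> bool"
  shows "(AE x in lebesgue_tuples {}. P x) \<longleftrightarrow> P (\<lambda>_. undefined)"
proof -
  have "(AE x in lebesgue_tuples {}. P x) \<longleftrightarrow> (AE x in (lebesgue_tuples {} :: ('i \<Rightarrow> 'a::euclidean_space) measure). P (\<lambda>_. undefined))"
    by (intro AE_cong) (auto simp: space_PiM_empty)
  also have "\<dots> \<longleftrightarrow> P (\<lambda>_. undefined)"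
    by (rule prob_space.AE_const) (auto intro!: prob_spaceI simp: emeasure_PiM_empty space_PiM_empty)
  finally show ?thesis .
qed

text \<open>The factorials are positive and do not affect null sets. The empty configuration is the image of the empty
tuple, so its unit mass becomes the case \<open>n = 0\<close>.\<close>

lemma nn_integral_lambda_LP_eq_0_iff:
  fixes f :: "'a::euclidean_space set \<Rightarrow> ennreal"
  assumes f: "f \<in> borel_measurable Gamma0_borel"
  shows "(\<integral>\<^sup>+ \<eta>. f \<eta> \<partial>lambda_LP) = 0 \<longleftrightarrow>
    (\<forall>n :: nat. AE x in lebesgue_tuples {..<n}. inj_on x {..<n} \<longrightarrow> f (x ` {..<n}) = 0)"
proof -
  have I: "(\<integral>\<^sup>+ \<eta>. f \<eta> \<partial>lebesgue_image n) = 0 \<longleftrightarrow>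
     (AE x in lebesgue_tuples {..<n}. inj_on x {..<n} \<longrightarrow> f (x ` {..<n}) = 0)" for n
    unfolding nn_integral_lebesgue_image[OF f]
    unfolding nn_integral_0_iff_AE[OF measurable_tuple_config[OF finite_lessThan f]]
    by (intro AE_cong) (auto simp: indicator_def)
  have "(\<integral>\<^sup>+ \<eta>. f \<eta> \<partial>lambda_LP) = 0 \<longleftrightarrow> f {} = 0 \<and> (\<forall>n. (\<integral>\<^sup>+ \<eta>. f \<eta> \<partial>lebesgue_image (Suc n)) = 0)"
    unfolding nn_integral_lambda_LP[OF f]
    by (auto simp: suminf_eq_zero_iff)
  also have "\<dots> \<longleftrightarrow> (\<forall>n :: nat. AE x in lebesgue_tuples {..<n}. inj_on x {..<n} \<longrightarrow> f (x ` {..<n}) = 0)"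
  proof -
    let ?A = "\<lambda>n :: nat. AE x in lebesgue_tuples {..<n}. inj_on x {..<n} \<longrightarrow> f (x ` {..<n}) = 0"
    have split: "(\<forall>n. P n) \<longleftrightarrow> P 0 \<and> (\<forall>n. P (Suc n))" for P :: "nat \<Rightarrow> bool"
      by (metis not0_implies_Suc)
    have "(\<forall>n. ?A n) \<longleftrightarrow> ?A 0 \<and> (\<forall>n. ?A (Suc n))" by (rule split)
    moreover have "?A 0 \<longleftrightarrow> f {} = 0" unfolding lessThan_0 AE_tuples_0 by simp
    ultimately show ?thesis unfolding I by blast
  qed
  finally show ?thesis .
qed

text \<open>Boxes have the same volume after a renaming of the coordinates.\<close>

lemma lebesgue_tuples_reindex:
  fixes h :: "'i \<Rightarrow> 'j"
  assumes "finite I" and h: "bij_betw h I J"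
  shows "distr (lebesgue_tuples J) (lebesgue_tuples I) (\<lambda>x. \<lambda>i\<in>I. x (h i)) =
    (lebesgue_tuples I :: ('i \<Rightarrow> 'a::euclidean_space) measure)"
proof (rule product_sigma_finite.PiM_eqI[OF product_lborel \<open>finite I\<close>])
  have J: "finite J" using assms bij_betw_finite by blast
  have hJ: "h i \<in> J" if "i \<in> I" for i using h that by (auto simp: bij_betw_def)
  have m: "(\<lambda>x. \<lambda>i\<in>I. x (h i)) \<in> lebesgue_tuples J \<rightarrow>\<^sub>M (lebesgue_tuples I :: ('i \<Rightarrow> 'a) measure)"
    by (intro measurable_restrict measurable_component_singleton hJ)
  fix A :: "'i \<Rightarrow> 'a set" assume A: "\<And>i. i \<in> I \<Longrightarrow> A i \<in> sets lborel"
  let ?k = "the_inv_into I h"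
  have k: "?k j \<in> I" "h (?k j) = j" if "j \<in> J" for j
    using h that by (auto simp: bij_betw_def the_inv_into_into f_the_inv_into_f)
  have kh: "?k (h i) = i" if "i \<in> I" for i using h that by (auto simp: bij_betw_def the_inv_into_f_f)
  have "(\<lambda>x. \<lambda>i\<in>I. x (h i)) -` Pi\<^sub>E I A \<inter> space (lebesgue_tuples J) = Pi\<^sub>E J (\<lambda>j. A (?k j))"
  proof (rule set_eqI)
    fix x :: "'j \<Rightarrow> 'a"
    have "(\<forall>i\<in>I. x (h i) \<in> A i) \<longleftrightarrow> (\<forall>j\<in>J. x j \<in> A (?k j))" using k kh hJ by metis
    then show "x \<in> (\<lambda>x. \<lambda>i\<in>I. x (h i)) -` Pi\<^sub>E I A \<inter> space (lebesgue_tuples J) \<longleftrightarrow>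
        x \<in> Pi\<^sub>E J (\<lambda>j. A (?k j))"
      by (auto simp: space_PiM PiE_def Pi_def)
  qed
  then have "emeasure (distr (lebesgue_tuples J) (lebesgue_tuples I) (\<lambda>x. \<lambda>i\<in>I. x (h i))) (Pi\<^sub>E I A) =
     emeasure (lebesgue_tuples J) (Pi\<^sub>E J (\<lambda>j. A (?k j)))"
    using A assms(1) by (subst emeasure_distr[OF m]) (auto intro!: sets_PiM_I_finite)
  also have "\<dots> = (\<Prod>j\<in>J. emeasure lborel (A (?k j)))"
    using A k by (intro product_sigma_finite.emeasure_PiM[OF product_lborel J]) auto
  also have "\<dots> = (\<Prod>i\<in>I. emeasure lborel (A i))"
    using kh by (subst prod.reindex_bij_betw[OF h, symmetric]) (auto intro!: prod.cong)
  finally show "emeasure (distr (lebesgue_tuples J) (lebesgue_tuples I) (\<lambda>x. \<lambda>i\<in>I. x (h i))) (Pi\<^sub>E I A) =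
     (\<Prod>i\<in>I. emeasure lborel (A i))" .
qed simp

text \<open>An arbitrary finite index set is needed because removing a coordinate from \<open>{..<n}\<close> leaves a set of
indices that is not an initial segment.\<close>

lemma AE_tuples_of_lambda_LP_null:
  fixes f :: "'a::euclidean_space set \<Rightarrow> ennreal"
  assumes f: "f \<in> borel_measurable Gamma0_borel" and 0: "(\<integral>\<^sup>+ \<eta>. f \<eta> \<partial>lambda_LP) = 0"
    and I: "finite (I :: 'i set)"
  shows "AE x in lebesgue_tuples I. inj_on x I \<longrightarrow> f (x ` I) = 0"
proof -
  let ?J = "{..<card I}"
  obtain h where h: "bij_betw h ?J I" using ex_bij_betw_nat_finite[OF I] by (metis atLeast0LessThan)
  have ae: "AE x in lebesgue_tuples ?J. inj_on x ?J \<longrightarrow> f (x ` ?J) = 0"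
    by (rule nn_integral_lambda_LP_eq_0_iff[OF f, THEN iffD1, OF 0, THEN spec])
  have m: "(\<lambda>x. \<lambda>j\<in>?J. x (h j)) \<in> lebesgue_tuples I \<rightarrow>\<^sub>M (lebesgue_tuples ?J :: (nat \<Rightarrow> 'a) measure)"
    using h by (intro measurable_restrict measurable_component_singleton) (auto simp: bij_betw_def)
  from ae have "AE x in distr (lebesgue_tuples I) (lebesgue_tuples ?J) (\<lambda>x. \<lambda>j\<in>?J. x (h j)). inj_on x ?J \<longrightarrow> f (x ` ?J) = 0"
    by (subst lebesgue_tuples_reindex[OF _ h]) simp
  from AE_distrD[OF m this]
  have "AE x in lebesgue_tuples I. inj_on (\<lambda>j\<in>?J. x (h j)) ?J \<longrightarrow> f ((\<lambda>j\<in>?J. x (h j)) ` ?J) = 0" .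
  then show ?thesis
  proof (rule AE_mp, intro AE_I2 impI)
    fix x :: "'i \<Rightarrow> 'a" assume *: "inj_on (\<lambda>j\<in>?J. x (h j)) ?J \<longrightarrow> f ((\<lambda>j\<in>?J. x (h j)) ` ?J) = 0" and x: "inj_on x I"
    have "inj_on (x \<circ> h) ?J" using h x by (intro comp_inj_on) (auto simp: bij_betw_def)
    then have "inj_on (\<lambda>j\<in>?J. x (h j)) ?J" by (simp add: inj_on_def)
    moreover have "(\<lambda>j\<in>?J. x (h j)) ` ?J = x ` h ` ?J" by (simp add: image_image)
    then have "(\<lambda>j\<in>?J. x (h j)) ` ?J = x ` I" by (simp only: bij_betw_imp_surj_on[OF h])
    ultimately show "f (x ` I) = 0" using * by simp
  qed
qed

text \<open>The function of the remaining coordinates vanishes almost everywhere and does not depend on the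
\<open>i\<close>-th coordinate, so its integral over all coordinates is \<open>0\<close>.\<close>

lemma AE_remove_of_lambda_LP_null:
  fixes f :: "'a::euclidean_space set \<Rightarrow> ennreal"
  assumes f: "f \<in> borel_measurable Gamma0_borel" and 0: "(\<integral>\<^sup>+ \<eta>. f \<eta> \<partial>lambda_LP) = 0"
    and I: "finite (I :: 'i set)" "i \<in> I"
  shows "AE x in lebesgue_tuples I. inj_on x I \<longrightarrow> f (x ` I - {x i}) = 0"
proof -
  let ?I = "I - {i}"
  let ?g = "\<lambda>x. f (x ` ?I) * indicator {x. inj_on x ?I} x"
  have fin: "finite ?I" and II: "insert i ?I = I" using I by auto
  have g: "?g \<in> borel_measurable (lebesgue_tuples ?I)" by (rule measurable_tuple_config[OF fin f])
  have "(\<lambda>x. restrict x ?I) \<in> lebesgue_tuples I \<rightarrow>\<^sub>M (lebesgue_tuples ?I :: ('i \<Rightarrow> 'a) measure)"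
    by (rule measurable_restrict_subset) auto
  from measurable_compose[OF this g]
  have gI: "?g \<in> borel_measurable (lebesgue_tuples I)"
    by (simp add: inj_on_def indicator_def)
  have "(\<integral>\<^sup>+ x. ?g x \<partial>lebesgue_tuples (insert i ?I)) =
     (\<integral>\<^sup>+ x. (\<integral>\<^sup>+ y. ?g (x(i := y)) \<partial>lborel) \<partial>lebesgue_tuples ?I)"
    using gI II by (intro product_sigma_finite.product_nn_integral_insert[OF product_lborel fin]) auto
  also have "\<dots> = (\<integral>\<^sup>+ x. (\<integral>\<^sup>+ y. ?g x \<partial>(lborel :: 'a measure)) \<partial>lebesgue_tuples ?I)"
  proof -
    have "?g (x(i := y)) = ?g x" for x y
      by (auto simp: inj_on_def indicator_def fun_upd_image)
    then show ?thesis by simp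
  qed
  also have "\<dots> = (\<integral>\<^sup>+ x. 0 \<partial>(lebesgue_tuples ?I :: ('i \<Rightarrow> 'a) measure))"
  proof (intro nn_integral_cong_AE)
    show "AE x in lebesgue_tuples ?I. (\<integral>\<^sup>+ y. ?g x \<partial>(lborel :: 'a measure)) = 0"
      using AE_tuples_of_lambda_LP_null[OF f 0 fin]
    proof (rule AE_mp, intro AE_I2 impI)
      fix x :: "'i \<Rightarrow> 'a" assume "inj_on x ?I \<longrightarrow> f (x ` ?I) = 0"
      then have "?g x = 0" by (auto simp: indicator_def)
      then show "(\<integral>\<^sup>+ y. ?g x \<partial>(lborel :: 'a measure)) = 0" by simp
    qed
  qed
  finally have "(\<integral>\<^sup>+ x. ?g x \<partial>lebesgue_tuples I) = 0" unfolding II by simp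
  then have "AE x in lebesgue_tuples I. ?g x = 0" using gI by (simp add: nn_integral_0_iff_AE)
  then show ?thesis
  proof (rule AE_mp, intro AE_I2 impI)
    fix x :: "'i \<Rightarrow> 'a" assume x: "?g x = 0" "inj_on x I"
    have "x ` ?I = x ` I - {x i}" using x(2) I(2) by (auto simp: inj_on_def)
    moreover have "inj_on x ?I" using x(2) by (rule inj_on_subset) auto
    ultimately show "f (x ` I - {x i}) = 0" using x(1) by simp
  qed
qed

text \<open>Fubini's theorem for tuples of length \<open>n + 1\<close>, integrating the last coordinate first; that coordinate
avoids the finitely many others almost surely.\<close>

lemma AE_insert_of_lambda_LP_null:
  fixes f :: "'a::euclidean_space set \<Rightarrow> ennreal" and n :: nat
  assumes f: "f \<in> borel_measurable Gamma0_borel" and 0: "(\<integral>\<^sup>+ \<eta>. f \<eta> \<partial>lambda_LP) = 0"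
  shows "AE x in lebesgue_tuples {..<n}. inj_on x {..<n} \<longrightarrow> (AE w in lborel. f (insert w (x ` {..<n})) = 0)"
proof -
  let ?g = "\<lambda>x. f (x ` {..<Suc n}) * indicator {x. inj_on x {..<Suc n}} x"
  have ins: "insert n {..<n} = {..<Suc n}" by auto
  have g: "?g \<in> borel_measurable (lebesgue_tuples {..<Suc n})" by (rule measurable_tuple_config[OF _ f]) simp
  have "(\<integral>\<^sup>+ x. ?g x \<partial>lebesgue_tuples {..<Suc n}) = 0"
    using AE_tuples_of_lambda_LP_null[OF f 0, of "{..<Suc n}"] g
    by (subst nn_integral_0_iff_AE) (auto simp: indicator_def elim!: eventually_mono)
  moreover have "(\<integral>\<^sup>+ x. ?g x \<partial>lebesgue_tuples (insert n {..<n})) =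
     (\<integral>\<^sup>+ x. (\<integral>\<^sup>+ w. ?g (x(n := w)) \<partial>lborel) \<partial>lebesgue_tuples {..<n})"
    using g by (intro product_sigma_finite.product_nn_integral_insert[OF product_lborel]) (simp_all only: ins, auto)
  ultimately have 1: "(\<integral>\<^sup>+ x. (\<integral>\<^sup>+ w. ?g (x(n := w)) \<partial>lborel) \<partial>lebesgue_tuples {..<n}) = 0"
    by (simp add: ins)
  have upd: "(\<lambda>(x, w). x(n := w)) \<in> lebesgue_tuples {..<n} \<Otimes>\<^sub>M lborel \<rightarrow>\<^sub>M (lebesgue_tuples {..<Suc n} :: (nat \<Rightarrow> 'a) measure)"
    using measurable_add_dim[of n "{..<n}" "\<lambda>_. lborel"] by (simp add: ins)
  have m: "(\<lambda>(x, w). ?g (x(n := w))) \<in> borel_measurable (lebesgue_tuples {..<n} \<Otimes>\<^sub>M lborel)"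
    using measurable_compose[OF upd g] by (simp add: case_prod_beta)
  have m1: "(\<lambda>x. \<integral>\<^sup>+ w. ?g (x(n := w)) \<partial>lborel) \<in> borel_measurable (lebesgue_tuples {..<n})"
    by (rule lborel.borel_measurable_nn_integral[OF m])
  have "AE x in lebesgue_tuples {..<n}. (\<integral>\<^sup>+ w. ?g (x(n := w)) \<partial>lborel) = 0"
    using 1 by (simp only: nn_integral_0_iff_AE[OF m1])
  then show ?thesis
  proof (rule AE_mp[OF _ AE_I2], intro impI)
    fix x :: "nat \<Rightarrow> 'a" assume xs: "x \<in> space (lebesgue_tuples {..<n})"
      and i0: "(\<integral>\<^sup>+ w. ?g (x(n := w)) \<partial>lborel) = 0" and inj: "inj_on x {..<n}"
    have "(\<lambda>w. ?g (x(n := w))) \<in> borel_measurable lborel"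
      using measurable_Pair2[OF m xs] by simp
    then have "AE w in lborel. ?g (x(n := w)) = 0" using i0 by (simp only: nn_integral_0_iff_AE)
    moreover have "AE w in lborel. w \<notin> x ` {..<n}"
      by (intro AE_not_in finite_imp_null_set_lborel) simp
    ultimately show "AE w in lborel. f (insert w (x ` {..<n})) = 0"
    proof eventually_elim
      case (elim w)
      have im: "(x(n := w)) ` {..<n} = x ` {..<n}" by auto
      define z where "z = x(n := w)"
      have "inj_on z {..<Suc n}"
        unfolding lessThan_Suc z_def using inj elim(2) by (auto simp: inj_on_def)
      moreover have "z ` {..<Suc n} = insert w (x ` {..<n})"
        unfolding lessThan_Suc image_insert z_def im by simp
      ultimately show ?case using elim(1) unfolding z_def[symmetric] by simp
    qed
  qed
qed

text \<open>The configurations with \<open>n\<close> points in a ball of radius \<open>R\<close> have finite measure, bounded by the \<open>n\<close>-th power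
of the volume of the ball. That all points lie in the ball is expressed by counts, which makes the
set measurable.\<close>

lemma sigma_finite_lambda_LP: "sigma_finite_measure (lambda_LP :: 'a::euclidean_space set measure)"
proof
  let ?G = "Gamma0_borel :: 'a set measure"
  define A where "A = (\<lambda>(n, R :: nat). {\<omega> \<in> space ?G. card \<omega> = n \<and> card (\<omega> \<inter> ball 0 (real R)) = n})"
  have A: "A p \<in> sets ?G" for p
  proof -
    have "{\<omega> \<in> space ?G. card (\<omega> \<inter> ball 0 (real R)) = n} \<in> sets ?G" for n R
      using measurable_count_open[of "ball 0 (real R) :: 'a set"] by measurable
    moreover have "{\<omega> \<in> space ?G. card \<omega> = n} \<in> sets ?G" for n using measurable_card by measurable
    ultimately show ?thesis unfolding A_def by (cases p) (auto intro: sets.sets_Collect_conj)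
  qed
  have fin: "emeasure lambda_LP (A (n, R)) \<noteq> \<infinity>" for n R
  proof -
    let ?b = "emeasure lborel (ball (0::'a) (real R)) ^ n"
    have b: "?b < \<infinity>" using emeasure_lborel_ball_finite[of "0::'a" "real R"] by (simp add: power_less_top_ennreal less_top)
    have k: "(\<integral>\<^sup>+ \<eta>. indicator (A (n, R)) \<eta> \<partial>lebesgue_image k) \<le> (if k = n then ?b else 0)" for k
    proof -
      have "(\<integral>\<^sup>+ \<eta>. indicator (A (n, R)) \<eta> \<partial>lebesgue_image k) \<le>
        (\<integral>\<^sup>+ x. (if k = n then indicator (Pi\<^sub>E {..<k} (\<lambda>_. ball (0::'a) (real R))) x else 0) \<partial>lebesgue_tuples {..<k})"
        using A unfolding nn_integral_lebesgue_image[OF borel_measurable_indicator[OF A]]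
      proof (intro nn_integral_mono)
        fix x :: "nat \<Rightarrow> 'a" assume x: "x \<in> space (lebesgue_tuples {..<k})"
        show "indicator (A (n, R)) (x ` {..<k}) * indicator {x. inj_on x {..<k}} x
          \<le> (if k = n then indicator (Pi\<^sub>E {..<k} (\<lambda>_. ball (0::'a) (real R))) x else (0::ennreal))"
        proof (cases "x ` {..<k} \<in> A (n, R) \<and> inj_on x {..<k}")
          case True
          then have c: "card (x ` {..<k}) = n" "card (x ` {..<k} \<inter> ball 0 (real R)) = n" "card (x ` {..<k}) = k"
            by (auto simp: A_def card_image)
          then have "x ` {..<k} \<inter> ball 0 (real R) = x ` {..<k}"
            by (intro card_subset_eq) auto
          then have "x \<in> Pi\<^sub>E {..<k} (\<lambda>_. ball 0 (real R))" using x by (auto simp: space_PiM PiE_iff)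
          then show ?thesis using c by (auto simp: indicator_def)
        qed (auto simp: indicator_def)
      qed
      also have "\<dots> = (if k = n then ?b else 0)"
        by (auto simp: product_sigma_finite.emeasure_PiM[OF product_lborel])
      finally show ?thesis .
    qed
    have "emeasure lambda_LP (A (n, R)) = (\<integral>\<^sup>+ \<eta>. indicator (A (n, R)) \<eta> \<partial>lambda_LP)"
      using A by simp
    also have "\<dots> \<le> 1 + (\<Sum>k. ennreal (1 / fact (Suc k)) * (if Suc k = n then ?b else 0))"
      unfolding nn_integral_lambda_LP[OF borel_measurable_indicator[OF A]]
      by (intro add_mono suminf_le mult_left_mono k) (auto simp: indicator_def)
    also have "(\<Sum>k. ennreal (1 / fact (Suc k)) * (if Suc k = n then ?b else 0)) =
       (\<Sum>k\<in>{n - 1}. ennreal (1 / fact (Suc k)) * (if Suc k = n then ?b else 0))"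
      by (rule suminf_finite) auto
    also have "1 + \<dots> < \<infinity>" using b by (auto simp: ennreal_mult_less_top)
    finally show ?thesis by simp
  qed
  have "\<omega> \<in> (\<Union>p. A p)" if "\<omega> \<in> space ?G" for \<omega>
  proof -
    have f: "finite \<omega>" using that by (simp add: space_Gamma0_borel Gamma0_def)
    obtain R where "Max (insert 0 (norm ` \<omega>)) < real R" using reals_Archimedean2 by blast
    then have "\<omega> \<inter> ball 0 (real R) = \<omega>" using f by (auto simp: Max_less_iff)
    then have "\<omega> \<in> A (card \<omega>, R)" using that by (simp add: A_def)
    then show ?thesis by blast
  qed
  then show "\<exists>A. countable A \<and> A \<subseteq> sets lambda_LP \<and> \<Union> A = space (lambda_LP :: 'a set measure) \<and> (\<forall>a\<in>A. emeasure lambda_LP a \<noteq> \<infinity>)"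
    using A fin sets.sets_into_space[OF A]
    by (intro exI[of _ "range A"]) (auto simp: space_Gamma0_borel, blast)
qed

section \<open>Invariance of densities\<close>

context dieckmann_law begin

text \<open>Deaths are covered by removing a coordinate, births by inserting one: the newborn point \<open>y - v\<close> has a law
that is absolutely continuous with respect to Lebesgue measure.\<close>

lemma Qint_lambda_LP_null:
  assumes g: "g \<in> borel_measurable Gamma0_borel" and 0: "(\<integral>\<^sup>+ \<eta>. g \<eta> \<partial>lambda_LP) = 0"
  shows "(\<integral>\<^sup>+ \<eta>. Qint t \<eta> g \<partial>lambda_LP) = 0"
proof -
  have m: "(\<lambda>\<eta>. Qint t \<eta> g) \<in> borel_measurable Gamma0_borel"
    using g by (intro measurable_Qint) auto
  have "AE x in lebesgue_tuples {..<n}. inj_on x {..<n} \<longrightarrow> Qint t (x ` {..<n}) g = 0" for n :: nat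
  proof -
    have "AE x in lebesgue_tuples {..<n}. \<forall>i\<in>{..<n}. inj_on x {..<n} \<longrightarrow> g (x ` {..<n} - {x i}) = 0"
      using AE_remove_of_lambda_LP_null[OF g 0, of "{..<n}"] by (intro AE_finite_allI) auto
    with AE_insert_of_lambda_LP_null[OF g 0, of n] show ?thesis
    proof eventually_elim
      case (elim x)
      show ?case
      proof
        assume inj: "inj_on x {..<n}"
        have fin: "finite (x ` {..<n})" by simp
        have d: "g (x ` {..<n} - {y}) = 0" if "y \<in> x ` {..<n}" for y using elim(2) inj that by blast
        have b: "(\<integral>\<^sup>+ v. g (insert (y - v) (x ` {..<n})) \<partial>\<alpha>) = 0" for y
        proof -
          have "AE w in distr lborel borel (\<lambda>v. y - v). g (insert w (x ` {..<n})) = 0"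
            unfolding lborel_reflect using elim(1) inj by blast
          then have "AE v in lborel. g (insert (y - v) (x ` {..<n})) = 0"
            by (rule AE_distrD[rotated]) simp
          then have "AE v in \<alpha>. g (insert (y - v) (x ` {..<n})) = 0"
            by (intro absolutely_continuous_AE[OF _ \<alpha>_continuous]) simp_all
          then have "(\<integral>\<^sup>+ v. g (insert (y - v) (x ` {..<n})) \<partial>\<alpha>) = (\<integral>\<^sup>+ v. 0 \<partial>\<alpha>)"
            by (rule nn_integral_cong_AE)
          then show ?thesis by simp
        qed
        show "Qint t (x ` {..<n}) g = 0" unfolding Qint_def using d b by (simp del: image_eqI)
      qed
    qed
  qed
  then show ?thesis unfolding nn_integral_lambda_LP_eq_0_iff[OF m] by blast
qed

lemma AE_lambda_LP_eq_0:
  fixes f :: "'a set \<Rightarrow> ennreal"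
  assumes f: "f \<in> borel_measurable Gamma0_borel" and 0: "(\<integral>\<^sup>+ \<eta>. f \<eta> \<partial>lambda_LP) = 0"
  shows "AE \<eta> in lambda_LP. f \<eta> = 0"
proof -
  have "f \<in> borel_measurable lambda_LP" using f measurable_cong_sets[OF sets_lambda_LP refl] by blast
  from nn_integral_0_iff_AE[OF this] 0 show ?thesis by simp
qed

text \<open>For each fixed time the integrand of the recursion vanishes almost everywhere, by the previous step;
Tonelli's theorem exchanges the exceptional null sets with the time integral.\<close>

lemma Pint_lambda_LP_null:
  assumes f: "f \<in> borel_measurable Gamma0_borel" and null: "(\<integral>\<^sup>+ \<eta>. f \<eta> \<partial>lambda_LP) = 0"
  shows "(\<integral>\<^sup>+ \<eta>. Pint n t f s \<eta> \<partial>lambda_LP) = 0"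
proof (induction n arbitrary: s)
  case 0
  have "AE \<eta> in lambda_LP. f \<eta> = 0" by (rule AE_lambda_LP_eq_0[OF f null])
  then have "(\<integral>\<^sup>+ \<eta>. Pint 0 t f s \<eta> \<partial>lambda_LP) = (\<integral>\<^sup>+ \<eta>. 0 \<partial>(lambda_LP :: 'a set measure))"
    by (intro nn_integral_cong_AE) (auto elim!: eventually_mono)
  then show ?case by simp
next
  case (Suc n)
  interpret LP: sigma_finite_measure "lambda_LP :: 'a set measure" by (rule sigma_finite_lambda_LP)
  interpret pair_sigma_finite "lborel :: real measure" "lambda_LP :: 'a set measure" ..
  have "Pint (Suc n) t f s \<eta> = (\<integral>\<^sup>+ r. ennreal (survival s r \<eta>) * Qint r \<eta> (Pint n t f r) * indicator {s..t} r \<partial>lborel)"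
    if "\<eta> \<in> Gamma0" for \<eta> using Pint_Suc[OF that measurable_Pint[OF f]] .
  then have "(\<integral>\<^sup>+ \<eta>. Pint (Suc n) t f s \<eta> \<partial>lambda_LP) =
     (\<integral>\<^sup>+ \<eta>. (\<integral>\<^sup>+ r. ennreal (survival s r \<eta>) * Qint r \<eta> (Pint n t f r) * indicator {s..t} r \<partial>lborel) \<partial>lambda_LP)"
    by (intro nn_integral_cong) simp
  also have "\<dots> = (\<integral>\<^sup>+ r. (\<integral>\<^sup>+ \<eta>. ennreal (survival s r \<eta>) * Qint r \<eta> (Pint n t f r) * indicator {s..t} r \<partial>lambda_LP) \<partial>lborel)"
  proof (rule Fubini')
    have 1: "(\<lambda>(y, \<omega>). Pint n t f (fst y) \<omega>) \<in>
        borel_measurable (((borel :: real measure) \<Otimes>\<^sub>M (Gamma0_borel :: 'a set measure)) \<Otimes>\<^sub>M Gamma0_borel)"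
    proof -
      have "(\<lambda>y. (fst (fst y), snd y)) \<in>
          ((borel :: real measure) \<Otimes>\<^sub>M (Gamma0_borel :: 'a set measure)) \<Otimes>\<^sub>M Gamma0_borel \<rightarrow>\<^sub>M borel \<Otimes>\<^sub>M Gamma0_borel"
        by measurable
      from measurable_compose[OF this measurable_Pint_pair[OF f]] show ?thesis by (simp add: case_prod_beta)
    qed
    have [measurable]: "(\<lambda>y. Qint (fst y) (snd y) (Pint n t f (fst y))) \<in> borel_measurable ((borel :: real measure) \<Otimes>\<^sub>M Gamma0_borel)"
      by (rule measurable_Qint[where g="\<lambda>y. Pint n t f (fst y)", OF _ _ 1]) measurable
    have [measurable]: "(\<lambda>y. survival s (fst y) (snd y)) \<in> borel_measurable ((borel :: real measure) \<Otimes>\<^sub>M Gamma0_borel)"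
      by (rule measurable_survival) measurable
    have m: "(\<lambda>y. ennreal (survival s (fst y) (snd y)) * Qint (fst y) (snd y) (Pint n t f (fst y)) * indicator {s..t} (fst y))
      \<in> borel_measurable ((borel :: real measure) \<Otimes>\<^sub>M Gamma0_borel)" by measurable
    have eq: "sets ((borel :: real measure) \<Otimes>\<^sub>M (Gamma0_borel :: 'a set measure)) = sets (lborel \<Otimes>\<^sub>M lambda_LP)"
      by (intro sets_pair_measure_cong) simp_all
    show "(\<lambda>(r, \<eta>). ennreal (survival s r \<eta>) * Qint r \<eta> (Pint n t f r) * indicator {s..t} r)
      \<in> borel_measurable (lborel \<Otimes>\<^sub>M lambda_LP)"
      using m unfolding measurable_cong_sets[OF eq refl] case_prod_beta .
  qed
  also have "\<dots> = (\<integral>\<^sup>+ r. 0 \<partial>(lborel :: real measure))"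
  proof (intro nn_integral_cong)
    fix r
    have "(\<lambda>\<eta>. Qint r \<eta> (Pint n t f r)) \<in> borel_measurable Gamma0_borel"
      using measurable_Pint[OF f] by (intro measurable_Qint) auto
    then have "AE \<eta> in lambda_LP. Qint r \<eta> (Pint n t f r) = 0"
      by (rule AE_lambda_LP_eq_0) (rule Qint_lambda_LP_null[OF measurable_Pint[OF f] Suc])
    then have "(\<integral>\<^sup>+ \<eta>. ennreal (survival s r \<eta>) * Qint r \<eta> (Pint n t f r) * indicator {s..t} r \<partial>lambda_LP) =
        (\<integral>\<^sup>+ \<eta>. 0 \<partial>(lambda_LP :: 'a set measure))"
      by (intro nn_integral_cong_AE) (auto elim!: eventually_mono)
    then show "(\<integral>\<^sup>+ \<eta>. ennreal (survival s r \<eta>) * Qint r \<eta> (Pint n t f r) * indicator {s..t} r \<partial>lambda_LP) = 0" by simp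
  qed
  finally show ?case by simp
qed

lemma transport_density:
  assumes R: "integrable lambda_LP R" and st: "s \<le> t"
  obtains D where "integrable lambda_LP D"
    "\<And>A. A \<in> sets Gamma0_borel \<Longrightarrow>
       measure (transport t s (density lambda_LP (\<lambda>x. ennreal (R x)))) A = (LINT \<eta>:A|lambda_LP. D \<eta>)"
proof -
  let ?M = "density lambda_LP (\<lambda>x. ennreal (R x)) :: 'a set measure"
  let ?N = "transport t s ?M"
  interpret LP: sigma_finite_measure "lambda_LP :: 'a set measure" by (rule sigma_finite_lambda_LP)
  have M: "sets ?M = sets Gamma0_borel" by simp
  have N: "finite_measure ?N"
    using R st by (intro finite_measure_transport finite_measure_density_integrable M)
  have ac: "absolutely_continuous lambda_LP ?N"
    unfolding absolutely_continuous_def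
  proof
    fix A :: "'a set set" assume A: "A \<in> null_sets lambda_LP"
    then have As: "A \<in> sets Gamma0_borel" and A0: "(\<integral>\<^sup>+ \<eta>. indicator A \<eta> \<partial>lambda_LP) = 0"
      by (auto simp: null_sets_def)
    have jt: "AE \<eta> in lambda_LP. Pint n t (indicator A) s \<eta> = 0" for n
      using As A0 by (intro AE_lambda_LP_eq_0 Pint_lambda_LP_null measurable_Pint) auto
    then have "AE \<eta> in lambda_LP. \<forall>n. Pint n t (indicator A) s \<eta> = 0" by (simp add: AE_all_countable)
    then have "AE \<eta> in lambda_LP. P_min Q s \<eta> t A = 0"
      unfolding P_min_eq by eventually_elim simp
    then have "AE \<eta> in ?M. P_min Q s \<eta> t A = 0"
      using R by (auto simp: AE_density elim!: eventually_mono)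
    then have "(\<integral>\<^sup>+ \<eta>. P_min Q s \<eta> t A \<partial>?M) = (\<integral>\<^sup>+ \<eta>. 0 \<partial>?M)" by (rule nn_integral_cong_AE)
    then show "A \<in> null_sets ?N" using As by (simp add: null_sets_def emeasure_transport[OF M As])
  qed
  have sN: "sets ?N = sets lambda_LP" by simp
  obtain D where D: "D \<in> borel_measurable lambda_LP" "AE x in lambda_LP. RN_deriv lambda_LP ?N x = ennreal (D x)"
    "\<And>x. 0 \<le> D x"
    by (rule LP.real_RN_deriv[OF N ac sN]) (rule that)
  have dens: "?N = density lambda_LP (\<lambda>x. ennreal (D x))"
  proof -
    have "density lambda_LP (RN_deriv lambda_LP ?N) = density lambda_LP (\<lambda>x. ennreal (D x))"
      using D(1,2) by (intro density_cong) auto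
    then show ?thesis using LP.density_RN_deriv[OF ac sN] by simp
  qed
  have e: "emeasure ?N A = (\<integral>\<^sup>+ \<eta>. ennreal (indicator A \<eta> *\<^sub>R D \<eta>) \<partial>lambda_LP)" if "A \<in> sets Gamma0_borel" for A
    unfolding dens using that D(1)
    by (subst emeasure_density) (auto intro!: nn_integral_cong split: split_indicator)
  have iD: "integrable lambda_LP D"
  proof (rule integrableI_nonneg)
    have "(\<integral>\<^sup>+ \<eta>. ennreal (D \<eta>) \<partial>lambda_LP) = emeasure ?N (space (lambda_LP :: 'a set measure))"
      unfolding dens using D(1)
      by (subst emeasure_density)
        (use sets.top[of "lambda_LP :: 'a set measure"] in \<open>auto simp del: space_lambda_LP intro!: nn_integral_cong\<close>)
    then show "(\<integral>\<^sup>+ \<eta>. ennreal (D \<eta>) \<partial>lambda_LP) < \<infinity>"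
      using finite_measure.emeasure_finite[OF N] by (simp add: less_top[symmetric])
  qed (use D in auto)
  show thesis
  proof (rule that[OF iD])
    fix A :: "'a set set" assume A: "A \<in> sets Gamma0_borel"
    have "(\<integral>\<^sup>+ \<eta>. ennreal (indicator A \<eta> *\<^sub>R D \<eta>) \<partial>lambda_LP) = ennreal (LINT \<eta>:A|lambda_LP. D \<eta>)"
      unfolding set_lebesgue_integral_def using A iD D(3)
      by (intro nn_integral_eq_integral integrable_mult_indicator) auto
    moreover have "0 \<le> (LINT \<eta>:A|lambda_LP. D \<eta>)"
      unfolding set_lebesgue_integral_def using D(3) by (intro Bochner_Integration.integral_nonneg) simp
    ultimately show "measure ?N A = (LINT \<eta>:A|lambda_LP. D \<eta>)"
      unfolding measure_def e[OF A] by simp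
  qed
qed

theorem densities_invariant:
  assumes R: "integrable lambda_LP R" and st: "s \<le> t"
  shows "\<exists>R'. integrable lambda_LP R' \<and> (\<forall>A\<in>sets Gamma0_borel.
    U_star Q t s (\<lambda>A. LINT \<eta>:A|lambda_LP. R \<eta>) A = (LINT \<eta>:A|lambda_LP. R' \<eta>))"
proof -
  obtain D1 where D1: "integrable lambda_LP D1" "\<And>A. A \<in> sets Gamma0_borel \<Longrightarrow>
       measure (transport t s (density lambda_LP (\<lambda>x. ennreal (R x)))) A = (LINT \<eta>:A|lambda_LP. D1 \<eta>)"
    using transport_density[OF R st] by blast
  have "integrable lambda_LP (\<lambda>x. - R x)" using R by simp
  then obtain D2 where D2: "integrable lambda_LP D2" "\<And>A. A \<in> sets Gamma0_borel \<Longrightarrow>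
       measure (transport t s (density lambda_LP (\<lambda>x. ennreal (- R x)))) A = (LINT \<eta>:A|lambda_LP. D2 \<eta>)"
    using transport_density[OF _ st] by blast
  show ?thesis
  proof (intro exI conjI ballI)
    show "integrable lambda_LP (\<lambda>\<eta>. D1 \<eta> - D2 \<eta>)" using D1(1) D2(1) by simp
    fix A :: "'a set set" assume A: "A \<in> sets Gamma0_borel"
    have "U_star Q t s (\<lambda>A. LINT \<eta>:A|lambda_LP. R \<eta>) A = (LINT \<eta>:A|lambda_LP. D1 \<eta>) - (LINT \<eta>:A|lambda_LP. D2 \<eta>)"
      using U_star_eq_transport[OF _ R _ A st] D1(2)[OF A] D2(2)[OF A] by simp
    also have "\<dots> = (LINT \<eta>:A|lambda_LP. D1 \<eta> - D2 \<eta>)"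
      using D1(1) D2(1) A unfolding set_integrable_def
      by (intro set_integral_diff(2)[symmetric, unfolded set_integrable_def] integrable_mult_indicator) auto
    finally show "U_star Q t s (\<lambda>A. LINT \<eta>:A|lambda_LP. R \<eta>) A = (LINT \<eta>:A|lambda_LP. D1 \<eta> - D2 \<eta>)" .
  qed
qed

end

section \<open>The Dieckmann-Law model\<close>

text \<open>Only times after \<open>s\<close> enter the recursion.\<close>

lemma P_n_cong_nonneg_times:
  assumes eq: "\<And>r \<eta>. 0 \<le> r \<Longrightarrow> Q r \<eta> = Q' r \<eta>" and "0 \<le> s"
  shows "P_n n Q s \<eta> t A = P_n n Q' s \<eta> t A"
proof -
  have rate: "(LINT r:{s..t}|lborel. total_rate Q r \<eta>) = (LINT r:{s..t}|lborel. total_rate Q' r \<eta>)"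
    if "0 \<le> s" for s t \<eta>
    using that unfolding set_lebesgue_integral_def total_rate_def
    by (intro Bochner_Integration.integral_cong) (auto simp: eq indicator_def)
  show ?thesis
    using \<open>0 \<le> s\<close>
  proof (induction n arbitrary: s \<eta>)
    case (Suc n)
    have "P_n n Q r \<omega> t A = P_n n Q' r \<omega> t A" if "r \<in> {s..t}" for r \<omega>
      using Suc that by auto
    then show ?case
      using Suc.prems by (auto simp: rate eq intro!: nn_integral_cong split: split_indicator)
  qed (simp add: rate)
qed

lemma U_star_cong_nonneg_times:
  assumes "\<And>r \<eta>. 0 \<le> r \<Longrightarrow> Q r \<eta> = Q' r \<eta>" and "0 \<le> s"
  shows "U_star Q t s \<nu> A = U_star Q' t s \<nu> A"
  unfolding U_star_def P_min_def by (simp add: P_n_cong_nonneg_times[of Q Q', OF assms])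

theorem theorem3p6:
  fixes m l :: "real \<Rightarrow> real"
    and am bp ap :: "'a::euclidean_space \<Rightarrow> real"
    and Q :: "real \<Rightarrow> 'a set \<Rightarrow> 'a set measure"
    and q :: "real \<Rightarrow> 'a set \<Rightarrow> real"
    and V :: "'a set \<Rightarrow> real"
  assumes m: "continuous_on {0..} m" "\<And>t. t \<ge> 0 \<Longrightarrow> m t \<ge> 0"
    and l: "continuous_on {0..} l" "\<And>t. t \<ge> 0 \<Longrightarrow> l t \<ge> 0"
    and am: "continuous_on UNIV am" "bounded (range am)" "\<And>x. am x \<ge> 0"
    and bp: "continuous_on UNIV bp" "bounded (range bp)" "\<And>x. bp x \<ge> 0"
    and ap: "ap \<in> borel_measurable lebesgue" "\<And>x. ap x \<ge> 0"
      "(\<integral>\<^sup>+ x. ennreal (ap x) \<partial>lebesgue) = 1"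
    and stable: "\<exists>b\<ge>0. \<forall>\<eta>\<in>Gamma0.
      (\<Sum>x\<in>\<eta>. \<Sum>y\<in>\<eta> - {x}. am (x - y) - bp (x - y)) \<ge> - b * real (card \<eta>)"
    and dominated: "\<And>\<Lambda>. compact \<Lambda> \<Longrightarrow>
      \<exists>astar :: 'a \<Rightarrow> real. integrable lebesgue astar \<and> (\<forall>x\<in>\<Lambda>. \<forall>w. ap (x - w) \<le> astar w)"
    and Q: "Q = DL_kernel m l am bp ap"
    and q: "q = total_rate Q"
    and V: "V = (\<lambda>\<eta>. real (card \<eta>) + (real (card \<eta>))\<^sup>2)"
  shows
    "\<comment> \<open>(A)\<close>
     (\<forall>\<epsilon>>0. \<forall>T>0. \<forall>B. compactin Gamma0_topology B \<longrightarrow>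
        (\<exists>A. compactin Gamma0_topology A \<and>
          (\<forall>\<eta>\<in>B. (\<integral>\<^sup>+ r\<in>{0..T}. emeasure (Q r \<eta>) (Gamma0 - A) \<partial>lborel) < ennreal \<epsilon>))) \<and>
     \<comment> \<open>(B)\<close>
     (\<exists>c. continuous_on {0..} c \<and> (\<forall>t\<ge>0. c t \<ge> 0) \<and>
        (\<forall>t\<ge>0. \<forall>\<eta>\<in>Gamma0.
          (\<integral>\<^sup>+ \<omega>. ennreal (V \<omega>) \<partial>Q t \<eta>) \<le> ennreal (c t * V \<eta> + q t \<eta> * V \<eta>))) \<and>
     \<comment> \<open>(C)\<close>
     (\<forall>F. continuous_map Gamma0_topology euclideanreal F \<and>
          bdd_above ((\<lambda>\<eta>. \<bar>F \<eta>\<bar> / (1 + V \<eta>)) ` Gamma0) \<longrightarrow>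
        (\<forall>t\<ge>0. \<forall>\<eta>\<in>Gamma0. integrable (Q t \<eta>) F) \<and>
        continuous_map (prod_topology (top_of_set {0..}) Gamma0_topology) euclideanreal
          (\<lambda>(t, \<eta>). LINT \<omega>|Q t \<eta>. F \<omega>)) \<and>
     \<comment> \<open>(D)\<close>
     (\<forall>T>0. \<exists>a>0. \<forall>\<eta>\<in>Gamma0. \<forall>t\<in>{0..T}. q t \<eta> \<le> a * V \<eta>) \<and>
     \<comment> \<open>moments\<close>
     (\<forall>n\<ge>1. \<forall>\<mu>. prob_space \<mu> \<and> sets \<mu> = sets Gamma0_borel \<and>
          (\<integral>\<^sup>+ \<eta>. ennreal (real (card \<eta>) ^ n) \<partial>\<mu>) < \<infinity> \<longrightarrow>
        (\<forall>s t. 0 \<le> s \<and> s \<le> t \<longrightarrow>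
          (\<exists>\<nu>. finite_measure \<nu> \<and> sets \<nu> = sets Gamma0_borel \<and>
            (\<forall>A\<in>sets Gamma0_borel. measure \<nu> A = U_star Q t s (measure \<mu>) A) \<and>
            (\<integral>\<^sup>+ \<eta>. ennreal (real (card \<eta>) ^ n) \<partial>\<nu>) < \<infinity>))) \<and>
     ((\<forall>t\<ge>0. m t > 0 \<and> l t > 0) \<longrightarrow>
        \<comment> \<open>(E)\<close>
        (\<forall>T>0. \<exists>b>0. \<forall>\<eta>\<in>Gamma0. \<forall>t\<in>{0..T}. q t \<eta> \<ge> b * q T \<eta>) \<and>
        \<comment> \<open>invariance of the densities\<close>
        (\<forall>s t. 0 \<le> s \<and> s \<le> t \<longrightarrow>
          (\<forall>R. integrable lambda_LP R \<longrightarrow>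
            (\<exists>R'. integrable lambda_LP R' \<and>
              (\<forall>A\<in>sets Gamma0_borel.
                U_star Q t s (\<lambda>A. LINT \<eta>:A|lambda_LP. R \<eta>) A = (LINT \<eta>:A|lambda_LP. R' \<eta>))))))"
proof -
  \<comment> \<open>Constant extension to negative times, which the evolution from \<open>s \<ge> 0\<close> never sees.\<close>
  define m' where "m' = (\<lambda>t. m (max 0 t))"
  define l' where "l' = (\<lambda>t. l (max 0 t))"
  obtain amax where amax: "\<And>x. am x \<le> amax"
    using am(2) unfolding bounded_iff by (metis UNIV_I abs_le_D1 imageI real_norm_def)
  obtain bmax where bmax: "\<And>x. bp x \<le> bmax"
    using bp(2) unfolding bounded_iff by (metis UNIV_I abs_le_D1 imageI real_norm_def)
  obtain b where b: "b \<ge> 0" "\<And>\<eta> :: 'a set. finite \<eta> \<Longrightarrow>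
      - b * real (card \<eta>) \<le> (\<Sum>x\<in>\<eta>. \<Sum>y\<in>\<eta> - {x}. am (x - y) - bp (x - y))"
    using stable unfolding Gamma0_def by blast
  obtain \<alpha> where \<alpha>: "prob_space \<alpha>" "sets \<alpha> = sets borel" "absolutely_continuous lborel \<alpha>"
    "\<And>h x. h \<in> borel_measurable borel \<Longrightarrow>
       (\<integral>\<^sup>+ w. h w * ennreal (ap (x - w)) \<partial>lebesgue) = (\<integral>\<^sup>+ v. h (x - v) \<partial>\<alpha>)"
    using displacement_law[OF ap(1,3)] by blast
  have cont: "continuous_on UNIV (\<lambda>t. f (max 0 t))" if "continuous_on {0..} f" for f :: "real \<Rightarrow> real"
    by (rule continuous_on_compose2[OF that]) (auto intro!: continuous_intros)
  interpret \<alpha>: prob_space \<alpha> by (rule \<alpha>(1))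
  interpret DL: stable_dieckmann_law \<alpha> m' l' am bp ap amax bmax b
    using \<alpha>(2-4) m l am bp amax bmax b cont[OF m(1)] cont[OF l(1)]
    by unfold_locales (simp_all add: m'_def l'_def)
  have Q': "Q t \<eta> = DL_kernel m' l' am bp ap t \<eta>" if "0 \<le> t" for t \<eta>
    using that by (simp add: Q DL_kernel_def DL_rate_def[abs_def] m'_def l'_def)
  have q': "q t \<eta> = DL.jump_rate t \<eta>" if "0 \<le> t" "\<eta> \<in> Gamma0" for t \<eta>
    using DL.total_rate_Q[OF that(2)] Q'[OF that(1)] by (simp add: q total_rate_def)
  have U': "U_star Q t s \<nu> A = U_star (DL_kernel m' l' am bp ap) t s \<nu> A" if "0 \<le> s" for t s \<nu> A
    using Q' that by (intro U_star_cong_nonneg_times) auto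
  have mV: "(\<lambda>\<omega>. ennreal (V \<omega>)) \<in> borel_measurable Gamma0_borel"
    unfolding V using measurable_card by measurable

  have A: "\<exists>A. compactin Gamma0_topology A \<and>
      (\<forall>\<eta>\<in>B. (\<integral>\<^sup>+ r\<in>{0..T}. emeasure (Q r \<eta>) (Gamma0 - A) \<partial>lborel) < ennreal \<epsilon>)"
    if "\<epsilon> > 0" "T > 0" "compactin Gamma0_topology B" for \<epsilon> T B
  proof -
    have "(\<integral>\<^sup>+ r\<in>{0..T}. emeasure (Q r \<eta>) (Gamma0 - A) \<partial>lborel) =
       (\<integral>\<^sup>+ r\<in>{0..T}. emeasure (DL_kernel m' l' am bp ap r \<eta>) (Gamma0 - A) \<partial>lborel)" for \<eta> A
      by (intro nn_integral_cong) (auto simp: Q' split: split_indicator)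
    then show ?thesis using DL.Q_tight[OF that] by simp
  qed
  have B: "\<exists>c. continuous_on {0..} c \<and> (\<forall>t\<ge>0. c t \<ge> 0) \<and>
        (\<forall>t\<ge>0. \<forall>\<eta>\<in>Gamma0.
          (\<integral>\<^sup>+ \<omega>. ennreal (V \<omega>) \<partial>Q t \<eta>) \<le> ennreal (c t * V \<eta> + q t \<eta> * V \<eta>))"
  proof (intro exI conjI allI impI ballI)
    show "continuous_on {0..} (\<lambda>t. 4 * l t + 2 * b + 2 * bmax)"
      by (intro continuous_intros l(1))
    show "0 \<le> 4 * l t + 2 * b + 2 * bmax" if "t \<ge> 0" for t
      using l(2)[OF that] b(1) DL.bmax_nonneg by simp
    show "(\<integral>\<^sup>+ \<omega>. ennreal (V \<omega>) \<partial>Q t \<eta>) \<le> ennreal ((4 * l t + 2 * b + 2 * bmax) * V \<eta> + q t \<eta> * V \<eta>)"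
      if "t \<ge> 0" "\<eta> \<in> Gamma0" for t \<eta>
    proof -
      have "l' t = l t" using that(1) by (simp add: l'_def)
      then show ?thesis
        using DL.V_drift[OF that(2), of t] DL.nn_integral_Q[OF that(2) mV, of t]
        by (simp add: Q'[OF that(1)] q'[OF that] V)
    qed
  qed
  have C: "(\<forall>t\<ge>0. \<forall>\<eta>\<in>Gamma0. integrable (Q t \<eta>) F) \<and>
        continuous_map (prod_topology (top_of_set {0..}) Gamma0_topology) euclideanreal
          (\<lambda>(t, \<eta>). LINT \<omega>|Q t \<eta>. F \<omega>)"
    if F: "continuous_map Gamma0_topology euclideanreal F"
      and bdd: "bdd_above ((\<lambda>\<eta>. \<bar>F \<eta>\<bar> / (1 + V \<eta>)) ` Gamma0)" for F
  proof -
    obtain C where C: "\<And>\<eta>. \<eta> \<in> Gamma0 \<Longrightarrow> \<bar>F \<eta>\<bar> / (1 + V \<eta>) \<le> C"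
      using bdd unfolding bdd_above_def by blast
    have bound: "\<bar>F \<eta>\<bar> \<le> C * (1 + real (card \<eta>) + (real (card \<eta>))\<^sup>2)" if "\<eta> \<in> Gamma0" for \<eta>
    proof -
      have "0 < 1 + V \<eta>" by (simp add: V add_pos_nonneg)
      then show ?thesis using C[OF that] by (simp add: pos_divide_le_eq V add.assoc)
    qed
    have "continuous_map (prod_topology (top_of_set {0..}) Gamma0_topology) euclideanreal
          (\<lambda>(t, \<eta>). LINT \<omega>|DL_kernel m' l' am bp ap t \<eta>. F \<omega>)"
      by (rule DL.Q_continuous[OF F bound])
    then have "continuous_map (prod_topology (top_of_set {0..}) Gamma0_topology) euclideanreal
          (\<lambda>(t, \<eta>). LINT \<omega>|Q t \<eta>. F \<omega>)"
      by (rule continuous_map_eq) (auto simp: Q')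
    moreover have "integrable (Q t \<eta>) F" if "t \<ge> 0" "\<eta> \<in> Gamma0" for t \<eta>
      using DL.integrable_Q[OF measurable_continuous_config[OF F] that(2) bound] Q'[OF that(1)] by simp
    ultimately show ?thesis by blast
  qed
  have D: "\<exists>a>0. \<forall>\<eta>\<in>Gamma0. \<forall>t\<in>{0..T}. q t \<eta> \<le> a * V \<eta>" for T
    using DL.jump_rate_le_V[of 0 T] by (simp add: q' V)
  have mom: "\<exists>\<nu>. finite_measure \<nu> \<and> sets \<nu> = sets Gamma0_borel \<and>
            (\<forall>A\<in>sets Gamma0_borel. measure \<nu> A = U_star Q t s (measure \<mu>) A) \<and>
            (\<integral>\<^sup>+ \<eta>. ennreal (real (card \<eta>) ^ n) \<partial>\<nu>) < \<infinity>"
    if "prob_space \<mu>" "sets \<mu> = sets Gamma0_borel"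
      "(\<integral>\<^sup>+ \<eta>. ennreal (real (card \<eta>) ^ n) \<partial>\<mu>) < \<infinity>" "0 \<le> s" "s \<le> t" for n \<mu> s t
    using DL.moments_propagate[OF that(1-3,5)] by (simp add: U'[OF that(4)])
  have E: "\<exists>b>0. \<forall>\<eta>\<in>Gamma0. \<forall>t\<in>{0..T}. q t \<eta> \<ge> b * q T \<eta>"
    if "\<forall>t\<ge>0. m t > 0 \<and> l t > 0" "T > 0" for T
  proof -
    have "\<And>t. 0 < m' t" "\<And>t. 0 < l' t" using that(1) by (simp_all add: m'_def l'_def)
    from DL.jump_rate_lower_bound[OF this, of 0 T] that(2) show ?thesis by (simp add: q')
  qed
  have dens: "\<exists>R'. integrable lambda_LP R' \<and> (\<forall>A\<in>sets Gamma0_borel.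
      U_star Q t s (\<lambda>A. LINT \<eta>:A|lambda_LP. R \<eta>) A = (LINT \<eta>:A|lambda_LP. R' \<eta>))"
    if "0 \<le> s" "s \<le> t" "integrable lambda_LP R" for s t R
    using DL.densities_invariant[OF that(3,2)] by (simp add: U'[OF that(1)])
  show ?thesis
    by (intro conjI, use A in blast, rule B, use C in blast, use D in blast, use mom in blast,
        intro impI conjI, use E in blast, use dens in blast)
qed

end
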